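(* Suppose $v\in\mathbf{A}^{2\times n}$ has a uniform matroid of rank $2$. Then $I'_v=I_v$ and $R/I'_v$ is a Cohen--Macaulay ring.
   Context: $\mathbf{k}$ is an algebraically closed field of characteristic zero. With $r=2$, let $R=\mathbf{k}[x_{ij}: 1\le i\le r,\ 1\le j\le n]$ and $\mathbf{A}^{r\times n}=\operatorname{Spec}(R)$, the space of $r$-by-$n$ matrices. The matroid of $v$ is uniform of rank $2$ if every pair of columns of $v$ is linearly independent (and $n\ge 2$). The group $G=\mathrm{GL}_r(\mathbf{k})\times(\mathbf{k}^\times)^n$ acts on $\mathbf{A}^{r\times n}$ by row operations (left multiplication) and rescaling of columns. $X_v$ is the Zariski closure of the orbit $G\cdot v$, and $I_v\subset R$ is its prime ideal. $I'_v\subset R$ is the ideal generated by the size $|J|$ minors of the matrices $x_J\odot v_J^\perp$ for nonempty $J\subset\{1,\dots,n\}$, defined as follows. For $J=\{j_1<\dots<j_\ell\}$, $v_J$ is the submatrix of $v$ on the columns in $J$, and $v_J^\perp$ is any $(\ell-\operatorname{rk}(v_J))$-by-$\ell$ matrix whose rows form a basis of the right kernel of $v_J$. With $x_j$ the $j$-th column of $x=(x_{ij})$, the $i$-th column of $x_J\odot v_J^\perp$ is the tensor $x_{j_i}\otimes (v_J^\perp)_i\in R^r\otimes\mathbf{k}^{\ell-\operatorname{rk}(v_J)}$ in coordinates. If the columns of $v_J$ are independent, the matrix is interpreted as zero; if a matrix has fewer than $|J|$ rows, its size $|J|$ minors are regarded as zero. *)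

theory Defs
  imports
    "HOL-Library.Poly_Mapping"
    "HOL-Library.Extended_Nat"
    "HOL-Computational_Algebra.Polynomial"
    "HOL-Algebra.QuotRing"
    "HOL-Algebra.Ring_Divisibility"
    "Jordan_Normal_Form.Matrix_Kernel"
    "Jordan_Normal_Form.DL_Rank"
    "Jordan_Normal_Form.DL_Submatrix"
begin

section \<open>Cohen--Macaulay rings\<close>

text \<open>A chain \<open>P 0 \<subset> \<dots> \<subset> P k\<close> of prime ideals has length \<open>k\<close>.\<close>

definition krull_dim :: "('a, 'm) ring_scheme \<Rightarrow> enat" where
  "krull_dim A = Sup {enat k | k. \<exists>P :: nat \<Rightarrow> 'a set.
     (\<forall>i\<le>k. primeideal (P i) A) \<and> (\<forall>i<k. P i \<subset> P (Suc i))}"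

text \<open>The second conjunct says that \<open>xs ! i\<close> is not a zero divisor modulo the ideal generated by
  the preceding elements.\<close>

definition regular_sequence :: "('a, 'm) ring_scheme \<Rightarrow> 'a list \<Rightarrow> bool" where
  "regular_sequence A xs \<longleftrightarrow> set xs \<subseteq> carrier A \<and>
     (\<forall>i<length xs. \<forall>a\<in>carrier A.
        xs ! i \<otimes>\<^bsub>A\<^esub> a \<in> genideal A (set (take i xs)) \<longrightarrow> a \<in> genideal A (set (take i xs))) \<and>
     genideal A (set xs) \<noteq> carrier A"

definition depth :: "('a, 'm) ring_scheme \<Rightarrow> 'a set \<Rightarrow> enat" where
  "depth A \<mm> = Sup {enat (length xs) | xs. regular_sequence A xs \<and> set xs \<subseteq> \<mm>}"

definition cohen_macaulay_local :: "('a, 'm) ring_scheme \<Rightarrow> bool" where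
  "cohen_macaulay_local A \<longleftrightarrow> cring A \<and> noetherian_ring A \<and>
     (\<exists>!\<mm>. maximalideal \<mm> A) \<and> (\<forall>\<mm>. maximalideal \<mm> A \<longrightarrow> depth A \<mm> = krull_dim A)"

text \<open>The localization \<open>S\<inverse>A\<close>: the pair \<open>(a, s)\<close> represents the fraction \<open>a/s\<close>.\<close>

definition frac_rel :: "('a, 'm) ring_scheme \<Rightarrow> 'a set \<Rightarrow> (('a \<times> 'a) \<times> ('a \<times> 'a)) set" where
  "frac_rel A S = {((a, s), (b, t)). a \<in> carrier A \<and> b \<in> carrier A \<and> s \<in> S \<and> t \<in> S \<and>
     (\<exists>u\<in>S. u \<otimes>\<^bsub>A\<^esub> (a \<otimes>\<^bsub>A\<^esub> t \<ominus>\<^bsub>A\<^esub> b \<otimes>\<^bsub>A\<^esub> s) = \<zero>\<^bsub>A\<^esub>)}"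

definition localization :: "('a, 'm) ring_scheme \<Rightarrow> 'a set \<Rightarrow> ('a \<times> 'a) set ring" where
  "localization A S = \<lparr>
     carrier = (carrier A \<times> S) // frac_rel A S,
     mult = (\<lambda>X Y. \<Union>(a, s)\<in>X. \<Union>(b, t)\<in>Y. frac_rel A S `` {(a \<otimes>\<^bsub>A\<^esub> b, s \<otimes>\<^bsub>A\<^esub> t)}),
     one = frac_rel A S `` {(\<one>\<^bsub>A\<^esub>, \<one>\<^bsub>A\<^esub>)},
     zero = frac_rel A S `` {(\<zero>\<^bsub>A\<^esub>, \<one>\<^bsub>A\<^esub>)},
     add = (\<lambda>X Y. \<Union>(a, s)\<in>X. \<Union>(b, t)\<in>Y.
              frac_rel A S `` {(a \<otimes>\<^bsub>A\<^esub> t \<oplus>\<^bsub>A\<^esub> b \<otimes>\<^bsub>A\<^esub> s, s \<otimes>\<^bsub>A\<^esub> t)})\<rparr>"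

definition cohen_macaulay :: "('a, 'm) ring_scheme \<Rightarrow> bool" where
  "cohen_macaulay A \<longleftrightarrow> cring A \<and> noetherian_ring A \<and>
     (\<forall>\<mm>. maximalideal \<mm> A \<longrightarrow> cohen_macaulay_local (localization A (carrier A - \<mm>)))"


section \<open>The coordinate ring of the space of matrices\<close>

text \<open>Polynomials in indeterminates \<open>x\<^sub>i\<^sub>j\<close> with \<open>(i, j)\<close> ranging over all pairs of naturals: a
  monomial is a finitely supported map from index pairs to exponents.  Row and column indices start
  at \<open>0\<close>, as they do for the matrix type.  The ring \<open>R\<close> is the subring involving only
  \<open>x\<^sub>i\<^sub>j\<close> with \<open>i < r\<close> and \<open>j < n\<close>.\<close>

type_synonym 'k mpoly = "((nat \<times> nat) \<Rightarrow>\<^sub>0 nat) \<Rightarrow>\<^sub>0 'k"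

definition indet :: "nat \<Rightarrow> nat \<Rightarrow> 'k::comm_ring_1 mpoly" where
  "indet i j = Poly_Mapping.single (Poly_Mapping.single (i, j) 1) 1"

definition const_poly :: "'k::comm_ring_1 \<Rightarrow> 'k mpoly" where
  "const_poly c = Poly_Mapping.single 0 c"

definition coord_ring :: "nat \<Rightarrow> nat \<Rightarrow> 'k::comm_ring_1 mpoly ring" where
  "coord_ring r n = \<lparr>
     carrier = {p. \<forall>m\<in>Poly_Mapping.keys p. Poly_Mapping.keys m \<subseteq> {..<r} \<times> {..<n}},
     mult = (*), one = 1, zero = 0, add = (+)\<rparr>"

definition eval_at :: "'k::comm_ring_1 mat \<Rightarrow> 'k mpoly \<Rightarrow> 'k" where
  "eval_at y p = (\<Sum>m\<in>Poly_Mapping.keys p. Poly_Mapping.lookup p m *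
     (\<Prod>ij\<in>Poly_Mapping.keys m. (y $$ ij) ^ Poly_Mapping.lookup m ij))"

definition zero_locus :: "nat \<Rightarrow> nat \<Rightarrow> 'k::comm_ring_1 mpoly set \<Rightarrow> 'k mat set" where
  "zero_locus r n F = {y \<in> carrier_mat r n. \<forall>p\<in>F. eval_at y p = 0}"

definition zariski_closure :: "nat \<Rightarrow> nat \<Rightarrow> 'k::comm_ring_1 mat set \<Rightarrow> 'k mat set" where
  "zariski_closure r n Y =
     \<Inter>{zero_locus r n F | F. F \<subseteq> carrier (coord_ring r n) \<and> Y \<subseteq> zero_locus r n F}"

definition vanishing_ideal :: "nat \<Rightarrow> nat \<Rightarrow> 'k::comm_ring_1 mat set \<Rightarrow> 'k mpoly set" where
  "vanishing_ideal r n Y = {p \<in> carrier (coord_ring r n). \<forall>y\<in>Y. eval_at y p = 0}"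


section \<open>Matrix orbit closures\<close>

text \<open>Right multiplication by an invertible diagonal matrix rescales the columns.\<close>

definition orbit :: "nat \<Rightarrow> nat \<Rightarrow> 'k::field mat \<Rightarrow> 'k mat set" where
  "orbit r n v = {g * v * mat_diag n t | g t.
     g \<in> carrier_mat r r \<and> invertible_mat g \<and> (\<forall>j<n. t j \<noteq> 0)}"

definition orbit_closure :: "nat \<Rightarrow> nat \<Rightarrow> 'k::field mat \<Rightarrow> 'k mat set" where
  "orbit_closure r n v = zariski_closure r n (orbit r n v)"

definition orbit_ideal :: "nat \<Rightarrow> nat \<Rightarrow> 'k::field mat \<Rightarrow> 'k mpoly set" where
  "orbit_ideal r n v = vanishing_ideal r n (orbit_closure r n v)"

text \<open>Independence of a family of columns, not just of the set of its values: a repeated column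
  is a dependency, hence the injectivity condition.\<close>

definition columns_independent :: "'k::field mat \<Rightarrow> nat set \<Rightarrow> bool" where
  "columns_independent v J \<longleftrightarrow> inj_on (col v) J \<and>
     \<not> module.lin_dep class_ring (module_vec TYPE('k) (dim_row v)) (col v ` J)"

definition uniform_rank_two :: "'k::field mat \<Rightarrow> bool" where
  "uniform_rank_two v \<longleftrightarrow> dim_col v \<ge> 2 \<and>
     (\<forall>i<dim_col v. \<forall>j<dim_col v. i \<noteq> j \<longrightarrow> columns_independent v {i, j})"


section \<open>The ideal of minors\<close>

abbreviation column_submatrix :: "'a mat \<Rightarrow> nat set \<Rightarrow> 'a mat" where
  "column_submatrix A J \<equiv> submatrix A UNIV J"

text \<open>\<open>B\<close> is an admissible choice of \<open>w\<^sup>\<bottom>\<close>: its rows form a basis of the right kernel of \<open>w\<close>.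
  If the columns of \<open>w\<close> are independent, then \<open>B\<close> has no rows.\<close>

definition is_perp :: "'k::field mat \<Rightarrow> 'k mat \<Rightarrow> bool" where
  "is_perp w B \<longleftrightarrow>
     B \<in> carrier_mat (dim_col w - vec_space.rank (dim_row w) w) (dim_col w) \<and>
     distinct (rows B) \<and> kernel.basis (dim_col w) w (set (rows B))"

text \<open>Column \<open>c\<close> of the result is the tensor product of columns \<open>c\<close> of \<open>X\<close> and \<open>C\<close>; the coordinate
  indexed by the pair \<open>(i, k)\<close> is placed in row \<open>i * dim_row C + k\<close>.\<close>

definition columnwise_tensor :: "'a::times mat \<Rightarrow> 'a mat \<Rightarrow> 'a mat" (infixl "\<odot>\<^sub>c" 70) where
  "X \<odot>\<^sub>c C = mat (dim_row X * dim_row C) (dim_col X)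
     (\<lambda>(a, c). X $$ (a div dim_row C, c) * C $$ (a mod dim_row C, c))"

definition generic_matrix :: "nat \<Rightarrow> nat \<Rightarrow> 'k::comm_ring_1 mpoly mat" where
  "generic_matrix r n = mat r n (\<lambda>(i, j). indet i j)"

text \<open>A matrix with fewer than \<open>k\<close> rows or columns has no minors of size \<open>k\<close>; for the ideal they
  generate this is the same as declaring these minors to be zero.\<close>

definition minors :: "nat \<Rightarrow> 'a::comm_ring_1 mat \<Rightarrow> 'a set" where
  "minors k A = {det (submatrix A I K) | I K.
     I \<subseteq> {..<dim_row A} \<and> K \<subseteq> {..<dim_col A} \<and> card I = k \<and> card K = k}"

text \<open>The ideal \<open>I'\<^sub>v\<close>, computed from the matrices \<open>perp J\<close> chosen as \<open>v\<^sub>J\<^sup>\<bottom>\<close>.\<close>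

definition minor_ideal :: "nat \<Rightarrow> nat \<Rightarrow> (nat set \<Rightarrow> 'k::comm_ring_1 mat) \<Rightarrow> 'k mpoly set" where
  "minor_ideal r n perp = genideal (coord_ring r n)
     (\<Union>J\<in>{J. J \<subseteq> {..<n} \<and> J \<noteq> {}}.
        minors (card J) (column_submatrix (generic_matrix r n) J \<odot>\<^sub>c map_mat const_poly (perp J)))"

end

(* Since GL_2 acts on the left of v without changing the orbit, one may take v_j = c_j (1, a_j) with
   the a_j distinct and a_i + a_j nonzero.  Write y_j and z_j for the two rows of the generic matrix.
   The d = n + 3 linear forms theta_j = z_j - a_j^2 y_j (j < n) and eta_i = sum_j a_j^i y_j (i < 3)
   are parameters for the quotient: modulo the theta_j the minors for four columns become nonzero
   multiples of the products of four distinct y_j, and any n - 3 of the y_j span all of them modulo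
   the eta_i.  This makes R / I'_v a module over B = k[theta, eta] generated by the C(n, 3) products
   of y_j over the sets S of size m <= 3 contained in {0, ..., n + m - 5}.  These products are
   linearly independent over B even as functions on the orbit: along a curve of orbit points that
   degenerates to a point whose y is supported on a given 3-set T, the part of lowest order in theta
   of a relation survives, and letting T vary gives a triangular system.  Independence yields both
   I'_v = I_v and the freeness of R / I'_v over B.  For n = 2 the orbit is dense and both ideals vanish.

   A finite free algebra over a polynomial ring in d variables is Cohen-Macaulay: by the
   Nullstellensatz every maximal ideal contains theta_i - c_i for suitable constants c_i, which form a
   regular sequence of length d by freeness, and the dimension is at most d because any d + 1 elements
   are algebraically dependent, by counting monomials.  The lowest term of such a relation in the
   lexicographic order contradicts a chain of primes of length d + 1. *)

theory Submission
  imports Defs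
begin

section \<open>Localization\<close>

text \<open>Why squares: a point of the orbit has columns t_j (p(a_j), q(a_j)) with p and q linear,
  so theta_j = t_j c(a_j) for c = q - x^2 p, and the coefficients of p and q become the four
  coefficients of an arbitrary cubic. A nonzero cubic has at most three roots, so when every theta_j
  tends to 0 while c keeps a nonzero limit, at most three y_j survive. The fibre over theta = 0
  should thus be the union of the C(n, 3) coordinate 3-spaces; hence the fourfold products, the
  three moments eta_i and the rank C(n, 3). Why n + 3: the group has dimension 4 + n, and for n >= 3
  only the scalars, which act through both factors, are lost. Why a_i + a_j is nonzero: the
  degeneration to a 3-set T uses the cubic with roots a_j, j in T, and its p and q are independent
  exactly when no two of these roots are opposite. The obstacle is that I'_v is not known to be
  radical, so equality cannot be read off zero sets; generators of R / I'_v that are independent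
  already on the orbit settle it without a primality proof.\<close>

definition fraction :: "('a, 'm) ring_scheme \<Rightarrow> 'a set \<Rightarrow> 'a \<Rightarrow> 'a \<Rightarrow> ('a \<times> 'a) set" where
  "fraction A S a s = frac_rel A S `` {(a, s)}"

locale localized = cring A for A (structure) +
  fixes S :: "'a set"
  assumes S_sub: "S \<subseteq> carrier A"
    and one_S: "\<one> \<in> S"
    and mult_S: "s \<in> S \<Longrightarrow> t \<in> S \<Longrightarrow> s \<otimes> t \<in> S"
begin

abbreviation "L \<equiv> localization A S"
abbreviation "fr \<equiv> fraction A S"

lemma S_carr [simp]: "s \<in> S \<Longrightarrow> s \<in> carrier A"
  using S_sub by auto

lemmas S_simps [simp] = one_S mult_S

text \<open>With zero divisors the factor \<open>u\<close> cannot be cancelled. The subtraction-free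
  form turns each cross-multiplication below into rewriting with associativity and
  commutativity.\<close>

lemma frac_rel_iff:
  "((a, s), (b, t)) \<in> frac_rel A S \<longleftrightarrow> a \<in> carrier A \<and> b \<in> carrier A \<and> s \<in> S \<and> t \<in> S \<and>
     (\<exists>u\<in>S. u \<otimes> a \<otimes> t = u \<otimes> b \<otimes> s)"
proof -
  have "u \<otimes> (a \<otimes> t \<ominus> b \<otimes> s) = \<zero> \<longleftrightarrow> u \<otimes> a \<otimes> t = u \<otimes> b \<otimes> s"
    if c: "a \<in> carrier A" "b \<in> carrier A" "s \<in> S" "t \<in> S" "u \<in> S" for u
  proof -
    have "u \<otimes> (a \<otimes> t \<ominus> b \<otimes> s) = u \<otimes> a \<otimes> t \<ominus> u \<otimes> b \<otimes> s"
      using c by (simp add: minus_eq r_distr r_minus m_assoc)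
    then show ?thesis using c r_right_minus_eq[of "u \<otimes> a \<otimes> t" "u \<otimes> b \<otimes> s"] by simp
  qed
  then show ?thesis unfolding frac_rel_def by blast
qed

lemma equiv_frac_rel: "equiv (carrier A \<times> S) (frac_rel A S)"
proof (rule equivI)
  show "frac_rel A S \<subseteq> (carrier A \<times> S) \<times> (carrier A \<times> S)"
    by (auto simp: frac_rel_iff)
  show "refl_on (carrier A \<times> S) (frac_rel A S)"
    unfolding refl_on_def by (auto simp: frac_rel_iff)
  show "sym (frac_rel A S)"
  proof (rule symI, clarify)
    fix a s b t
    assume "((a, s), (b, t)) \<in> frac_rel A S"
    then obtain u where "a \<in> carrier A" "b \<in> carrier A" "s \<in> S" "t \<in> S" "u \<in> S"
        "u \<otimes> a \<otimes> t = u \<otimes> b \<otimes> s"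
      unfolding frac_rel_iff by blast
    then show "((b, t), (a, s)) \<in> frac_rel A S"
      unfolding frac_rel_iff by (intro conjI bexI[of _ u]) simp_all
  qed
  show "trans (frac_rel A S)"
  proof (rule transI, clarify)
    fix a s b t c r
    assume "((a, s), (b, t)) \<in> frac_rel A S" "((b, t), (c, r)) \<in> frac_rel A S"
    then obtain u w where c: "a \<in> carrier A" "b \<in> carrier A" "c \<in> carrier A" "s \<in> S" "t \<in> S"
        "r \<in> S" "u \<in> S" "w \<in> S"
      and e1: "u \<otimes> a \<otimes> t = u \<otimes> b \<otimes> s" and e2: "w \<otimes> b \<otimes> r = w \<otimes> c \<otimes> t"
      by (auto simp: frac_rel_iff)
    \<comment> \<open>The witness contains the middle denominator \<open>t\<close> besides
      \<open>u\<close> and \<open>w\<close>: the two equations can be chained only after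
      multiplication by it.\<close>
    have "(u \<otimes> w \<otimes> t) \<otimes> a \<otimes> r = (u \<otimes> a \<otimes> t) \<otimes> (w \<otimes> r)" using c by (simp add: m_ac)
    also have "\<dots> = (w \<otimes> b \<otimes> r) \<otimes> (u \<otimes> s)" unfolding e1 using c by (simp add: m_ac)
    also have "\<dots> = (u \<otimes> w \<otimes> t) \<otimes> c \<otimes> s" unfolding e2 using c by (simp add: m_ac)
    finally show "((a, s), (c, r)) \<in> frac_rel A S"
      using c by (auto simp: frac_rel_iff intro!: bexI[of _ "u \<otimes> w \<otimes> t"])
  qed
qed

lemma fr_eqI:
  assumes "a \<in> carrier A" "b \<in> carrier A" "s \<in> S" "t \<in> S" "u \<in> S" "u \<otimes> a \<otimes> t = u \<otimes> b \<otimes> s"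
  shows "fr a s = fr b t"
  unfolding fraction_def
  by (rule equiv_class_eq[OF equiv_frac_rel]) (use assms frac_rel_iff in blast)

lemma fr_eqI':
  assumes "a \<in> carrier A" "b \<in> carrier A" "s \<in> S" "t \<in> S" "a \<otimes> t = b \<otimes> s"
  shows "fr a s = fr b t"
  by (rule fr_eqI[of _ _ _ _ \<one>]) (use assms in auto)

lemma fr_eqD:
  assumes "fr a s = fr b t" "a \<in> carrier A" "b \<in> carrier A" "s \<in> S" "t \<in> S"
  shows "\<exists>u\<in>S. u \<otimes> a \<otimes> t = u \<otimes> b \<otimes> s"
proof -
  have "((a, s), (b, t)) \<in> frac_rel A S"
    by (rule eq_equiv_class[OF _ equiv_frac_rel]) (use assms in \<open>auto simp: fraction_def\<close>)
  then show ?thesis using frac_rel_iff by blast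
qed

lemma mem_fr: "(b, t) \<in> fr a s \<longleftrightarrow> ((a, s), (b, t)) \<in> frac_rel A S"
  by (simp add: fraction_def)

lemma mem_frD:
  assumes "(b, t) \<in> fr a s"
  shows "b \<in> carrier A" "t \<in> S" "a \<in> carrier A" "s \<in> S" "\<exists>u\<in>S. u \<otimes> a \<otimes> t = u \<otimes> b \<otimes> s"
  using assms by (auto simp: mem_fr frac_rel_iff)

lemma fr_self: "a \<in> carrier A \<Longrightarrow> s \<in> S \<Longrightarrow> (a, s) \<in> fr a s"
  by (auto simp: mem_fr frac_rel_iff)

lemma carrier_L: "carrier L = {fr a s | a s. a \<in> carrier A \<and> s \<in> S}"
  by (auto simp: localization_def quotient_def fraction_def)

lemma fr_in_L [simp]: "a \<in> carrier A \<Longrightarrow> s \<in> S \<Longrightarrow> fr a s \<in> carrier L"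
  by (auto simp: carrier_L)

lemma in_L_E:
  assumes "x \<in> carrier L"
  obtains a s where "a \<in> carrier A" "s \<in> S" "x = fr a s"
  using assms by (auto simp: carrier_L)

lemma one_L: "\<one>\<^bsub>L\<^esub> = fr \<one> \<one>" and zero_L: "\<zero>\<^bsub>L\<^esub> = fr \<zero> \<one>"
  by (simp_all add: localization_def fraction_def)

text \<open>Independence of representatives; it collapses the unions in the definition of the
  product to a single class.\<close>

lemma fr_mult_cong:
  assumes "(a', s') \<in> fr a s" "(b', t') \<in> fr b t"
  shows "fr (a' \<otimes> b') (s' \<otimes> t') = fr (a \<otimes> b) (s \<otimes> t)"
proof -
  note c = mem_frD(1-4)[OF assms(1)] mem_frD(1-4)[OF assms(2)]
  from mem_frD(5)[OF assms(1)] mem_frD(5)[OF assms(2)] obtain u w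
    where uw: "u \<in> S" "w \<in> S" "u \<otimes> a \<otimes> s' = u \<otimes> a' \<otimes> s" "w \<otimes> b \<otimes> t' = w \<otimes> b' \<otimes> t"
    by blast
  have "(u \<otimes> w) \<otimes> (a' \<otimes> b') \<otimes> (s \<otimes> t) = (u \<otimes> a' \<otimes> s) \<otimes> (w \<otimes> b' \<otimes> t)"
    using c uw(1,2) by (simp add: m_ac)
  also have "\<dots> = (u \<otimes> a \<otimes> s') \<otimes> (w \<otimes> b \<otimes> t')" by (simp add: uw)
  also have "\<dots> = (u \<otimes> w) \<otimes> (a \<otimes> b) \<otimes> (s' \<otimes> t')"
    using c uw(1,2) by (simp add: m_ac)
  finally show ?thesis
    using c uw(1,2) by (intro fr_eqI[of _ _ _ _ "u \<otimes> w"]) auto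
qed

lemma fr_add_cong:
  assumes "(a', s') \<in> fr a s" "(b', t') \<in> fr b t"
  shows "fr (a' \<otimes> t' \<oplus> b' \<otimes> s') (s' \<otimes> t') = fr (a \<otimes> t \<oplus> b \<otimes> s) (s \<otimes> t)"
proof -
  note c = mem_frD(1-4)[OF assms(1)] mem_frD(1-4)[OF assms(2)]
  from mem_frD(5)[OF assms(1)] mem_frD(5)[OF assms(2)] obtain u w
    where uw: "u \<in> S" "w \<in> S" "u \<otimes> a \<otimes> s' = u \<otimes> a' \<otimes> s" "w \<otimes> b \<otimes> t' = w \<otimes> b' \<otimes> t"
    by blast
  have "(u \<otimes> w) \<otimes> (a' \<otimes> t' \<oplus> b' \<otimes> s') \<otimes> (s \<otimes> t)
      = (u \<otimes> a' \<otimes> s) \<otimes> (w \<otimes> t' \<otimes> t) \<oplus> (w \<otimes> b' \<otimes> t) \<otimes> (u \<otimes> s' \<otimes> s)"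
    using c uw(1,2) by (simp add: m_ac l_distr r_distr)
  also have "\<dots> = (u \<otimes> a \<otimes> s') \<otimes> (w \<otimes> t' \<otimes> t) \<oplus> (w \<otimes> b \<otimes> t') \<otimes> (u \<otimes> s' \<otimes> s)"
    by (simp add: uw)
  also have "\<dots> = (u \<otimes> w) \<otimes> (a \<otimes> t \<oplus> b \<otimes> s) \<otimes> (s' \<otimes> t')"
    using c uw(1,2) by (simp add: m_ac l_distr r_distr)
  finally show ?thesis
    using c uw(1,2) by (intro fr_eqI[of _ _ _ _ "u \<otimes> w"]) auto
qed

lemma fr_mult [simp]:
  assumes "a \<in> carrier A" "b \<in> carrier A" "s \<in> S" "t \<in> S"
  shows "fr a s \<otimes>\<^bsub>L\<^esub> fr b t = fr (a \<otimes> b) (s \<otimes> t)"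
proof -
  have "fr a s \<otimes>\<^bsub>L\<^esub> fr b t = (\<Union>(a', s')\<in>fr a s. \<Union>(b', t')\<in>fr b t. fr (a' \<otimes> b') (s' \<otimes> t'))"
    by (simp add: localization_def fraction_def)
  also have "\<dots> = (\<Union>(a', s')\<in>fr a s. \<Union>(b', t')\<in>fr b t. fr (a \<otimes> b) (s \<otimes> t))"
    by (intro SUP_cong refl) (auto dest: fr_mult_cong)
  also have "\<dots> = fr (a \<otimes> b) (s \<otimes> t)"
    using fr_self[OF assms(1,3)] fr_self[OF assms(2,4)] by auto
  finally show ?thesis .
qed

lemma fr_add [simp]:
  assumes "a \<in> carrier A" "b \<in> carrier A" "s \<in> S" "t \<in> S"
  shows "fr a s \<oplus>\<^bsub>L\<^esub> fr b t = fr (a \<otimes> t \<oplus> b \<otimes> s) (s \<otimes> t)"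
proof -
  have "fr a s \<oplus>\<^bsub>L\<^esub> fr b t
      = (\<Union>(a', s')\<in>fr a s. \<Union>(b', t')\<in>fr b t. fr (a' \<otimes> t' \<oplus> b' \<otimes> s') (s' \<otimes> t'))"
    by (simp add: localization_def fraction_def)
  also have "\<dots> = (\<Union>(a', s')\<in>fr a s. \<Union>(b', t')\<in>fr b t. fr (a \<otimes> t \<oplus> b \<otimes> s) (s \<otimes> t))"
    by (intro SUP_cong refl) (auto dest: fr_add_cong)
  also have "\<dots> = fr (a \<otimes> t \<oplus> b \<otimes> s) (s \<otimes> t)"
    using fr_self[OF assms(1,3)] fr_self[OF assms(2,4)] by auto
  finally show ?thesis .
qed

lemma cring_L: "cring L"
proof (rule cringI)
  show "abelian_group L"
  proof (rule abelian_groupI)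
    fix x y assume "x \<in> carrier L" "y \<in> carrier L"
    then obtain a s b t where *: "a \<in> carrier A" "s \<in> S" "x = fr a s" "b \<in> carrier A" "t \<in> S" "y = fr b t"
      by (elim in_L_E)
    show "x \<oplus>\<^bsub>L\<^esub> y \<in> carrier L" using * by simp
    show "x \<oplus>\<^bsub>L\<^esub> y = y \<oplus>\<^bsub>L\<^esub> x" using * by (simp add: m_comm a_comm)
    fix z assume "z \<in> carrier L"
    then obtain c r where c: "c \<in> carrier A" "r \<in> S" "z = fr c r" by (elim in_L_E)
    have "(a \<otimes> t \<oplus> b \<otimes> s) \<otimes> r \<oplus> c \<otimes> (s \<otimes> t) = a \<otimes> (t \<otimes> r) \<oplus> (b \<otimes> r \<oplus> c \<otimes> t) \<otimes> s"
      using * c by (simp add: l_distr r_distr m_ac a_assoc)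
    then show "x \<oplus>\<^bsub>L\<^esub> y \<oplus>\<^bsub>L\<^esub> z = x \<oplus>\<^bsub>L\<^esub> (y \<oplus>\<^bsub>L\<^esub> z)" using * c by (simp add: m_assoc)
  next
    fix x assume "x \<in> carrier L"
    then obtain a s where *: "a \<in> carrier A" "s \<in> S" "x = fr a s" by (elim in_L_E)
    show "\<zero>\<^bsub>L\<^esub> \<oplus>\<^bsub>L\<^esub> x = x" using * by (simp add: zero_L)
    have "fr (\<ominus> a) s \<oplus>\<^bsub>L\<^esub> x = \<zero>\<^bsub>L\<^esub>"
      using * by (simp add: zero_L, intro fr_eqI') (auto simp: l_minus l_neg)
    then show "\<exists>y\<in>carrier L. y \<oplus>\<^bsub>L\<^esub> x = \<zero>\<^bsub>L\<^esub>" using * by (intro bexI[of _ "fr (\<ominus> a) s"]) auto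
  qed (simp add: zero_L)
  show "comm_monoid L"
  proof (rule comm_monoidI)
    fix x y assume "x \<in> carrier L" "y \<in> carrier L"
    then obtain a s b t where *: "a \<in> carrier A" "s \<in> S" "x = fr a s" "b \<in> carrier A" "t \<in> S" "y = fr b t"
      by (elim in_L_E)
    show "x \<otimes>\<^bsub>L\<^esub> y \<in> carrier L" using * by simp
    show "x \<otimes>\<^bsub>L\<^esub> y = y \<otimes>\<^bsub>L\<^esub> x" using * by (simp add: m_comm)
    fix z assume "z \<in> carrier L"
    then obtain c r where c: "c \<in> carrier A" "r \<in> S" "z = fr c r" by (elim in_L_E)
    show "x \<otimes>\<^bsub>L\<^esub> y \<otimes>\<^bsub>L\<^esub> z = x \<otimes>\<^bsub>L\<^esub> (y \<otimes>\<^bsub>L\<^esub> z)" using * c by (simp add: m_assoc)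
  next
    fix x assume "x \<in> carrier L"
    then obtain a s where *: "a \<in> carrier A" "s \<in> S" "x = fr a s" by (elim in_L_E)
    show "\<one>\<^bsub>L\<^esub> \<otimes>\<^bsub>L\<^esub> x = x" using * by (simp add: one_L)
  qed (simp add: one_L)
  fix x y z assume "x \<in> carrier L" "y \<in> carrier L" "z \<in> carrier L"
  then obtain a s b t c r where *: "a \<in> carrier A" "s \<in> S" "x = fr a s" "b \<in> carrier A" "t \<in> S" "y = fr b t"
      "c \<in> carrier A" "r \<in> S" "z = fr c r"
    by (elim in_L_E)
  show "(x \<oplus>\<^bsub>L\<^esub> y) \<otimes>\<^bsub>L\<^esub> z = x \<otimes>\<^bsub>L\<^esub> z \<oplus>\<^bsub>L\<^esub> y \<otimes>\<^bsub>L\<^esub> z"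
    using * by (simp, intro fr_eqI') (auto simp: l_distr r_distr m_ac)
qed

lemma fr_cancel: "a \<in> carrier A \<Longrightarrow> s \<in> S \<Longrightarrow> t \<in> S \<Longrightarrow> fr (t \<otimes> a) (t \<otimes> s) = fr a s"
  by (intro fr_eqI') (auto simp: m_ac)

section \<open>Extension and contraction of ideals\<close>

definition con :: "('a \<times> 'a) set set \<Rightarrow> 'a set" where
  "con I = {a \<in> carrier A. fr a \<one> \<in> I}"

definition ext :: "'a set \<Rightarrow> ('a \<times> 'a) set set" where
  "ext J = {fr a s | a s. a \<in> J \<and> s \<in> S}"

lemma extI: "a \<in> J \<Longrightarrow> s \<in> S \<Longrightarrow> fr a s \<in> ext J"
  by (auto simp: ext_def)

lemma ideal_ext:
  assumes "ideal J A"
  shows "ideal (ext J) L"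
proof -
  interpret J: ideal J A by fact
  show ?thesis
  proof (rule idealI)
    show "ring L" using cring_L by (rule cring.axioms(1))
    show "subgroup (ext J) (add_monoid L)"
    proof (rule group.subgroupI)
      show "group (add_monoid L)"
        using cring_L abelian_group.a_group cring.axioms(1) ring.is_abelian_group by blast
      show "ext J \<subseteq> carrier (add_monoid L)" using J.Icarr by (auto simp: ext_def)
      show "ext J \<noteq> {}" using extI[OF J.zero_closed one_S] by blast
      fix x assume "x \<in> ext J"
      then obtain a s where *: "a \<in> J" "s \<in> S" "x = fr a s" by (auto simp: ext_def)
      have aA: "a \<in> carrier A" using * J.Icarr by auto
      have "fr (\<ominus> a) s \<oplus>\<^bsub>L\<^esub> x = \<zero>\<^bsub>L\<^esub>"
        using * aA by (simp add: zero_L, intro fr_eqI') (auto simp: l_minus l_neg)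
      then have "inv\<^bsub>add_monoid L\<^esub> x = fr (\<ominus> a) s"
        using * aA cring.axioms(1)[OF cring_L]
        by (intro group.inv_equality[OF \<open>group (add_monoid L)\<close>]) auto
      moreover have "\<ominus> a \<in> J" using * J.a_inv_closed by auto
      ultimately show "inv\<^bsub>add_monoid L\<^esub> x \<in> ext J" using * by (auto simp: ext_def)
      fix y assume "y \<in> ext J"
      then obtain b t where **: "b \<in> J" "t \<in> S" "y = fr b t" by (auto simp: ext_def)
      have bA: "b \<in> carrier A" using ** J.Icarr by auto
      have "a \<otimes> t \<oplus> b \<otimes> s \<in> J"
        using * ** J.I_r_closed by auto
      then show "x \<otimes>\<^bsub>add_monoid L\<^esub> y \<in> ext J" using * ** aA bA by (simp add: extI)
    qed
    fix x y assume "x \<in> ext J" "y \<in> carrier L"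
    then obtain a s b t where *: "a \<in> J" "s \<in> S" "x = fr a s" "b \<in> carrier A" "t \<in> S" "y = fr b t"
      by (auto simp: ext_def carrier_L)
    have aA: "a \<in> carrier A" using * J.Icarr by auto
    show "y \<otimes>\<^bsub>L\<^esub> x \<in> ext J" "x \<otimes>\<^bsub>L\<^esub> y \<in> ext J"
      using * aA J.I_l_closed J.I_r_closed by (simp_all add: extI)
  qed
qed

text \<open>A fraction determines its numerator only up to a factor from \<open>S\<close>, so
  membership of the numerator is tested after such a factor.\<close>

lemma fr_in_ext_iff:
  assumes "ideal J A" "a \<in> carrier A" "s \<in> S"
  shows "fr a s \<in> ext J \<longleftrightarrow> (\<exists>u\<in>S. u \<otimes> a \<in> J)"
proof
  interpret J: ideal J A by fact
  assume "fr a s \<in> ext J"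
  then obtain b t where b: "b \<in> J" "t \<in> S" "fr a s = fr b t" by (auto simp: ext_def)
  have bA: "b \<in> carrier A" using b J.Icarr by auto
  obtain u where u: "u \<in> S" "u \<otimes> a \<otimes> t = u \<otimes> b \<otimes> s"
    using fr_eqD[OF b(3)] assms b bA by auto
  have "u \<otimes> b \<otimes> s \<in> J" using b u assms J.I_l_closed J.I_r_closed by auto
  then have "(u \<otimes> t) \<otimes> a \<in> J" using u b assms by (simp add: m_ac)
  then show "\<exists>u\<in>S. u \<otimes> a \<in> J" using u b by (intro bexI[of _ "u \<otimes> t"]) auto
next
  assume "\<exists>u\<in>S. u \<otimes> a \<in> J"
  then obtain u where u: "u \<in> S" "u \<otimes> a \<in> J" by auto
  then have "fr (u \<otimes> a) (u \<otimes> s) \<in> ext J" using assms by (intro extI) auto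
  then show "fr a s \<in> ext J" using fr_cancel assms u by simp
qed

lemma fr_split: "a \<in> carrier A \<Longrightarrow> s \<in> S \<Longrightarrow> fr a s = fr \<one> s \<otimes>\<^bsub>L\<^esub> fr a \<one>"
  by simp

lemma fr_num: "a \<in> carrier A \<Longrightarrow> s \<in> S \<Longrightarrow> fr a \<one> = fr s \<one> \<otimes>\<^bsub>L\<^esub> fr a s"
  by simp (intro fr_eqI', auto simp: m_ac)

lemma fr_in_ideal_iff:
  assumes "ideal I L" "a \<in> carrier A" "s \<in> S"
  shows "fr a s \<in> I \<longleftrightarrow> a \<in> con I"
proof -
  interpret I: ideal I L by fact
  show ?thesis
  proof
    assume "fr a s \<in> I"
    then have "fr s \<one> \<otimes>\<^bsub>L\<^esub> fr a s \<in> I" by (rule I.I_l_closed) (simp add: assms)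
    then show "a \<in> con I" unfolding fr_num[OF assms(2,3), symmetric] using assms by (simp add: con_def)
  next
    assume "a \<in> con I"
    then have "fr a \<one> \<in> I" by (simp add: con_def)
    then have "fr \<one> s \<otimes>\<^bsub>L\<^esub> fr a \<one> \<in> I" by (rule I.I_l_closed) (simp add: assms)
    then show "fr a s \<in> I" unfolding fr_split[OF assms(2,3), symmetric] .
  qed
qed

lemma ideal_con:
  assumes "ideal I L"
  shows "ideal (con I) A"
proof -
  interpret I: ideal I L by fact
  show ?thesis
  proof (rule idealI)
    show "ring A" by (rule ring_axioms)
    show "subgroup (con I) (add_monoid A)"
    proof (rule group.subgroupI)
      show "group (add_monoid A)" by (rule a_group)
      show "con I \<subseteq> carrier (add_monoid A)" by (auto simp: con_def)
      have "\<zero> \<in> con I"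
        using additive_subgroup.zero_closed[OF I.additive_subgroup_axioms]
        by (simp add: con_def zero_L)
      then show "con I \<noteq> {}" by auto
      fix a b assume "a \<in> con I" "b \<in> con I"
      then show "a \<otimes>\<^bsub>add_monoid A\<^esub> b \<in> con I"
        using additive_subgroup.a_closed[OF I.additive_subgroup_axioms, of "fr a \<one>" "fr b \<one>"]
        by (simp add: con_def)
    next
      fix a assume a: "a \<in> con I"
      have "\<ominus> a \<in> con I"
        using I.I_l_closed[of "fr a \<one>" "fr (\<ominus> \<one>) \<one>"] a by (simp add: con_def l_minus)
      then show "inv\<^bsub>add_monoid A\<^esub> a \<in> con I" by (simp add: a_inv_def)
    qed
    fix a x assume a: "a \<in> con I" "x \<in> carrier A"
    show "x \<otimes> a \<in> con I" "a \<otimes> x \<in> con I"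
      using I.I_l_closed[of "fr a \<one>" "fr x \<one>"] I.I_r_closed[of "fr a \<one>" "fr x \<one>"] a
      by (simp_all add: con_def)
  qed
qed

text \<open>Every ideal of the localization is extended, because a/s and a/1 differ by a unit.
  Finite generation and strict inclusions are transferred through this identity.\<close>

lemma ext_con: "ideal I L \<Longrightarrow> ext (con I) = I"
proof (intro equalityI subsetI)
  fix x assume I: "ideal I L"
  { assume "x \<in> ext (con I)"
    then obtain a s where *: "a \<in> con I" "s \<in> S" "x = fr a s" by (auto simp: ext_def)
    then have "a \<in> carrier A" by (auto simp: con_def)
    then show "x \<in> I" using * fr_in_ideal_iff[OF I] by auto }
  { assume "x \<in> I"
    moreover then have "x \<in> carrier L" using I ideal.Icarr by metis
    ultimately show "x \<in> ext (con I)"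
      using fr_in_ideal_iff[OF I] by (auto simp: ext_def carrier_L) }
qed

lemma prime_con:
  assumes "primeideal P L"
  shows "primeideal (con P) A"
proof -
  interpret P: primeideal P L by fact
  have I: "ideal P L" by (rule P.is_ideal)
  show ?thesis
  proof (rule primeidealI[OF ideal_con[OF I]])
    show "cring A" by (rule cring_axioms)
    show "carrier A \<noteq> con P"
    proof
      assume "carrier A = con P"
      then have "\<one>\<^bsub>L\<^esub> \<in> P" using fr_in_ideal_iff[OF I, of \<one> \<one>] by (auto simp: one_L)
      then show False using P.one_imp_carrier P.I_notcarr by simp
    qed
    fix a b assume ab: "a \<in> carrier A" "b \<in> carrier A" "a \<otimes> b \<in> con P"
    then have "fr a \<one> \<otimes>\<^bsub>L\<^esub> fr b \<one> \<in> P" by (auto simp: con_def)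
    then show "a \<in> con P \<or> b \<in> con P"
      using P.I_prime[of "fr a \<one>" "fr b \<one>"] ab by (auto simp: con_def)
  qed
qed

lemma ext_mono: "J \<subseteq> K \<Longrightarrow> ext J \<subseteq> ext K"
  by (auto simp: ext_def)

lemma con_strict_mono:
  assumes "ideal I L" "ideal J L" "I \<subset> J"
  shows "con I \<subset> con J"
proof
  show "con I \<subseteq> con J" using assms(3) by (auto simp: con_def)
  show "con I \<noteq> con J"
  proof
    assume "con I = con J"
    then have "ext (con I) = ext (con J)" by (rule arg_cong)
    then show False using ext_con[OF assms(1)] ext_con[OF assms(2)] assms(3) by simp
  qed
qed

lemma genideal_image:
  assumes "X \<subseteq> carrier A"
  shows "genideal L ((\<lambda>a. fr a \<one>) ` X) = ext (genideal A X)"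
proof -
  interpret L: cring L by (rule cring_L)
  have Xi: "ideal (genideal A X) A" using genideal_ideal assms by auto
  have XL: "(\<lambda>a. fr a \<one>) ` X \<subseteq> carrier L" using assms by auto
  show ?thesis
  proof
    show "genideal L ((\<lambda>a. fr a \<one>) ` X) \<subseteq> ext (genideal A X)"
      using genideal_self[OF assms] one_S
      by (intro L.genideal_minimal ideal_ext Xi) (auto intro!: extI)
    let ?I = "genideal L ((\<lambda>a. fr a \<one>) ` X)"
    have I: "ideal ?I L" using L.genideal_ideal XL by auto
    have "X \<subseteq> con ?I" using L.genideal_self[OF XL] assms by (auto simp: con_def)
    then have "genideal A X \<subseteq> con ?I" by (intro genideal_minimal ideal_con I)
    then show "ext (genideal A X) \<subseteq> ?I" using ext_mono ext_con[OF I] by blast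
  qed
qed

lemma noetherian_L:
  assumes "noetherian_ring A"
  shows "noetherian_ring L"
proof -
  interpret L: cring L by (rule cring_L)
  interpret N: noetherian_ring A by fact
  show ?thesis
  proof (rule L.noetherian_ringI)
    fix I assume I: "ideal I L"
    obtain X where X: "X \<subseteq> carrier A" "finite X" "con I = genideal A X"
      using N.finetely_gen[OF ideal_con[OF I]] by auto
    have "I = genideal L ((\<lambda>a. fr a \<one>) ` X)"
      using genideal_image[OF X(1)] X(3) ext_con[OF I] by simp
    then show "\<exists>X\<subseteq>carrier L. finite X \<and> I = genideal L X"
      using X by (intro exI[of _ "(\<lambda>a. fr a \<one>) ` X"]) auto
  qed
qed

text \<open>A relation between fractions is cleared by a factor from \<open>S\<close>, and
  regularity in \<open>A\<close> applies to the cleared numerator. Properness has to be assumed,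
  since the elements may generate the unit ideal after localization.\<close>

lemma regular_sequence_L:
  assumes "regular_sequence A xs" "genideal L ((\<lambda>a. fr a \<one>) ` set xs) \<noteq> carrier L"
  shows "regular_sequence L (map (\<lambda>a. fr a \<one>) xs)"
  unfolding regular_sequence_def
proof (intro conjI allI impI ballI)
  have xs: "set xs \<subseteq> carrier A" using assms by (auto simp: regular_sequence_def)
  then show "set (map (\<lambda>a. fr a \<one>) xs) \<subseteq> carrier L" by auto
  show "genideal L (set (map (\<lambda>a. fr a \<one>) xs)) \<noteq> carrier L" using assms by simp
  fix i x assume i: "i < length (map (\<lambda>a. fr a \<one>) xs)" and x: "x \<in> carrier L"
    and m: "map (\<lambda>a. fr a \<one>) xs ! i \<otimes>\<^bsub>L\<^esub> x \<in> genideal L (set (take i (map (\<lambda>a. fr a \<one>) xs)))"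
  obtain a s where a: "a \<in> carrier A" "s \<in> S" "x = fr a s" using x by (elim in_L_E)
  let ?J = "genideal A (set (take i xs))"
  have ti: "set (take i xs) \<subseteq> carrier A" using xs set_take_subset by fastforce
  have J: "ideal ?J A" using genideal_ideal[OF ti] .
  have eq: "genideal L (set (take i (map (\<lambda>a. fr a \<one>) xs))) = ext ?J"
    using genideal_image[OF ti] by (simp add: take_map)
  have xi: "xs ! i \<in> carrier A" using xs i by auto
  have "fr (xs ! i \<otimes> a) s \<in> ext ?J" using m i a xi unfolding eq by simp
  then obtain u where u: "u \<in> S" "u \<otimes> (xs ! i \<otimes> a) \<in> ?J"
    using fr_in_ext_iff[OF J] a xi by auto
  then have "xs ! i \<otimes> (u \<otimes> a) \<in> ?J" using a xi by (simp add: m_lcomm)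
  then have "u \<otimes> a \<in> ?J" using assms(1) i u a unfolding regular_sequence_def by auto
  then show "x \<in> genideal L (set (take i (map (\<lambda>a. fr a \<one>) xs)))"
    unfolding eq using fr_in_ext_iff[OF J] a u by auto
qed

end


section \<open>A criterion for Cohen--Macaulay rings\<close>

lemma (in cring) ideal_adjoin:
  assumes M: "ideal M R" and a: "a \<in> carrier R"
  obtains X where "ideal X R" "M \<subseteq> X" "a \<in> X"
    "\<forall>x\<in>X. \<exists>m\<in>M. \<exists>r\<in>carrier R. x = m \<oplus> r \<otimes> a"
proof
  interpret M: ideal M R by fact
  let ?X = "set_add R M (PIdl a)"
  show "ideal ?X R" by (intro add_ideals M cgenideal_ideal a)
  have mem: "x \<in> ?X \<longleftrightarrow> (\<exists>m\<in>M. \<exists>r\<in>carrier R. x = m \<oplus> r \<otimes> a)" for x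
    unfolding set_add_def' cgenideal_def by auto
  show "M \<subseteq> ?X"
  proof
    fix m assume "m \<in> M"
    then show "m \<in> ?X" unfolding mem using a M.Icarr by (intro bexI[of _ m] bexI[of _ \<zero>]) auto
  qed
  show "a \<in> ?X"
    unfolding mem using a M.zero_closed by (intro bexI[of _ \<zero>] bexI[of _ \<one>]) auto
  show "\<forall>x\<in>?X. \<exists>m\<in>M. \<exists>r\<in>carrier R. x = m \<oplus> r \<otimes> a" using mem by blast
qed

text \<open>Krull's argument: an ideal maximal among those that contain \<open>J\<close> and miss
  \<open>T\<close> is prime. If \<open>a\<close> and \<open>b\<close> lie outside, then
  \<open>T\<close> meets both ideals obtained by adjoining one of them, and the product of the two
  elements found would lie in the maximal ideal if \<open>a \<otimes> b\<close> did.\<close>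

lemma (in cring) prime_avoiding:
  assumes J: "ideal J R" and T: "\<one> \<in> T" "\<And>s t. s \<in> T \<Longrightarrow> t \<in> T \<Longrightarrow> s \<otimes> t \<in> T"
    and JT: "J \<inter> T = {}"
  shows "\<exists>P. primeideal P R \<and> J \<subseteq> P \<and> P \<inter> T = {}"
proof -
  define \<A> where "\<A> = {I. ideal I R \<and> J \<subseteq> I \<and> I \<inter> T = {}}"
  have "\<exists>M\<in>\<A>. \<forall>X\<in>\<A>. M \<subseteq> X \<longrightarrow> X = M"
  proof (rule subset_Zorn_nonempty)
    show "\<A> \<noteq> {}" using J JT by (auto simp: \<A>_def)
    fix C assume C: "C \<noteq> {}" "subset.chain \<A> C"
    then have "subset.chain {I. ideal I R} C"
      unfolding \<A>_def subset_chain_def by auto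
    then have "ideal (\<Union>C) R" using chain_Union_is_ideal[of C] C by simp
    then show "\<Union>C \<in> \<A>" using C unfolding \<A>_def subset_chain_def by blast
  qed
  then obtain M where MA: "M \<in> \<A>" and maxM: "\<And>X. X \<in> \<A> \<Longrightarrow> M \<subseteq> X \<Longrightarrow> X = M"
    by metis
  have M: "ideal M R" "J \<subseteq> M" "M \<inter> T = {}" using MA by (auto simp: \<A>_def)
  have max: "X = M" if "ideal X R" "M \<subseteq> X" "X \<inter> T = {}" for X
    using that M by (intro maxM) (auto simp: \<A>_def)
  interpret M: ideal M R by fact
  have meets: "\<exists>m\<in>M. \<exists>r\<in>carrier R. m \<oplus> r \<otimes> a \<in> T" if a: "a \<in> carrier R" "a \<notin> M" for a
  proof (rule ccontr)
    assume neg: "\<not> ?thesis"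
    obtain X where X: "ideal X R" "M \<subseteq> X" "a \<in> X" "\<forall>x\<in>X. \<exists>m\<in>M. \<exists>r\<in>carrier R. x = m \<oplus> r \<otimes> a"
      by (rule ideal_adjoin[OF M(1) a(1)]) (rule that)
    have "X \<inter> T = {}" using neg X(4) by fastforce
    then have "X = M" using max X by simp
    then show False using a X(3) by simp
  qed
  have "primeideal M R"
  proof (rule primeidealI[OF M(1)])
    show "cring R" by (rule cring_axioms)
    show "carrier R \<noteq> M" using T(1) M(3) by auto
    fix a b assume ab: "a \<in> carrier R" "b \<in> carrier R" "a \<otimes> b \<in> M"
    show "a \<in> M \<or> b \<in> M"
    proof (rule ccontr)
      assume "\<not> ?thesis"
      then obtain m r m' r' where *: "m \<in> M" "r \<in> carrier R" "m \<oplus> r \<otimes> a \<in> T"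
          "m' \<in> M" "r' \<in> carrier R" "m' \<oplus> r' \<otimes> b \<in> T"
        using meets ab by meson
      have c: "m \<in> carrier R" "m' \<in> carrier R" using * M.Icarr by auto
      have "(m \<oplus> r \<otimes> a) \<otimes> (m' \<oplus> r' \<otimes> b)
          = m \<otimes> (m' \<oplus> r' \<otimes> b) \<oplus> ((r \<otimes> a) \<otimes> m' \<oplus> (r \<otimes> r') \<otimes> (a \<otimes> b))"
        using * c ab by (simp add: l_distr r_distr m_ac a_assoc)
      also have "\<dots> \<in> M"
        using * c ab M.I_l_closed M.I_r_closed by (intro M.a_closed) auto
      finally show False using T(2)[OF *(3,6)] M(3) by auto
    qed
  qed
  then show ?thesis using M by blast
qed

section \<open>Chains of primes, depth and dimension\<close>

definition prime_chain :: "('a, 'm) ring_scheme \<Rightarrow> nat \<Rightarrow> (nat \<Rightarrow> 'a set) \<Rightarrow> bool" where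
  "prime_chain A k P \<longleftrightarrow> (\<forall>i\<le>k. primeideal (P i) A) \<and> (\<forall>i<k. P i \<subset> P (Suc i))"

lemma krull_dim_alt: "krull_dim A = Sup {enat k | k. \<exists>P. prime_chain A k P}"
  by (simp add: krull_dim_def prime_chain_def)

text \<open>If \<open>x\<close> is a nonzerodivisor modulo \<open>J\<close> and \<open>P\<close> is a prime containing \<open>J\<close> and \<open>x\<close>, then a
  prime containing \<open>J\<close> and avoiding all \<open>x\<^sup>k u\<close> with \<open>u \<notin> P\<close> lies strictly below \<open>P\<close>.\<close>

lemma (in cring) regular_sequence_prime_chain:
  assumes reg: "regular_sequence R xs" and j: "j \<le> length xs"
  shows "\<exists>P. prime_chain R j P \<and> set (take (length xs - j) xs) \<subseteq> P 0"
  using j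
proof (induction j)
  case 0
  have xs: "set xs \<subseteq> carrier R" using reg by (auto simp: regular_sequence_def)
  let ?J = "genideal R (set xs)"
  have J: "ideal ?J R" using genideal_ideal[OF xs] .
  have "\<one> \<notin> ?J" using reg ideal.one_imp_carrier[OF J] by (auto simp: regular_sequence_def)
  then have "\<exists>P. primeideal P R \<and> ?J \<subseteq> P \<and> P \<inter> {\<one>} = {}"
    by (intro prime_avoiding J) auto
  then obtain P where "primeideal P R" "?J \<subseteq> P" by blast
  then show ?case
    using genideal_self[OF xs] by (intro exI[of _ "\<lambda>_. P"]) (auto simp: prime_chain_def)
next
  case (Suc j)
  then obtain P where P: "prime_chain R j P" "set (take (length xs - j) xs) \<subseteq> P 0" by auto
  \<comment> \<open>The chain is extended at its lower end: \<open>xs ! m\<close> is the last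
    element still known to lie in \<open>P 0\<close>, and the new prime only has to contain those
    before it.\<close>
  define m where "m = length xs - Suc j"
  have m: "length xs - j = Suc m" "m < length xs" using Suc.prems by (auto simp: m_def)
  define x where "x = xs ! m"
  have xs: "set xs \<subseteq> carrier R" using reg by (auto simp: regular_sequence_def)
  have x: "x \<in> carrier R" "x \<in> P 0"
    using xs m P(2) unfolding m(1) x_def by (auto simp: take_Suc_conv_app_nth)
  let ?X = "set (take m xs)"
  have Xc: "?X \<subseteq> carrier R" using xs set_take_subset by fastforce
  let ?J = "genideal R ?X"
  have J: "ideal ?J R" using genideal_ideal[OF Xc] .
  have pr: "primeideal (P 0) R" using P by (auto simp: prime_chain_def)
  interpret P0: primeideal "P 0" R by fact
  have XP: "?X \<subseteq> P 0" using P(2) unfolding m(1) using m(2) by (auto simp: take_Suc_conv_app_nth)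
  then have JP: "?J \<subseteq> P 0" using genideal_minimal P0.is_ideal by blast
  define T where "T = {x [^] k \<otimes> u | (k::nat) u. u \<in> carrier R - P 0}"
  have one: "\<one> \<notin> P 0" using P0.one_imp_carrier P0.I_notcarr by auto
  have "\<exists>Q. primeideal Q R \<and> ?J \<subseteq> Q \<and> Q \<inter> T = {}"
  proof (rule prime_avoiding[OF J])
    have "\<one> = x [^] (0::nat) \<otimes> \<one>" by simp
    then show "\<one> \<in> T" using one unfolding T_def by blast
    fix s t assume "s \<in> T" "t \<in> T"
    then obtain k u l w where *: "u \<in> carrier R - P 0" "w \<in> carrier R - P 0"
        "s = x [^] (k::nat) \<otimes> u" "t = x [^] (l::nat) \<otimes> w"
      by (auto simp: T_def)
    have "s \<otimes> t = x [^] (k + l) \<otimes> (u \<otimes> w)"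
      using * x by (simp add: m_ac nat_pow_mult[symmetric])
    moreover have "u \<otimes> w \<in> carrier R - P 0" using * P0.I_prime by auto
    ultimately show "s \<otimes> t \<in> T" unfolding T_def by blast
  next
    have regx: "a \<in> ?J" if "a \<in> carrier R" "x \<otimes> a \<in> ?J" for a
      using reg that m(2) unfolding regular_sequence_def x_def by auto
    have "x [^] k \<otimes> u \<in> ?J \<Longrightarrow> u \<in> ?J" if "u \<in> carrier R" for k :: nat and u
    proof (induction k)
      case (Suc k)
      have "x \<otimes> (x [^] k \<otimes> u) \<in> ?J" using Suc.prems x that by (simp add: m_ac)
      then show ?case using regx[of "x [^] k \<otimes> u"] Suc.IH x that by auto
    qed (use that in auto)
    then show "?J \<inter> T = {}" using JP unfolding T_def by blast
  qed
  then obtain Q where Q: "primeideal Q R" "?J \<subseteq> Q" "Q \<inter> T = {}" by blast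
  have Qc: "Q \<subseteq> carrier R" using ideal.Icarr[OF primeideal.axioms(1)[OF Q(1)]] by auto
  \<comment> \<open>The exponents 1 and 0 in \<open>T\<close> give the two halves of
    \<open>Q \<subset> P 0\<close>: the prime \<open>Q\<close> misses \<open>x\<close>, and it
    misses everything outside \<open>P 0\<close>.\<close>
  have "x = x [^] (1::nat) \<otimes> \<one>" using x by simp
  then have "x \<in> T" using one unfolding T_def by blast
  moreover have "u \<in> T" if "u \<in> carrier R - P 0" for u
  proof -
    have "u = x [^] (0::nat) \<otimes> u" using that by simp
    then show ?thesis using that unfolding T_def by blast
  qed
  ultimately have QP: "Q \<subset> P 0" using Q(3) Qc x by blast
  define P' where "P' = (\<lambda>i. case i of 0 \<Rightarrow> Q | Suc i \<Rightarrow> P i)"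
  have "prime_chain R (Suc j) P'"
    using P(1) Q(1) QP unfolding prime_chain_def P'_def by (auto split: nat.split)
  moreover have "?X \<subseteq> P' 0" using genideal_self[OF Xc] Q(2) by (simp add: P'_def)
  ultimately show ?case unfolding m_def by blast
qed

lemma (in cring) depth_le_krull_dim: "depth R \<mm> \<le> krull_dim R"
  unfolding depth_def krull_dim_alt
proof (rule Sup_mono)
  fix a assume "a \<in> {enat (length xs) |xs. regular_sequence R xs \<and> set xs \<subseteq> \<mm>}"
  then obtain xs where "a = enat (length xs)" "regular_sequence R xs" by auto
  then show "\<exists>b\<in>{enat k |k. \<exists>P. prime_chain R k P}. a \<le> b"
    using regular_sequence_prime_chain[of xs "length xs"] by auto
qed

context localized
begin

text \<open>An element outside \<open>\<mm>\<close> becomes a unit, so a proper ideal of the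
  localization contracts into \<open>\<mm>\<close> and lies in \<open>ext \<mm>\<close>.\<close>

lemma maximal_ideal_L_unique:
  assumes m: "maximalideal \<mm> A" and S: "S = carrier A - \<mm>"
  shows "maximalideal (ext \<mm>) L" "maximalideal \<nn> L \<Longrightarrow> \<nn> = ext \<mm>"
proof -
  interpret L: cring L by (rule cring_L)
  interpret m: maximalideal \<mm> A by fact
  have me: "ideal (ext \<mm>) L" using ideal_ext m.is_ideal by blast
  have proper: "\<one>\<^bsub>L\<^esub> \<notin> ext \<mm>"
  proof
    assume "\<one>\<^bsub>L\<^esub> \<in> ext \<mm>"
    then obtain u where "u \<in> S" "u \<otimes> \<one> \<in> \<mm>"
      using fr_in_ext_iff[OF m.is_ideal, of \<one> \<one>] by (auto simp: one_L)
    then show False by (auto simp: S)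
  qed
  have sub: "I \<subseteq> ext \<mm>" if I: "ideal I L" "\<one>\<^bsub>L\<^esub> \<notin> I" for I
  proof -
    have "con I \<subseteq> \<mm>"
    proof
      fix a assume a: "a \<in> con I"
      then have ac: "a \<in> carrier A" by (simp add: con_def)
      show "a \<in> \<mm>"
      proof (rule ccontr)
        assume "a \<notin> \<mm>"
        then have aS: "a \<in> S" using ac S by simp
        then have "fr a a \<in> I" using fr_in_ideal_iff[OF I(1) ac] a by simp
        moreover have "fr a a = \<one>\<^bsub>L\<^esub>" unfolding one_L using ac aS by (intro fr_eqI') auto
        ultimately show False using I(2) by simp
      qed
    qed
    then have "ext (con I) \<subseteq> ext \<mm>" by (rule ext_mono)
    then show ?thesis using ext_con[OF I(1)] by simp
  qed
  show max: "maximalideal (ext \<mm>) L"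
  proof (rule maximalidealI[OF me])
    show "carrier L \<noteq> ext \<mm>" using proper L.one_closed by blast
    fix I assume I: "ideal I L" "ext \<mm> \<subseteq> I" "I \<subseteq> carrier L"
    show "I = ext \<mm> \<or> I = carrier L"
      using sub[OF I(1)] I ideal.one_imp_carrier[OF I(1)] by blast
  qed
  assume n: "maximalideal \<nn> L"
  interpret n: maximalideal \<nn> L by fact
  have "\<nn> \<subseteq> ext \<mm>" using sub[OF n.is_ideal] n.one_imp_carrier n.I_notcarr by blast
  moreover have "ext \<mm> \<subseteq> carrier L" using ideal.Icarr[OF me] by auto
  ultimately show "\<nn> = ext \<mm>"
    using n.I_maximal[OF me] proper L.one_closed by blast
qed

end

text \<open>Both hypotheses are global and pass to each localization: a chain of primes contracts to
  a strict chain in \<open>R\<close>, and a regular sequence inside \<open>\<mm>\<close> stays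
  regular. Depth is then at least \<open>d\<close> and dimension at most \<open>d\<close>, while
  depth never exceeds dimension.\<close>

theorem (in cring) cohen_macaulayI:
  assumes noeth: "noetherian_ring R"
    and dim: "\<And>P. \<not> prime_chain R (Suc d) P"
    and reg: "\<And>\<mm>. maximalideal \<mm> R \<Longrightarrow>
      \<exists>xs. regular_sequence R xs \<and> set xs \<subseteq> \<mm> \<and> length xs = d"
  shows "cohen_macaulay R"
  unfolding cohen_macaulay_def
proof (intro conjI allI impI noeth cring_axioms)
  fix \<mm> assume m: "maximalideal \<mm> R"
  interpret m: maximalideal \<mm> R by fact
  interpret mp: primeideal \<mm> R using maximalideal_prime[OF m] .
  define S where "S = carrier R - \<mm>"
  have one: "\<one> \<notin> \<mm>" using m.one_imp_carrier m.I_notcarr by auto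
  interpret localized R S
    by unfold_locales (use one mp.I_prime in \<open>auto simp: S_def\<close>)
  interpret L: cring L by (rule cring_L)
  note max = maximal_ideal_L_unique[OF m S_def]
  have dimL: "krull_dim L \<le> enat d"
    unfolding krull_dim_alt
  proof (rule Sup_least, clarify)
    fix k P assume P: "prime_chain L k P"
    show "enat k \<le> enat d"
    proof (rule ccontr)
      assume "\<not> enat k \<le> enat d"
      then have k: "Suc d \<le> k" by simp
      have id: "ideal (P i) L" if "i \<le> k" for i
        using P that by (auto simp: prime_chain_def primeideal_def)
      have "prime_chain R (Suc d) (\<lambda>i. con (P i))"
        unfolding prime_chain_def
      proof (intro conjI allI impI)
        fix i assume "i \<le> Suc d"
        then show "primeideal (con (P i)) R" using P k by (intro prime_con) (auto simp: prime_chain_def)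
      next
        fix i assume "i < Suc d"
        then show "con (P i) \<subset> con (P (Suc i))"
          using P k id by (intro con_strict_mono) (auto simp: prime_chain_def)
      qed
      then show False using dim by blast
    qed
  qed
  have depthL: "enat d \<le> depth L (ext \<mm>)"
  proof -
    obtain xs where xs: "regular_sequence R xs" "set xs \<subseteq> \<mm>" "length xs = d" using reg[OF m] by blast
    have xsc: "set xs \<subseteq> carrier R" using xs by (auto simp: regular_sequence_def)
    have sub: "(\<lambda>a. fr a \<one>) ` set xs \<subseteq> ext \<mm>" using xs extI by auto
    interpret e: maximalideal "ext \<mm>" L by (rule max(1))
    have "genideal L ((\<lambda>a. fr a \<one>) ` set xs) \<subseteq> ext \<mm>"
      using L.genideal_minimal[OF e.is_ideal sub] .
    then have "genideal L ((\<lambda>a. fr a \<one>) ` set xs) \<noteq> carrier L"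
      using e.I_notcarr e.Icarr by blast
    then have "regular_sequence L (map (\<lambda>a. fr a \<one>) xs)" using regular_sequence_L xs by blast
    then show ?thesis
      unfolding depth_def using sub xs by (intro Sup_upper) (auto intro!: exI[of _ "map (\<lambda>a. fr a \<one>) xs"])
  qed
  have "depth L (ext \<mm>) = krull_dim L"
    using dimL depthL L.depth_le_krull_dim[of "ext \<mm>"] by (meson order_trans antisym)
  then show "cohen_macaulay_local (localization R (carrier R - \<mm>))"
    unfolding cohen_macaulay_local_def S_def[symmetric]
    using max noetherian_L[OF noeth] cring_L by metis
qed


section \<open>Evaluation of polynomials\<close>

definition mon :: "('v \<Rightarrow> 'r::comm_ring_1) \<Rightarrow> ('v \<Rightarrow>\<^sub>0 nat) \<Rightarrow> 'r" where
  "mon x m = (\<Prod>i\<in>Poly_Mapping.keys m. x i ^ Poly_Mapping.lookup m i)"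

text \<open>The map \<open>\<kappa>\<close> on coefficients makes one notion serve for evaluation at
  points (\<open>id\<close>), for substitution of polynomials (\<open>Const\<close>), and for
  passing to polynomials in a new indeterminate.\<close>

definition ev :: "('k \<Rightarrow> 'r) \<Rightarrow> ('v \<Rightarrow> 'r::comm_ring_1) \<Rightarrow> (('v \<Rightarrow>\<^sub>0 nat) \<Rightarrow>\<^sub>0 'k::comm_ring_1) \<Rightarrow> 'r" where
  "ev \<kappa> x p = (\<Sum>m\<in>Poly_Mapping.keys p. \<kappa> (Poly_Mapping.lookup p m) * mon x m)"

definition Const :: "'k::comm_ring_1 \<Rightarrow> (('v \<Rightarrow>\<^sub>0 nat) \<Rightarrow>\<^sub>0 'k)" where
  "Const c = Poly_Mapping.single 0 c"

definition Var :: "'v \<Rightarrow> (('v \<Rightarrow>\<^sub>0 nat) \<Rightarrow>\<^sub>0 'k::comm_ring_1)" where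
  "Var i = Poly_Mapping.single (Poly_Mapping.single i 1) 1"

definition polys_in :: "'v set \<Rightarrow> (('v \<Rightarrow>\<^sub>0 nat) \<Rightarrow>\<^sub>0 'k::comm_ring_1) set" where
  "polys_in V = {p. \<forall>m\<in>Poly_Mapping.keys p. Poly_Mapping.keys m \<subseteq> V}"

lemma mon_superset:
  assumes "finite K" "Poly_Mapping.keys m \<subseteq> K"
  shows "mon x m = (\<Prod>i\<in>K. x i ^ Poly_Mapping.lookup m i)"
  unfolding mon_def by (rule prod.mono_neutral_left) (use assms in \<open>auto simp: in_keys_iff\<close>)

lemma mon_0 [simp]: "mon x 0 = 1" by (simp add: mon_def)

lemma mon_single [simp]: "mon x (Poly_Mapping.single i k) = x i ^ k"
  by (cases "k = 0") (auto simp: mon_def)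

lemma mon_add: "mon x (m + m') = mon x m * mon x m'"
proof -
  let ?K = "Poly_Mapping.keys m \<union> Poly_Mapping.keys m'"
  have "mon x (m + m') = (\<Prod>i\<in>?K. x i ^ Poly_Mapping.lookup (m + m') i)"
    by (rule mon_superset) (auto simp: keys_add)
  also have "\<dots> = (\<Prod>i\<in>?K. x i ^ Poly_Mapping.lookup m i) * (\<Prod>i\<in>?K. x i ^ Poly_Mapping.lookup m' i)"
    by (simp add: lookup_add power_add prod.distrib)
  also have "\<dots> = mon x m * mon x m'"
    by (subst (1 2) mon_superset[of ?K]) auto
  finally show ?thesis .
qed

lemma sum_single: "p = (\<Sum>m\<in>Poly_Mapping.keys p. Poly_Mapping.single m (Poly_Mapping.lookup p m))"
  by (rule poly_mapping_eqI)
    (auto simp: lookup_sum lookup_single when_def in_keys_iff)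

lemma single_decomp:
  "Poly_Mapping.single m (c::'k::comm_ring_1) = Const c * (\<Prod>i\<in>Poly_Mapping.keys m. Var i ^ Poly_Mapping.lookup m i)"
proof -
  have pw: "Var i ^ k = Poly_Mapping.single (Poly_Mapping.single i k) (1::'k)" for i :: 'a and k
    by (induction k) (auto simp: Var_def mult_single single_add[symmetric])
  have "(\<Prod>i\<in>K. Var i ^ Poly_Mapping.lookup m i) = Poly_Mapping.single (\<Sum>i\<in>K. Poly_Mapping.single i (Poly_Mapping.lookup m i)) (1::'k)"
    if "finite K" for K
    using that by (induction K) (auto simp: pw mult_single)
  then show ?thesis using sum_single[of m, symmetric] by (simp add: Const_def mult_single)
qed

lemma lookup_single_0_mult:
  "Poly_Mapping.lookup (Poly_Mapping.single 0 c * p) m = c * Poly_Mapping.lookup p m"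
  for p :: "('v \<Rightarrow>\<^sub>0 nat) \<Rightarrow>\<^sub>0 'k::comm_ring_1"
  by (simp add: mult_map_scale_conv_mult[symmetric] Poly_Mapping.map.rep_eq when_def)

lemma polys_in_add [intro]: "p \<in> polys_in V \<Longrightarrow> q \<in> polys_in V \<Longrightarrow> p + q \<in> polys_in V"
  using Poly_Mapping.keys_add[of p q] by (auto simp: polys_in_def)

lemma polys_in_mult [intro]: "p \<in> polys_in V \<Longrightarrow> q \<in> polys_in V \<Longrightarrow> p * q \<in> polys_in V"
  unfolding polys_in_def
proof clarify
  fix m i
  assume p: "\<forall>m\<in>Poly_Mapping.keys p. Poly_Mapping.keys m \<subseteq> V"
    and q: "\<forall>m\<in>Poly_Mapping.keys q. Poly_Mapping.keys m \<subseteq> V"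
    and m: "m \<in> Poly_Mapping.keys (p * q)" "i \<in> Poly_Mapping.keys m"
  obtain a b where "m = a + b" "a \<in> Poly_Mapping.keys p" "b \<in> Poly_Mapping.keys q"
    using keys_mult[of p q] m by auto
  then show "i \<in> V" using p q m Poly_Mapping.keys_add[of a b] by blast
qed

lemma polys_in_Const [simp, intro]: "Const c \<in> polys_in V"
  by (auto simp: polys_in_def Const_def)

lemma polys_in_Var [intro]: "i \<in> V \<Longrightarrow> Var i \<in> polys_in V"
  by (auto simp: polys_in_def Var_def)

lemma Const_simps [simp]: "Const 0 = 0" "Const 1 = 1"
  by (simp_all add: Const_def)

lemma Const_add: "Const (a + b) = Const a + Const b" and Const_mult: "Const (a * b) = Const a * Const b"
  by (simp_all add: Const_def single_add mult_single)

lemma comm_ring_hom_Const: "comm_ring_hom (Const :: 'k::comm_ring_1 \<Rightarrow> ('v \<Rightarrow>\<^sub>0 nat) \<Rightarrow>\<^sub>0 'k)"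
  by unfold_locales (simp_all add: Const_add Const_mult)

lemma polys_in_0 [simp, intro]: "0 \<in> polys_in V" and polys_in_1 [simp, intro]: "1 \<in> polys_in V"
  using polys_in_Const[of 0 V] polys_in_Const[of 1 V] by simp_all

lemma polys_in_uminus [intro]: "p \<in> polys_in V \<Longrightarrow> - p \<in> polys_in V"
  by (auto simp: polys_in_def in_keys_iff)

lemma polys_in_minus [intro]: "p \<in> polys_in V \<Longrightarrow> q \<in> polys_in V \<Longrightarrow> p - q \<in> polys_in V"
  using polys_in_add[of p V "- q"] by auto

lemma polys_in_sum [intro]: "(\<And>i. i \<in> I \<Longrightarrow> f i \<in> polys_in V) \<Longrightarrow> sum f I \<in> polys_in V"
  by (induction I rule: infinite_finite_induct) auto

lemma polys_in_prod [intro]: "(\<And>i. i \<in> I \<Longrightarrow> f i \<in> polys_in V) \<Longrightarrow> prod f I \<in> polys_in V"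
  by (induction I rule: infinite_finite_induct) auto

lemma polys_in_UNIV [simp]: "p \<in> polys_in UNIV" by (simp add: polys_in_def)

lemma polys_in_mono: "V \<subseteq> W \<Longrightarrow> polys_in V \<subseteq> polys_in W" by (auto simp: polys_in_def)

lemma polys_induct [consumes 1, case_names Const Var add mult]:
  assumes "p \<in> polys_in V"
    and const: "\<And>c. P (Const c)" and var: "\<And>i. i \<in> V \<Longrightarrow> P (Var i)"
    and add: "\<And>p q. P p \<Longrightarrow> P q \<Longrightarrow> P (p + q)" and mult: "\<And>p q. P p \<Longrightarrow> P q \<Longrightarrow> P (p * q)"
  shows "P p"
proof -
  have one: "P 1" and zero: "P 0" using const[of 1] const[of 0] by simp_all
  have pow: "P q \<Longrightarrow> P (q ^ k)" for q k
    by (induction k) (auto simp: one intro: mult)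
  have prod: "(\<And>i. i \<in> I \<Longrightarrow> P (f i)) \<Longrightarrow> P (prod f I)" for I and f :: "'a \<Rightarrow> _"
    by (induction I rule: infinite_finite_induct) (auto simp: one intro: mult)
  have sum: "(\<And>i. i \<in> I \<Longrightarrow> P (f i)) \<Longrightarrow> P (sum f I)" for I and f :: "('a \<Rightarrow>\<^sub>0 nat) \<Rightarrow> _"
    by (induction I rule: infinite_finite_induct) (auto simp: zero intro: add)
  have "P (Poly_Mapping.single m (Poly_Mapping.lookup p m))" if "m \<in> Poly_Mapping.keys p" for m
    unfolding single_decomp using that assms(1)
    by (intro mult const prod pow var) (auto simp: polys_in_def)
  then show ?thesis by (subst sum_single) (rule sum)
qed

locale evaluation = comm_ring_hom \<kappa> for \<kappa> :: "'k::comm_ring_1 \<Rightarrow> 'r::comm_ring_1"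
begin

lemma ev_superset:
  assumes "finite K" "Poly_Mapping.keys p \<subseteq> K"
  shows "ev \<kappa> x p = (\<Sum>m\<in>K. \<kappa> (Poly_Mapping.lookup p m) * mon x m)"
  unfolding ev_def by (rule sum.mono_neutral_left) (use assms in \<open>auto simp: in_keys_iff\<close>)

lemma ev_0 [simp]: "ev \<kappa> x 0 = 0" by (simp add: ev_def)

lemma ev_single [simp]: "ev \<kappa> x (Poly_Mapping.single m c) = \<kappa> c * mon x m"
  by (cases "c = 0") (auto simp: ev_def)

lemma ev_Const [simp]: "ev \<kappa> x (Const c) = \<kappa> c" by (simp add: Const_def)

lemma ev_Var [simp]: "ev \<kappa> x (Var i) = x i" by (simp add: Var_def)

lemma ev_add: "ev \<kappa> x (p + q) = ev \<kappa> x p + ev \<kappa> x q"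
proof -
  let ?K = "Poly_Mapping.keys p \<union> Poly_Mapping.keys q"
  have "ev \<kappa> x (p + q) = (\<Sum>m\<in>?K. \<kappa> (Poly_Mapping.lookup (p + q) m) * mon x m)"
    by (rule ev_superset) (auto simp: Poly_Mapping.keys_add)
  also have "\<dots> = (\<Sum>m\<in>?K. \<kappa> (Poly_Mapping.lookup p m) * mon x m) + (\<Sum>m\<in>?K. \<kappa> (Poly_Mapping.lookup q m) * mon x m)"
    by (simp add: lookup_add hom_add ring_distribs sum.distrib)
  also have "\<dots> = ev \<kappa> x p + ev \<kappa> x q"
    by (subst (1 2) ev_superset[of ?K]) auto
  finally show ?thesis .
qed

lemma ev_sum0: "ev \<kappa> x (sum f I) = (\<Sum>i\<in>I. ev \<kappa> x (f i))"
  by (induction I rule: infinite_finite_induct) (auto simp: ev_add)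

lemma ev_mult: "ev \<kappa> x (p * q) = ev \<kappa> x p * ev \<kappa> x q"
proof -
  have "p * q = (\<Sum>m\<in>Poly_Mapping.keys p. \<Sum>m'\<in>Poly_Mapping.keys q.
      Poly_Mapping.single (m + m') (Poly_Mapping.lookup p m * Poly_Mapping.lookup q m'))"
    by (subst sum_single[of p], subst sum_single[of q]) (simp add: sum_product mult_single)
  then have "ev \<kappa> x (p * q) = (\<Sum>m\<in>Poly_Mapping.keys p. \<Sum>m'\<in>Poly_Mapping.keys q.
      \<kappa> (Poly_Mapping.lookup p m * Poly_Mapping.lookup q m') * mon x (m + m'))"
    by (simp add: ev_sum0)
  also have "\<dots> = ev \<kappa> x p * ev \<kappa> x q"
    by (simp add: ev_def sum_product mon_add hom_mult mult_ac)
  finally show ?thesis .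
qed

lemma comm_ring_hom_ev: "comm_ring_hom (ev \<kappa> x)"
proof unfold_locales
  show "ev \<kappa> x 1 = 1" using ev_Const[of x 1] by (simp add: hom_one)
qed (simp_all add: ev_add ev_mult)

sublocale E: comm_ring_hom "ev \<kappa> x" for x by (rule comm_ring_hom_ev)

lemma ev_cong:
  assumes "p \<in> polys_in V" "\<And>i. i \<in> V \<Longrightarrow> x i = y i"
  shows "ev \<kappa> x p = ev \<kappa> y p"
  using assms(1) by (induction rule: polys_induct) (simp_all add: assms(2) ev_add ev_mult)

lemma ev_unique:
  assumes "comm_ring_hom h" "p \<in> polys_in V" "\<And>c. h (Const c) = \<kappa> c" "\<And>i. i \<in> V \<Longrightarrow> h (Var i) = x i"
  shows "h p = ev \<kappa> x p"
proof -
  interpret h: comm_ring_hom h by fact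
  show ?thesis using assms(2)
    by (induction rule: polys_induct) (simp_all add: assms(3,4) ev_add ev_mult h.hom_add h.hom_mult)
qed

end

lemma evaluation_Const: "evaluation Const"
  using comm_ring_hom_Const by (simp add: evaluation_def)

lemma evaluation_id: "evaluation (id :: 'k::comm_ring_1 \<Rightarrow> 'k)"
  unfolding evaluation_def by unfold_locales auto

interpretation EC: evaluation Const by (rule evaluation_Const)
interpretation EI: evaluation id by (rule evaluation_id)

lemma (in evaluation) ev_ev:
  "ev \<kappa> x (ev Const y p) = ev \<kappa> (\<lambda>i. ev \<kappa> x (y i)) p"
proof -
  have "comm_ring_hom (\<lambda>p. ev \<kappa> x (ev Const y p))"
    by unfold_locales (simp_all add: EC.ev_add EC.ev_mult ev_add ev_mult EC.E.hom_one E.hom_one)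
  then show ?thesis
    by (rule ev_unique[where V = UNIV]) auto
qed

lemma ev_Const_in:
  assumes "p \<in> polys_in V" "\<And>i. i \<in> V \<Longrightarrow> y i \<in> polys_in W"
  shows "ev Const y p \<in> polys_in W"
  using assms(1) by (induction rule: polys_induct) (auto simp: EC.ev_add EC.ev_mult assms(2))

lemma ev_Const_Var: "ev Const Var p = p"
proof -
  have "comm_ring_hom (id :: (('a \<Rightarrow>\<^sub>0 nat) \<Rightarrow>\<^sub>0 'b) \<Rightarrow> _)" by unfold_locales auto
  then show ?thesis using EC.ev_unique[of id p UNIV Var] by simp
qed

section \<open>Separating monomials by their digits in base e\<close>

lemma digits_unique:
  fixes f g :: "nat \<Rightarrow> nat"
  assumes "\<And>i. i < N \<Longrightarrow> f i < e" "\<And>i. i < N \<Longrightarrow> g i < e"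
    and "(\<Sum>i<N. f i * e ^ i) = (\<Sum>i<N. g i * e ^ i)" "i < N"
  shows "f i = g i"
  using assms
proof (induction N arbitrary: f g i)
  case (Suc N)
  have s: "(\<Sum>i<Suc N. h i * e ^ i) = h 0 + e * (\<Sum>i<N. h (Suc i) * e ^ i)" for h :: "nat \<Rightarrow> nat"
    by (subst sum.lessThan_Suc_shift) (simp add: sum_distrib_left mult_ac)
  have eq: "f 0 + e * (\<Sum>i<N. f (Suc i) * e ^ i) = g 0 + e * (\<Sum>i<N. g (Suc i) * e ^ i)"
    using Suc.prems(3) unfolding s .
  have lt: "f 0 < e" "g 0 < e" using Suc.prems by auto
  have 0: "f 0 = g 0" using arg_cong[OF eq, of "\<lambda>t. t mod e"] lt by simp
  then have "(\<Sum>i<N. f (Suc i) * e ^ i) = (\<Sum>i<N. g (Suc i) * e ^ i)" using eq lt by simp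
  then have "j < N \<Longrightarrow> f (Suc j) = g (Suc j)" for j
    using Suc.IH[of "\<lambda>i. f (Suc i)" "\<lambda>i. g (Suc i)" j] Suc.prems(1,2) by auto
  then show ?case using 0 Suc.prems(4) by (cases i) auto
qed simp

text \<open>The exponent vector read as a number in base \<open>e\<close>. It separates monomials
  once \<open>e\<close> exceeds all exponents, which serves both Kronecker's substitution and the
  change of variables in Zariski's lemma.\<close>

definition weight :: "nat \<Rightarrow> nat \<Rightarrow> (nat \<Rightarrow>\<^sub>0 nat) \<Rightarrow> nat" where
  "weight e N m = (\<Sum>i<N. Poly_Mapping.lookup m i * e ^ i)"

lemma inj_on_weight:
  assumes p: "p \<in> polys_in {..<N}"
  obtains e where "\<And>m i. m \<in> Poly_Mapping.keys p \<Longrightarrow> Poly_Mapping.lookup m i < e"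
    "inj_on (weight e N) (Poly_Mapping.keys p)"
proof -
  let ?E = "\<Union>m\<in>Poly_Mapping.keys p. Poly_Mapping.range m"
  define e where "e = Suc (Max (insert 0 ?E))"
  have fin: "finite (insert 0 ?E)" by simp
  have lt: "Poly_Mapping.lookup m i < e" if "m \<in> Poly_Mapping.keys p" for m i
  proof (cases "Poly_Mapping.lookup m i = 0")
    case False
    then have "Poly_Mapping.lookup m i \<in> insert 0 ?E"
      using that in_keys_lookup_in_range[of i m] by (auto simp: in_keys_iff simp del: in_keys_lookup_in_range)
    then show ?thesis unfolding e_def using Max_ge[OF fin] by (simp add: less_Suc_eq_le)
  qed (simp add: e_def)
  have "inj_on (weight e N) (Poly_Mapping.keys p)"
  proof (rule inj_onI)
    fix m m' assume m: "m \<in> Poly_Mapping.keys p" "m' \<in> Poly_Mapping.keys p"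
      and eq: "weight e N m = weight e N m'"
    show "m = m'"
    proof (rule poly_mapping_eqI)
      fix i
      show "Poly_Mapping.lookup m i = Poly_Mapping.lookup m' i"
      proof (cases "i < N")
        case True
        then show ?thesis
          using digits_unique[of N "Poly_Mapping.lookup m" e "Poly_Mapping.lookup m'" i] lt m eq
          by (auto simp: weight_def)
      next
        case False
        then have "i \<notin> Poly_Mapping.keys m" "i \<notin> Poly_Mapping.keys m'"
          using p m by (auto simp: polys_in_def)
        then show ?thesis by (simp add: in_keys_iff)
      qed
    qed
  qed
  then show ?thesis using that lt by blast
qed

lemma polys_in_lessThan: "\<exists>N. p \<in> polys_in {..<N::nat}"
proof -
  have "finite (\<Union>m\<in>Poly_Mapping.keys p. Poly_Mapping.keys m)" by simp
  then obtain N where "(\<Union>m\<in>Poly_Mapping.keys p. Poly_Mapping.keys m) \<subseteq> {..<N}"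
    by (meson finite_nat_iff_bounded)
  then show ?thesis by (auto simp: polys_in_def)
qed

text \<open>Kronecker's substitution \<open>x\<^sub>i \<mapsto> s ^ (e ^ i)\<close> reduces to one variable.\<close>

lemma poly_zero_if_vanishing:
  fixes p :: "(nat \<Rightarrow>\<^sub>0 nat) \<Rightarrow>\<^sub>0 'k::field_char_0"
  assumes "\<And>x. ev id x p = 0"
  shows "p = 0"
proof (rule ccontr)
  assume "p \<noteq> 0"
  then obtain m where m: "m \<in> Poly_Mapping.keys p"
    by (metis poly_mapping_eqI lookup_zero in_keys_iff)
  obtain N where N: "p \<in> polys_in {..<N}" using polys_in_lessThan by blast
  obtain e where e: "inj_on (weight e N) (Poly_Mapping.keys p)" using inj_on_weight[OF N] by blast
  define q where "q = (\<Sum>m\<in>Poly_Mapping.keys p. Polynomial.monom (Poly_Mapping.lookup p m) (weight e N m))"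
  have "poly q s = 0" for s
  proof -
    have "mon (\<lambda>i. s ^ (e ^ i)) m = s ^ weight e N m" if "m \<in> Poly_Mapping.keys p" for m
    proof -
      have "mon (\<lambda>i. s ^ (e ^ i)) m = (\<Prod>i<N. (s ^ (e ^ i)) ^ Poly_Mapping.lookup m i)"
        using N that by (intro mon_superset) (auto simp: polys_in_def)
      also have "\<dots> = s ^ weight e N m"
        by (simp add: weight_def power_sum power_mult[symmetric] mult.commute)
      finally show ?thesis .
    qed
    then have "poly q s = ev id (\<lambda>i. s ^ (e ^ i)) p"
      by (simp add: q_def ev_def poly_sum poly_monom)
    then show ?thesis using assms by simp
  qed
  then have q0: "q = 0" using poly_all_0_iff_0 by blast
  have "Polynomial.coeff q (weight e N m)
      = (\<Sum>m'\<in>Poly_Mapping.keys p. if m' = m then Poly_Mapping.lookup p m' else 0)"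
    unfolding q_def coeff_sum using e m by (intro sum.cong refl) (auto simp: inj_on_def)
  also have "\<dots> = Poly_Mapping.lookup p m" using m by simp
  finally show False using q0 m by (simp add: in_keys_iff)
qed

text \<open>The product \<open>p * q\<close> vanishes everywhere and the polynomial ring is a
  domain, so testing for zero may be restricted to the points where \<open>q\<close> is
  nonzero.\<close>

lemma poly_zero_if_vanishing_generic:
  fixes p q :: "(nat \<Rightarrow>\<^sub>0 nat) \<Rightarrow>\<^sub>0 'k::field_char_0"
  assumes "q \<noteq> 0" "\<And>x. ev id x q \<noteq> 0 \<Longrightarrow> ev id x p = 0"
  shows "p = 0"
proof -
  have "ev id x (p * q) = 0" for x using assms(2)[of x] by (auto simp: EI.ev_mult)
  then have "p * q = 0" by (rule poly_zero_if_vanishing)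
  then show ?thesis using assms(1) by simp
qed

lemma Var_nonzero [simp]: "Var i \<noteq> (0 :: ('v \<Rightarrow>\<^sub>0 nat) \<Rightarrow>\<^sub>0 'k::comm_ring_1)"
  by (metis Var_def lookup_single_eq lookup_zero zero_neq_one)


section \<open>Zariski's lemma\<close>

context evaluation
begin

definition alg :: "(nat \<Rightarrow> 'r) \<Rightarrow> nat \<Rightarrow> 'r set" where
  "alg u N = ev \<kappa> u ` polys_in {..<N}"

lemma alg_add: "x \<in> alg u N \<Longrightarrow> y \<in> alg u N \<Longrightarrow> x + y \<in> alg u N"
  unfolding alg_def by (auto simp: ev_add[symmetric])

lemma alg_mult: "x \<in> alg u N \<Longrightarrow> y \<in> alg u N \<Longrightarrow> x * y \<in> alg u N"
  unfolding alg_def by (auto simp: ev_mult[symmetric])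

lemma alg_const: "\<kappa> c \<in> alg u N"
  unfolding alg_def using ev_Const by (metis image_eqI polys_in_Const)

lemma alg_0: "0 \<in> alg u N" and alg_1: "1 \<in> alg u N"
  using alg_const[of 0 u N] alg_const[of 1 u N] by (simp_all add: hom_zero hom_one)

lemma alg_gen: "i < N \<Longrightarrow> u i \<in> alg u N"
  unfolding alg_def by (rule image_eqI[of _ _ "Var i"]) auto

lemma alg_uminus: "x \<in> alg u N \<Longrightarrow> - x \<in> alg u N"
  using alg_mult[OF alg_const[of "-1" u N], of x] by (simp add: hom_uminus hom_one)

lemma alg_diff: "x \<in> alg u N \<Longrightarrow> y \<in> alg u N \<Longrightarrow> x - y \<in> alg u N"
  using alg_add[OF _ alg_uminus, of x u N y] by simp

lemma alg_power: "x \<in> alg u N \<Longrightarrow> x ^ k \<in> alg u N"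
  by (induction k) (auto intro: alg_1 alg_mult)

lemma alg_induct [consumes 1, case_names const gen add mult]:
  assumes "x \<in> alg u N"
    and const: "\<And>c. P (\<kappa> c)" and gen: "\<And>i. i < N \<Longrightarrow> P (u i)"
    and add: "\<And>x y. P x \<Longrightarrow> P y \<Longrightarrow> P (x + y)" and mult: "\<And>x y. P x \<Longrightarrow> P y \<Longrightarrow> P (x * y)"
  shows "P x"
proof -
  obtain p where "p \<in> polys_in {..<N}" "x = ev \<kappa> u p" using assms(1) by (auto simp: alg_def)
  moreover have "P (ev \<kappa> u p)" if "p \<in> polys_in {..<N}" for p
    using that by (induction rule: polys_induct) (auto simp: ev_add ev_mult intro: const gen add mult)
  ultimately show ?thesis by simp
qed

text \<open>The element \<open>t\<close> may satisfy relations over \<open>B\<close>, so an element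
  has no degree of its own. Membership records that some expression of it in the powers of
  \<open>t\<close> has degree below \<open>D\<close>; \<open>monic_in\<close> below is meant in the
  same sense.\<close>

inductive_set lowdeg :: "'r set \<Rightarrow> 'r \<Rightarrow> nat \<Rightarrow> 'r set" for B t D where
  zero: "0 \<in> lowdeg B t D"
| add: "x \<in> lowdeg B t D \<Longrightarrow> y \<in> lowdeg B t D \<Longrightarrow> x + y \<in> lowdeg B t D"
| monom: "b \<in> B \<Longrightarrow> j < D \<Longrightarrow> b * t ^ j \<in> lowdeg B t D"

lemma lowdeg_mono: "x \<in> lowdeg B t D \<Longrightarrow> D \<le> E \<Longrightarrow> x \<in> lowdeg B t E"
  by (induction rule: lowdeg.induct) (auto intro: lowdeg.intros)

lemma lowdeg_sum_rep:
  assumes "x \<in> lowdeg (alg u N) t D"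
  shows "\<exists>b. (\<forall>j. b j \<in> alg u N) \<and> x = (\<Sum>j<D. b j * t ^ j)"
  using assms
proof (induction rule: lowdeg.induct)
  case zero
  show ?case by (intro exI[of _ "\<lambda>_. 0"]) (auto simp: alg_0)
next
  case (add x y)
  then obtain b c where "\<forall>j. b j \<in> alg u N" "x = (\<Sum>j<D. b j * t ^ j)"
      "\<forall>j. c j \<in> alg u N" "y = (\<Sum>j<D. c j * t ^ j)" by blast
  then show ?case by (intro exI[of _ "\<lambda>j. b j + c j"]) (auto simp: alg_add ring_distribs sum.distrib)
next
  case (monom b j)
  have "(\<Sum>i<D. (if i = j then b else 0) * t ^ i) = (\<Sum>i<D. if i = j then b * t ^ i else 0)"
    by (rule sum.cong) auto
  then show ?case using monom
    by (intro exI[of _ "\<lambda>i. if i = j then b else 0"]) (auto simp: alg_0)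
qed

lemma lowdeg_mult:
  assumes "x \<in> lowdeg (alg u N) t D" "y \<in> lowdeg (alg u N) t E"
  shows "x * y \<in> lowdeg (alg u N) t (D + E)"
  using assms(1)
proof (induction rule: lowdeg.induct)
  case (monom b j)
  show ?case using assms(2)
  proof (induction rule: lowdeg.induct)
    case (monom c i)
    have "(b * c) * t ^ (j + i) \<in> lowdeg (alg u N) t (D + E)"
      using monom \<open>b \<in> _\<close> \<open>j < D\<close> by (intro lowdeg.monom alg_mult) auto
    then show ?case by (simp add: power_add mult_ac)
  qed (auto simp: ring_distribs intro: lowdeg.intros)
qed (auto simp: ring_distribs intro: lowdeg.intros)

lemma lowdeg_power: "i < D \<Longrightarrow> t ^ i \<in> lowdeg (alg u N) t D"
  using lowdeg.monom[OF alg_1[of u N], of i D t] by simp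

lemma lowdeg_mult_power:
  assumes "x \<in> lowdeg (alg u N) t D"
  shows "x * t ^ i \<in> lowdeg (alg u N) t (D + i)"
  using assms
proof (induction rule: lowdeg.induct)
  case (monom b j)
  then have "b * t ^ (j + i) \<in> lowdeg (alg u N) t (D + i)" by (intro lowdeg.monom) auto
  then show ?case by (simp add: power_add mult_ac)
qed (auto simp: ring_distribs intro: lowdeg.intros)

lemma lowdeg_alg_mult:
  assumes "c \<in> alg u N" "x \<in> lowdeg (alg u N) t D"
  shows "c * x \<in> lowdeg (alg u N) t D"
  using assms(2)
proof (induction rule: lowdeg.induct)
  case (monom b j)
  then have "(c * b) * t ^ j \<in> lowdeg (alg u N) t D" using assms(1) by (intro lowdeg.monom alg_mult)
  then show ?case by (simp add: mult_ac)
qed (auto simp: ring_distribs intro: lowdeg.intros)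

definition monic_in :: "(nat \<Rightarrow> 'r) \<Rightarrow> nat \<Rightarrow> 'r \<Rightarrow> nat \<Rightarrow> 'r \<Rightarrow> bool" where
  "monic_in u N t D q \<longleftrightarrow> q - t ^ D \<in> lowdeg (alg u N) t D"

lemma monic_in_1: "monic_in u N t 0 1"
  by (simp add: monic_in_def lowdeg.zero)

lemma monic_in_mult:
  assumes "monic_in u N t D q" "monic_in u N t E r"
  shows "monic_in u N t (D + E) (q * r)"
proof -
  define x y where "x = q - t ^ D" and "y = r - t ^ E"
  have *: "q * r - t ^ (D + E) = x * y + (x * t ^ E + y * t ^ D)"
    by (simp add: x_def y_def algebra_simps power_add)
  have "x \<in> lowdeg (alg u N) t D" "y \<in> lowdeg (alg u N) t E"
    using assms by (simp_all add: monic_in_def x_def y_def)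
  then have "x * y \<in> lowdeg (alg u N) t (D + E)" "x * t ^ E \<in> lowdeg (alg u N) t (D + E)"
      "y * t ^ D \<in> lowdeg (alg u N) t (D + E)"
    using lowdeg_mult[of x u N t D y E] lowdeg_mult_power[of x u N t D E]
      lowdeg_mult_power[of y u N t E D] by (simp_all add: add.commute)
  then show ?thesis
    unfolding monic_in_def * by (intro lowdeg.add)
qed

lemma monic_in_power: "monic_in u N t D q \<Longrightarrow> monic_in u N t (D * k) (q ^ k)"
  by (induction k) (auto simp: monic_in_1 intro: monic_in_mult)

lemma monic_in_prod:
  "finite I \<Longrightarrow> (\<And>i. i \<in> I \<Longrightarrow> monic_in u N t (D i) (f i)) \<Longrightarrow> monic_in u N t (sum D I) (prod f I)"
  by (induction I rule: finite_induct) (auto simp: monic_in_1 intro: monic_in_mult)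

end

text \<open>Congruence modulo a prime ideal \<open>M\<close> of the ambient ring replaces the
  residue domain, so that no quotient has to be formed.\<close>

locale prime_algebra = evaluation \<kappa> for \<kappa> :: "'k::alg_closed_field \<Rightarrow> 'r::comm_ring_1" +
  fixes M :: "'r set"
  assumes M_0: "0 \<in> M" and M_add: "x \<in> M \<Longrightarrow> y \<in> M \<Longrightarrow> x + y \<in> M"
    and M_mult: "x \<in> M \<Longrightarrow> r * x \<in> M" and M_1: "1 \<notin> M"
    and M_prime: "x * y \<in> M \<Longrightarrow> x \<in> M \<or> y \<in> M"
begin

lemma M_mult': "x \<in> M \<Longrightarrow> x * r \<in> M"
  using M_mult[of x r] by (simp add: mult.commute)

lemma M_uminus: "x \<in> M \<Longrightarrow> - x \<in> M"
  using M_mult[of x "-1"] by simp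

lemma M_sum: "(\<And>i. i \<in> I \<Longrightarrow> f i \<in> M) \<Longrightarrow> sum f I \<in> M"
  by (induction I rule: infinite_finite_induct) (auto intro: M_0 M_add)

lemma cong_trans: "x - y \<in> M \<Longrightarrow> y - z \<in> M \<Longrightarrow> x - z \<in> M"
  using M_add[of "x - y" "y - z"] by simp

lemma cong_add: "x - y \<in> M \<Longrightarrow> x' - y' \<in> M \<Longrightarrow> (x + x') - (y + y') \<in> M"
  using M_add[of "x - y" "x' - y'"] by (simp add: algebra_simps)

lemma cong_mult: "x - y \<in> M \<Longrightarrow> x' - y' \<in> M \<Longrightarrow> x * x' - y * y' \<in> M"
  using M_add[OF M_mult'[of "x - y" x'] M_mult[of "x' - y'" y]] by (simp add: algebra_simps)

text \<open>Nakayama's lemma by elimination in place of determinants: each step removes one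
  \<open>t i\<close> from the right-hand sides, and the factor on the left keeps the form 1 plus a
  multiple of \<open>b\<close>. The assumption \<open>D \<le> E\<close> guarantees that the equation
  for the eliminated index is available.\<close>

lemma nakayama:
  fixes D E :: nat and t :: "nat \<Rightarrow> 'r"
  assumes b: "b \<in> alg u N" and s: "\<exists>r\<in>alg u N. s = 1 + b * r"
    and a: "\<And>i j. a i j \<in> alg u N"
    and eq: "\<And>j. j < E \<Longrightarrow> s * t j - b * (\<Sum>i<D. a j i * t i) \<in> M" and DE: "D \<le> E"
  shows "\<exists>r\<in>alg u N. \<forall>j<E. (1 + b * r) * t j \<in> M"
  using s a eq DE
proof (induction D arbitrary: s a)
  case 0
  then show ?case by auto
next
  case (Suc D)
  obtain r where r: "r \<in> alg u N" "s = 1 + b * r" using Suc.prems(1) by blast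
  define s' where "s' = s - b * a D D"
  have s': "s' = 1 + b * (r - a D D)" by (simp add: s'_def r algebra_simps)
  let ?a = "\<lambda>j i. s' * a j i + b * a j D * a D i"
  have 0: "s' * t D - b * (\<Sum>i<D. a D i * t i) \<in> M"
    using Suc.prems(3)[of D] Suc.prems(4) by (simp add: s'_def algebra_simps)
  show ?case
  proof (rule Suc.IH[of "s' * s" ?a])
    have "s' * s = 1 + b * (r + (r - a D D) + b * r * (r - a D D))"
      unfolding s' r(2) by (simp add: algebra_simps)
    moreover have "r + (r - a D D) + b * r * (r - a D D) \<in> alg u N"
      using r Suc.prems(2) b by (intro alg_add alg_mult alg_diff)
    ultimately show "\<exists>r\<in>alg u N. s' * s = 1 + b * r" by blast
    have "s' \<in> alg u N" unfolding s' using r Suc.prems(2) b by (intro alg_add alg_mult alg_diff alg_1)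
    then show "?a i j \<in> alg u N" for i j
      using Suc.prems(2) b by (intro alg_add alg_mult) auto
    show "D \<le> E" using Suc.prems by simp
    fix j assume j: "j < E"
    have "s' * (s * t j - b * (\<Sum>i<Suc D. a j i * t i))
        + (b * a j D) * (s' * t D - b * (\<Sum>i<D. a D i * t i)) \<in> M"
      using Suc.prems(3)[OF j] 0 by (intro M_add M_mult)
    also have "s' * (s * t j - b * (\<Sum>i<Suc D. a j i * t i))
        + (b * a j D) * (s' * t D - b * (\<Sum>i<D. a D i * t i))
      = s' * s * t j - b * (\<Sum>i<D. ?a j i * t i)"
      by (simp add: ring_distribs sum.distrib sum_distrib_left right_diff_distrib mult_ac)
    finally show "s' * s * t j - b * (\<Sum>i<D. ?a j i * t i) \<in> M" .
  qed
qed

text \<open>Over an algebraically closed field \<open>p\<close> splits into linear factors; as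
  \<open>M\<close> is prime and contains no nonzero constant, it contains one of these factors at
  \<open>t\<close>.\<close>

lemma root_of_poly:
  assumes "p \<noteq> 0" "poly (map_poly \<kappa> p) t \<in> M"
  shows "\<exists>c. t - \<kappa> c \<in> M"
  using assms
proof (induction "Polynomial.degree p" arbitrary: p)
  case 0
  then obtain c where c: "p = [:c:]" by (metis degree_eq_zeroE)
  then have "\<kappa> c \<in> M" "c \<noteq> 0" using 0 by (auto simp: map_poly_pCons)
  then have "\<kappa> (inverse c) * \<kappa> c \<in> M" by (intro M_mult)
  then show ?case using M_1 \<open>c \<noteq> 0\<close> by (simp add: hom_mult[symmetric] hom_one)
next
  case (Suc n)
  obtain a where "poly p a = 0" using alg_closed_imp_poly_has_root[of p] Suc by auto
  then obtain q where q: "p = [:- a, 1:] * q" by (auto simp: poly_eq_0_iff_dvd)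
  have q0: "q \<noteq> 0" using q Suc by auto
  have "map_poly \<kappa> p = [:- \<kappa> a, 1:] * map_poly \<kappa> q"
    unfolding q by (rule poly_eqI)
      (auto simp: coeff_map_poly hom_add hom_mult hom_uminus hom_minus hom_zero coeff_pCons split: nat.split)
  then have "(t - \<kappa> a) * poly (map_poly \<kappa> q) t \<in> M" using Suc.prems by (simp add: left_diff_distrib)
  moreover have "Polynomial.degree q = n"
    using Suc(2) q0 unfolding q by (subst (asm) Polynomial.degree_mult_eq) auto
  ultimately show ?case using M_prime Suc.hyps(1)[of q] q0 by blast
qed

lemma alg_cong_const:
  assumes u: "\<And>i. i < N \<Longrightarrow> \<exists>c. u i - \<kappa> c \<in> M" and "x \<in> alg u N"
  shows "\<exists>c. x - \<kappa> c \<in> M"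
  using assms(2)
proof (induction rule: alg_induct)
  case (const c)
  show ?case using M_0 by (intro exI[of _ c]) simp
next
  case (add x y)
  then obtain c d where "x - \<kappa> c \<in> M" "y - \<kappa> d \<in> M" by blast
  then show ?case using cong_add[of x "\<kappa> c" y "\<kappa> d"] by (intro exI[of _ "c + d"]) (simp add: hom_add)
next
  case (mult x y)
  then obtain c d where "x - \<kappa> c \<in> M" "y - \<kappa> d \<in> M" by blast
  then show ?case using cong_mult[of x "\<kappa> c" y "\<kappa> d"] by (intro exI[of _ "c * d"]) (simp add: hom_mult)
qed (use u in auto)

text \<open>The assumption says that the algebra is a field modulo \<open>M\<close>. Noether
  normalization makes it integral over an algebra with one generator fewer; that algebra is again a
  field modulo \<open>M\<close>, which is what the induction needs.\<close>

theorem zariski_lemma: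
  assumes "\<And>b. b \<in> alg u N \<Longrightarrow> b \<notin> M \<Longrightarrow> \<exists>b'\<in>alg u N. b * b' - 1 \<in> M" "i < N"
  shows "\<exists>c. u i - \<kappa> c \<in> M"
  using assms
proof (induction N arbitrary: u i)
  case (Suc N)
  show ?case
  proof (cases "\<exists>F\<in>polys_in {..<Suc N}. F \<noteq> 0 \<and> ev \<kappa> u F \<in> M")
    case False
    \<comment> \<open>Without a relation modulo \<open>M\<close> the algebra behaves as a polynomial
      ring, where \<open>Var 0\<close> has no inverse: the equation \<open>Var 0 * G = 1\<close>
      fails at the origin.\<close>
    have "u 0 \<notin> M" using False polys_in_Var[of 0 "{..<Suc N}"] ev_Var[of u 0] Var_nonzero by fastforce
    then obtain G where G: "G \<in> polys_in {..<Suc N}" "u 0 * ev \<kappa> u G - 1 \<in> M"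
      using Suc.prems(1)[of "u 0"] alg_gen[of 0 "Suc N" u] by (auto simp: alg_def)
    have "Var 0 * G - 1 \<in> polys_in {..<Suc N}" using G by auto
    moreover have "ev \<kappa> u (Var 0 * G - 1) \<in> M" using G by (simp add: E.hom_minus ev_mult E.hom_one)
    ultimately have "Var 0 * G - 1 = 0" using False by blast
    then have "ev id (\<lambda>_. 0) (Var 0 * G) = ev id (\<lambda>_. 0) 1" by simp
    then have False by (simp add: EI.ev_mult EI.E.hom_one)
    then show ?thesis ..
  next
    case True
    then obtain F where F: "F \<in> polys_in {..<Suc N}" "F \<noteq> 0" "ev \<kappa> u F \<in> M" by blast
    have ne: "Poly_Mapping.keys F \<noteq> {}" using F(2) by (metis poly_mapping_eqI lookup_zero in_keys_iff empty_iff)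
    obtain e where lt: "\<And>m i. m \<in> Poly_Mapping.keys F \<Longrightarrow> Poly_Mapping.lookup m i < e"
      and inj: "inj_on (weight e (Suc N)) (Poly_Mapping.keys F)"
      using inj_on_weight[OF F(1)] by metis
    have e: "e > 0" using lt ne by fastforce
    define t where "t = u 0"
    \<comment> \<open>Nagata's change of variables: every \<open>u i\<close> becomes monic of degree
      \<open>e ^ i\<close> in \<open>t\<close>, and a monomial of \<open>F\<close> becomes monic of
      degree its weight. The weights are distinct, so a single monomial dominates and
      \<open>t\<close> is integral over \<open>?B\<close> modulo \<open>M\<close>.\<close>
    define u' where "u' i = u (Suc i) - t ^ (e ^ Suc i)" for i
    let ?B = "alg u' N"
    have mu: "monic_in u' N t (e ^ i) (u i)" if "i < Suc N" for i
    proof (cases i)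
      case 0
      then show ?thesis by (simp add: t_def monic_in_def lowdeg.zero)
    next
      case (Suc k)
      show ?thesis using lowdeg.monom[of "u' k" ?B 0 "e ^ i" t] alg_gen[of k N u'] that Suc e
        by (simp add: monic_in_def u'_def)
    qed
    have mm: "monic_in u' N t (weight e (Suc N) m) (mon u m)" if "m \<in> Poly_Mapping.keys F" for m
    proof -
      have "mon u m = (\<Prod>i<Suc N. u i ^ Poly_Mapping.lookup m i)"
        using F that by (intro mon_superset) (auto simp: polys_in_def)
      also have "monic_in u' N t (\<Sum>i<Suc N. e ^ i * Poly_Mapping.lookup m i) \<dots>"
        by (intro monic_in_prod monic_in_power mu) auto
      finally show ?thesis by (simp add: weight_def mult.commute)
    qed
    define D where "D = Max (weight e (Suc N) ` Poly_Mapping.keys F)"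
    have "D \<in> weight e (Suc N) ` Poly_Mapping.keys F" unfolding D_def using ne by (intro Max_in) auto
    then obtain m where m: "m \<in> Poly_Mapping.keys F" "D = weight e (Suc N) m" by blast
    define c where "c = Poly_Mapping.lookup F m"
    have c: "c \<noteq> 0" using m by (simp add: c_def in_keys_iff)
    have less: "weight e (Suc N) m' < D" if "m' \<in> Poly_Mapping.keys F - {m}" for m'
    proof -
      have "weight e (Suc N) m' \<le> D" unfolding D_def using that by (intro Max_ge) auto
      moreover have "weight e (Suc N) m' \<noteq> D" using that m inj by (auto simp: inj_on_def)
      ultimately show ?thesis by simp
    qed
    define l where "l = \<kappa> c * (mon u m - t ^ D) + (\<Sum>m'\<in>Poly_Mapping.keys F - {m}. \<kappa> (Poly_Mapping.lookup F m') * mon u m')"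
    have evF: "ev \<kappa> u F = \<kappa> c * t ^ D + l"
      unfolding ev_def l_def using m by (subst sum.remove[of _ m]) (auto simp: c_def algebra_simps)
    have sumL: "sum f I \<in> lowdeg ?B t D" if "\<And>i. i \<in> I \<Longrightarrow> f i \<in> lowdeg ?B t D" for f and I :: "(nat \<Rightarrow>\<^sub>0 nat) set"
      using that by (induction I rule: infinite_finite_induct) (auto intro: lowdeg.intros)
    have "mon u m' \<in> lowdeg ?B t D" if "m' \<in> Poly_Mapping.keys F - {m}" for m'
    proof -
      have "(mon u m' - t ^ weight e (Suc N) m') + t ^ weight e (Suc N) m' \<in> lowdeg ?B t D"
        using mm[of m'] that less[OF that]
        by (intro lowdeg.add lowdeg_power) (auto simp: monic_in_def intro: lowdeg_mono)
      then show ?thesis by simp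
    qed
    then have l: "l \<in> lowdeg ?B t D"
      unfolding l_def using mm[OF m(1)]
      by (intro lowdeg.add lowdeg_alg_mult sumL alg_const) (auto simp: monic_in_def m(2))
    define l' where "l' = - \<kappa> (inverse c) * l"
    have l': "l' \<in> lowdeg ?B t D"
      unfolding l'_def by (intro lowdeg_alg_mult l alg_uminus alg_const)
    have tD: "t ^ D - l' \<in> M"
    proof -
      have "\<kappa> (inverse c) * ev \<kappa> u F \<in> M" by (intro M_mult F)
      moreover have "\<kappa> (inverse c) * ev \<kappa> u F = (\<kappa> (inverse c) * \<kappa> c) * t ^ D - l'"
        by (simp add: evF l'_def algebra_simps)
      moreover have "\<kappa> (inverse c) * \<kappa> c = 1" using c by (simp add: hom_mult[symmetric] hom_one)
      ultimately show ?thesis by simp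
    qed
    \<comment> \<open>The module generated over \<open>?B\<close> by the powers of \<open>t\<close>
      below \<open>D\<close>, modulo \<open>M\<close>. The integral equation makes it stable under
      \<open>t\<close>, so that it absorbs the whole of \<open>alg u (Suc N)\<close>.\<close>
    define LM where "LM = {x. \<exists>l\<in>lowdeg ?B t D. x - l \<in> M}"
    have LM_add: "x \<in> LM \<Longrightarrow> y \<in> LM \<Longrightarrow> x + y \<in> LM" for x y
      unfolding LM_def using cong_add lowdeg.add by blast
    have LM_alg: "b \<in> ?B \<Longrightarrow> x \<in> LM \<Longrightarrow> b * x \<in> LM" for b x
    proof -
      assume "b \<in> ?B" "x \<in> LM"
      then obtain l where "l \<in> lowdeg ?B t D" "x - l \<in> M" by (auto simp: LM_def)
      then show "b * x \<in> LM"
        unfolding LM_def using lowdeg_alg_mult[OF \<open>b \<in> ?B\<close>, of l] M_mult[of "x - l" b]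
        by (auto simp: right_diff_distrib)
    qed
    have LM_sub: "x \<in> lowdeg ?B t D \<Longrightarrow> x \<in> LM" for x
      unfolding LM_def using M_0 by (intro CollectI bexI[of _ x]) auto
    have LM_t: "t * x \<in> LM" if x: "x \<in> LM" for x
    proof -
      have L: "t * y \<in> LM" if "y \<in> lowdeg ?B t D" for y
        using that
      proof (induction rule: lowdeg.induct)
        case (monom b j)
        show ?case
        proof (cases "Suc j < D")
          case True
          then show ?thesis using lowdeg.monom[OF monom(1) True, of t] by (intro LM_sub) (simp add: mult_ac)
        next
          case False
          then have "Suc j = D" using monom by simp
          moreover have "b * t ^ D \<in> LM" using tD l' by (intro LM_alg monom) (auto simp: LM_def)
          ultimately show ?thesis by (metis mult.left_commute power_Suc)
        qed
      qed (auto simp: ring_distribs intro: LM_add LM_sub lowdeg.zero)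
      obtain y where y: "y \<in> lowdeg ?B t D" "x - y \<in> M" using x by (auto simp: LM_def)
      obtain z where z: "z \<in> lowdeg ?B t D" "t * y - z \<in> M" using L[OF y(1)] by (auto simp: LM_def)
      have "t * x - t * y \<in> M" using M_mult[OF y(2), of t] by (simp add: right_diff_distrib)
      then have "t * x - z \<in> M" using cong_trans z(2) by blast
      then show ?thesis using z(1) by (auto simp: LM_def)
    qed
    have D0: "D > 0"
    proof (rule ccontr)
      assume "\<not> D > 0"
      then have "D = 0" by simp
      have "x = 0" if "x \<in> lowdeg ?B t 0" for x using that by (induction rule: lowdeg.induct) auto
      then have "1 \<in> M" using tD l' \<open>D = 0\<close> by fastforce
      then show False using M_1 by simp
    qed
    have LM_1: "1 \<in> LM" using lowdeg_power[OF D0, of t u' N] by (intro LM_sub) simp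
    have LM_pow: "x \<in> LM \<Longrightarrow> t ^ k * x \<in> LM" for x k
      by (induction k) (auto simp: mult.assoc intro: LM_t)
    have LM_all: "x * y \<in> LM" if "x \<in> alg u (Suc N)" "y \<in> LM" for x y
      using that
    proof (induction arbitrary: y rule: alg_induct)
      case (gen i)
      show ?case
      proof (cases i)
        case 0
        then show ?thesis using LM_t gen by (simp add: t_def)
      next
        case (Suc k)
        have eq: "u i * y = u' k * y + t ^ (e ^ Suc k) * y" by (simp add: Suc u'_def algebra_simps)
        show ?thesis
          unfolding eq using gen Suc by (intro LM_add LM_alg LM_pow alg_gen) auto
      qed
    qed (auto simp: ring_distribs mult.assoc intro: LM_add LM_alg alg_const)
    have tB: "t \<in> alg u (Suc N)" unfolding t_def by (rule alg_gen) simp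
    have sub: "x \<in> alg u (Suc N)" if "x \<in> ?B" for x
      using that
    proof (induction rule: alg_induct)
      case (gen i)
      then show ?case unfolding u'_def by (intro alg_diff alg_power tB alg_gen) auto
    qed (auto intro: alg_add alg_mult alg_const)
    \<comment> \<open>The inverse \<open>c\<close> of \<open>b\<close> is known only in the larger
      algebra. Each \<open>c * t ^ j\<close> is a combination of the powers of \<open>t\<close>
      below \<open>D\<close>; multiplying by \<open>b\<close> gives the system for
      \<open>nakayama\<close>, whose factor \<open>1 + b * r\<close> kills \<open>t ^ 0\<close> and
      exhibits an inverse inside \<open>?B\<close>.\<close>
    have field: "\<exists>b'\<in>?B. b * b' - 1 \<in> M" if b: "b \<in> ?B" "b \<notin> M" for b
    proof -
      obtain c where c: "c \<in> alg u (Suc N)" "b * c - 1 \<in> M" using Suc.prems(1)[OF sub] b by blast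
      have "\<exists>a. (\<forall>i. a i \<in> ?B) \<and> c * t ^ j - (\<Sum>i<D. a i * t ^ i) \<in> M" for j
      proof -
        have "c * t ^ j * 1 \<in> LM" using c tB by (intro LM_all LM_1 alg_mult alg_power)
        then obtain l where "l \<in> lowdeg ?B t D" "c * t ^ j - l \<in> M" by (auto simp: LM_def)
        then show ?thesis using lowdeg_sum_rep by blast
      qed
      then obtain a where a: "\<And>i j. a j i \<in> ?B" "\<And>j. c * t ^ j - (\<Sum>i<D. a j i * t ^ i) \<in> M" by metis
      have "\<exists>r\<in>?B. \<forall>j<D. (1 + b * r) * t ^ j \<in> M"
      proof (rule nakayama[where s = 1 and D = D and a = a])
        show "\<exists>r\<in>?B. 1 = 1 + b * r" by (intro bexI[of _ 0]) (auto simp: alg_0)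
        fix j
        have "t ^ j * (1 - b * c) + b * (c * t ^ j - (\<Sum>i<D. a j i * t ^ i)) \<in> M"
          using a(2)[of j] M_uminus[OF c(2)] by (intro M_add M_mult) auto
        then show "1 * t ^ j - b * (\<Sum>i<D. a j i * t ^ i) \<in> M" by (simp add: algebra_simps)
      qed (use a b in auto)
      then obtain r where r: "r \<in> ?B" "(1 + b * r) * t ^ 0 \<in> M" using D0 by blast
      then have "- (1 + b * r) \<in> M" by (intro M_uminus) simp
      also have "- (1 + b * r) = b * (- r) - 1" by simp
      finally have "b * (- r) - 1 \<in> M" .
      then show ?thesis using r alg_uminus by blast
    qed
    have u'c: "\<exists>c. u' j - \<kappa> c \<in> M" if "j < N" for j
      using Suc.IH[OF field that] .
    have Bc: "\<exists>c. b - \<kappa> c \<in> M" if "b \<in> ?B" for b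
      using alg_cong_const[OF u'c that] .
    obtain b where b: "\<And>j. b j \<in> ?B" "l' = (\<Sum>j<D. b j * t ^ j)" using lowdeg_sum_rep[OF l'] by blast
    obtain d where d: "\<And>j. b j - \<kappa> (d j) \<in> M" using Bc[OF b(1)] by metis
    \<comment> \<open>The integral equation of \<open>t\<close> with its coefficients replaced by
      constants, which are congruent to them by the induction hypothesis.\<close>
    define P where "P = Polynomial.monom 1 D - (\<Sum>j<D. Polynomial.monom (d j) j)"
    have coP: "Polynomial.coeff P k = (if k = D then 1 else if k < D then - d k else 0)" for k
      by (auto simp: P_def coeff_sum)
    then have P0: "P \<noteq> 0" by (metis Polynomial.coeff_0 zero_neq_one)
    have "map_poly \<kappa> P = Polynomial.monom 1 D - (\<Sum>j<D. Polynomial.monom (\<kappa> (d j)) j)"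
      by (rule poly_eqI) (auto simp: coeff_map_poly coP hom_zero hom_one hom_uminus coeff_sum)
    then have "poly (map_poly \<kappa> P) t = (t ^ D - l') + (\<Sum>j<D. (b j - \<kappa> (d j)) * t ^ j)"
      by (simp add: b(2) poly_sum poly_monom sum_subtractf left_diff_distrib)
    also have "\<dots> \<in> M" using tD d by (intro M_add M_sum M_mult')
    finally obtain a where a: "t - \<kappa> a \<in> M" using root_of_poly[OF P0] by blast
    show ?thesis
    proof (cases i)
      case 0
      then show ?thesis using a by (auto simp: t_def)
    next
      case (Suc k)
      then obtain c where c: "u' k - \<kappa> c \<in> M" using u'c Suc.prems by auto
      have pw: "t ^ j - \<kappa> (a ^ j) \<in> M" for j
      proof (induction j)
        case (Suc j)
        then show ?case using cong_mult[OF a Suc] by (simp add: hom_mult)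
      qed (simp add: hom_one M_0)
      have "u i - \<kappa> (c + a ^ (e ^ Suc k)) \<in> M"
        using cong_add[OF c pw[of "e ^ Suc k"]] by (simp add: Suc u'_def hom_add)
      then show ?thesis by blast
    qed
  qed
qed simp

end


section \<open>The Hilbert basis theorem\<close>

definition ideal_in :: "'r::comm_ring_1 set \<Rightarrow> 'r set \<Rightarrow> bool" where
  "ideal_in C I \<longleftrightarrow> I \<subseteq> C \<and> 0 \<in> I \<and> (\<forall>x\<in>I. \<forall>y\<in>I. x + y \<in> I) \<and> (\<forall>c\<in>C. \<forall>x\<in>I. c * x \<in> I)"

text \<open>Generation is expressed by minimality among the ideals containing \<open>F\<close>, so
  that no linear combinations have to be written down.\<close>

definition noetherian_subring :: "'r::comm_ring_1 set \<Rightarrow> bool" where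
  "noetherian_subring C \<longleftrightarrow> (\<forall>I. ideal_in C I \<longrightarrow>
     (\<exists>F. finite F \<and> F \<subseteq> I \<and> (\<forall>I'. ideal_in C I' \<longrightarrow> F \<subseteq> I' \<longrightarrow> I \<subseteq> I')))"

lemma noetherian_subringE:
  assumes "noetherian_subring C" "ideal_in C I"
  obtains F where "finite F" "F \<subseteq> I" "\<And>I'. ideal_in C I' \<Longrightarrow> F \<subseteq> I' \<Longrightarrow> I \<subseteq> I'"
  using assms unfolding noetherian_subring_def by meson

lemma ideal_inD:
  assumes "ideal_in C I"
  shows "x \<in> I \<Longrightarrow> x \<in> C" "0 \<in> I" "x \<in> I \<Longrightarrow> y \<in> I \<Longrightarrow> x + y \<in> I" "c \<in> C \<Longrightarrow> x \<in> I \<Longrightarrow> c * x \<in> I"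
  using assms by (auto simp: ideal_in_def)

context evaluation
begin

lemma alg_Suc_lowdeg:
  assumes "x \<in> alg u (Suc N)"
  shows "\<exists>D. x \<in> lowdeg (alg u N) (u N) D"
  using assms
proof (induction rule: alg_induct)
  case (const c)
  show ?case using lowdeg.monom[OF alg_const[of c u N], of 0 1 "u N"] by auto
next
  case (gen i)
  show ?case
  proof (cases "i = N")
    case True
    then show ?thesis using lowdeg_power[of 1 2 "u N" u N] by auto
  next
    case False
    then show ?thesis using lowdeg.monom[OF alg_gen[of i N u], of 0 1 "u N"] gen by auto
  qed
next
  case (add x y)
  then obtain D E where "x \<in> lowdeg (alg u N) (u N) D" "y \<in> lowdeg (alg u N) (u N) E" by blast
  then show ?case by (intro exI[of _ "max D E"] lowdeg.add) (auto elim: lowdeg_mono)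
next
  case (mult x y)
  then show ?case using lowdeg_mult by blast
qed

lemma alg_mono_Suc: "x \<in> alg u N \<Longrightarrow> x \<in> alg u (Suc N)"
  using polys_in_mono[of "{..<N}" "{..<Suc N}"] by (auto simp: alg_def)

lemma lowdeg_Suc_decomp:
  assumes "x \<in> lowdeg (alg u N) t (Suc D)"
  shows "\<exists>c\<in>alg u N. x - c * t ^ D \<in> lowdeg (alg u N) t D"
  using assms
proof (induction rule: lowdeg.induct)
  case zero
  show ?case by (intro bexI[of _ 0]) (auto intro: lowdeg.zero alg_0)
next
  case (add x y)
  then obtain c d where cd: "c \<in> alg u N" "d \<in> alg u N" "x - c * t ^ D \<in> lowdeg (alg u N) t D"
      "y - d * t ^ D \<in> lowdeg (alg u N) t D" by blast
  have "(x - c * t ^ D) + (y - d * t ^ D) \<in> lowdeg (alg u N) t D" using cd by (intro lowdeg.add)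
  then show ?case using cd by (intro bexI[of _ "c + d"]) (auto simp: algebra_simps alg_add)
next
  case (monom b j)
  show ?case
  proof (cases "j = D")
    case True
    then show ?thesis using monom by (intro bexI[of _ b]) (auto intro: lowdeg.zero)
  next
    case False
    then show ?thesis using monom by (intro bexI[of _ 0]) (auto intro: lowdeg.monom alg_0)
  qed
qed

text \<open>The usual argument with leading coefficients. As \<open>u N\<close> may be algebraic
  over the smaller algebra, a leading coefficient belongs to an expression of degree
  \<open>d\<close> and not to an element; the sets \<open>lead I d\<close> are nevertheless ideals
  that increase with \<open>d\<close>.\<close>

theorem hilbert_basis:
  assumes "noetherian_subring (alg u N)"
  shows "noetherian_subring (alg u (Suc N))"
  unfolding noetherian_subring_def
proof (intro allI impI)
  let ?C = "alg u N" and ?C' = "alg u (Suc N)"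
  define g where "g = u N"
  let ?low = "lowdeg ?C g"
  fix I assume I: "ideal_in ?C' I"
  note ID = ideal_inD[OF I]
  have gC: "g ^ k \<in> ?C'" for k unfolding g_def by (intro alg_power alg_gen) simp
  define lead where "lead J d = {c \<in> ?C. \<exists>x\<in>J. x - c * g ^ d \<in> ?low d}" for J :: "'r set" and d
  have lead_ideal: "ideal_in ?C (lead J d)" if J: "ideal_in ?C' J" for J d
    unfolding ideal_in_def
  proof (intro conjI ballI)
    note JD = ideal_inD[OF J]
    show "lead J d \<subseteq> ?C" by (auto simp: lead_def)
    show "0 \<in> lead J d" using JD(2) lowdeg.zero[of ?C g d] alg_0 by (force simp: lead_def)
    fix x assume "x \<in> lead J d"
    then obtain a where a: "x \<in> ?C" "a \<in> J" "a - x * g ^ d \<in> ?low d" by (auto simp: lead_def)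
    { fix y assume "y \<in> lead J d"
      then obtain b where b: "y \<in> ?C" "b \<in> J" "b - y * g ^ d \<in> ?low d" by (auto simp: lead_def)
      have "(a - x * g ^ d) + (b - y * g ^ d) \<in> ?low d" using a b by (intro lowdeg.add)
      then show "x + y \<in> lead J d"
        unfolding lead_def using a b
        by (auto intro!: bexI[of _ "a + b"] simp: JD algebra_simps alg_add) }
    { fix c assume c: "c \<in> ?C"
      have "c * (a - x * g ^ d) \<in> ?low d" using a c by (intro lowdeg_alg_mult)
      moreover have "c * (a - x * g ^ d) = c * a - (c * x) * g ^ d" by (simp add: algebra_simps)
      moreover have "c * a \<in> J" using a c by (intro JD(4) alg_mono_Suc)
      ultimately show "c * x \<in> lead J d"
        unfolding lead_def using a c alg_mult by auto }
  qed
  have lead_Suc: "c \<in> lead J (d + k)" if c: "c \<in> lead J d" and J: "ideal_in ?C' J" for c d k J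
  proof -
    obtain a where a: "c \<in> ?C" "a \<in> J" "a - c * g ^ d \<in> ?low d" using c by (auto simp: lead_def)
    have "(a - c * g ^ d) * g ^ k \<in> ?low (d + k)" using a by (intro lowdeg_mult_power)
    then have "g ^ k * a - c * g ^ (d + k) \<in> ?low (d + k)" by (simp add: algebra_simps power_add)
    then show ?thesis using a ideal_inD(4)[OF J gC] by (auto simp: lead_def)
  qed
  define LL where "LL = (\<Union>d. lead I d)"
  have "ideal_in ?C LL"
    unfolding ideal_in_def
  proof (intro conjI ballI)
    show "LL \<subseteq> ?C" by (auto simp: LL_def lead_def)
    show "0 \<in> LL" using ideal_inD(2)[OF lead_ideal[OF I]] by (auto simp: LL_def)
    fix x assume "x \<in> LL"
    then obtain d where d: "x \<in> lead I d" by (auto simp: LL_def)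
    { fix c assume "c \<in> ?C"
      then show "c * x \<in> LL" using ideal_inD(4)[OF lead_ideal[OF I] _ d] by (auto simp: LL_def) }
    { fix y assume "y \<in> LL"
      then obtain e where e: "y \<in> lead I e" by (auto simp: LL_def)
      have "x \<in> lead I (d + e)" "y \<in> lead I (d + e)"
        using lead_Suc[OF d I, of e] lead_Suc[OF e I, of d] by (simp_all add: add.commute)
      then show "x + y \<in> LL" using ideal_inD(3)[OF lead_ideal[OF I]] by (auto simp: LL_def) }
  qed
  then obtain F where F: "finite F" "F \<subseteq> LL" "\<And>I'. ideal_in ?C I' \<Longrightarrow> F \<subseteq> I' \<Longrightarrow> LL \<subseteq> I'"
    using noetherian_subringE[OF assms] by metis
  \<comment> \<open>The union of the increasing ideals \<open>lead I d\<close> is finitely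
    generated, so it is reached at one degree \<open>D\<close>; generators in degrees up to
    \<open>D\<close> will suffice.\<close>
  have "\<exists>D. F \<subseteq> lead I D"
    using F(1,2)
  proof (induction F rule: finite_induct)
    case (insert x F)
    then obtain D where D: "F \<subseteq> lead I D" by blast
    obtain e where e: "x \<in> lead I e" using insert by (auto simp: LL_def)
    have "x \<in> lead I (D + e)" using lead_Suc[OF e I, of D] by (simp add: add.commute)
    moreover have "y \<in> lead I (D + e)" if "y \<in> F" for y using D that lead_Suc[OF _ I] by blast
    ultimately show ?case by blast
  qed auto
  then obtain D where D: "F \<subseteq> lead I D" by blast
  have LD: "LL \<subseteq> lead I D" using F(3)[OF lead_ideal[OF I] D] .
  have "\<exists>G. finite G \<and> G \<subseteq> lead I d \<and> (\<forall>I'. ideal_in ?C I' \<longrightarrow> G \<subseteq> I' \<longrightarrow> lead I d \<subseteq> I')" for d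
    using noetherian_subringE[OF assms lead_ideal[OF I]] by metis
  then obtain G where G: "\<And>d. finite (G d)" "\<And>d. G d \<subseteq> lead I d"
    "\<And>d I'. ideal_in ?C I' \<Longrightarrow> G d \<subseteq> I' \<Longrightarrow> lead I d \<subseteq> I'" by metis
  have "\<exists>x\<in>I. x - c * g ^ d \<in> ?low d" if "c \<in> G d" for c d using G(2) that by (auto simp: lead_def)
  then obtain X where X: "\<And>c d. c \<in> G d \<Longrightarrow> X c d \<in> I" "\<And>c d. c \<in> G d \<Longrightarrow> X c d - c * g ^ d \<in> ?low d"
    by metis
  define H where "H = (\<Union>d\<in>{..D}. (\<lambda>c. X c d) ` G d)"
  have "finite H" using G(1) by (auto simp: H_def)
  moreover have "H \<subseteq> I" using X(1) by (auto simp: H_def)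
  moreover have "I \<subseteq> I'" if I': "ideal_in ?C' I'" "H \<subseteq> I'" for I'
  proof -
    note ID' = ideal_inD[OF I'(1)]
    \<comment> \<open>The element that cancels a leading term must lie in \<open>I\<close>, to
      continue the induction, and in \<open>I'\<close>, to conclude; hence the intersection.\<close>
    have II: "ideal_in ?C' (I \<inter> I')" using I I'(1) by (auto simp: ideal_in_def)
    have lead_sub: "lead I d \<subseteq> lead (I \<inter> I') d" for d
    proof (cases "d \<le> D")
      case True
      have "G d \<subseteq> lead (I \<inter> I') d"
      proof
        fix c assume c: "c \<in> G d"
        then have "X c d \<in> H" using True by (auto simp: H_def)
        then show "c \<in> lead (I \<inter> I') d" using X[OF c] I' G(2) c by (auto simp: lead_def)
      qed
      then show ?thesis using G(3) lead_ideal[OF II] by blast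
    next
      case False
      have "G D \<subseteq> lead (I \<inter> I') D"
      proof
        fix c assume c: "c \<in> G D"
        then have "X c D \<in> H" by (auto simp: H_def)
        then show "c \<in> lead (I \<inter> I') D" using X[OF c] I' G(2) c by (auto simp: lead_def)
      qed
      then have D': "lead I D \<subseteq> lead (I \<inter> I') D" using G(3) lead_ideal[OF II] by blast
      show ?thesis
      proof
        fix c assume "c \<in> lead I d"
        then have "c \<in> lead (I \<inter> I') D" using LD D' by (auto simp: LL_def)
        then show "c \<in> lead (I \<inter> I') d" using lead_Suc[OF _ II, of c D "d - D"] False by simp
      qed
    qed
    have "x \<in> I \<Longrightarrow> x \<in> ?low d \<Longrightarrow> x \<in> I'" for x d
    proof (induction d arbitrary: x)
      case 0
      have "y = 0" if "y \<in> ?low 0" for y using that by (induction rule: lowdeg.induct) auto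
      then show ?case using 0 ID'(2) by auto
    next
      case (Suc d)
      obtain c where c: "c \<in> ?C" "x - c * g ^ d \<in> ?low d" using lowdeg_Suc_decomp[OF Suc.prems(2)] by blast
      then have "c \<in> lead I d" using Suc.prems by (auto simp: lead_def)
      then have "c \<in> lead (I \<inter> I') d" using lead_sub by blast
      then obtain y where y: "y \<in> I" "y \<in> I'" "y - c * g ^ d \<in> ?low d" by (auto simp: lead_def)
      have "- 1 \<in> ?C'" "- 1 \<in> ?C" by (intro alg_uminus alg_1)+
      then have "x + (- 1) * y \<in> I" using Suc.prems(1) y(1) by (intro ID(3,4))
      moreover have "(x - c * g ^ d) + (- 1) * (y - c * g ^ d) \<in> ?low d"
        using c y \<open>- 1 \<in> ?C\<close> by (intro lowdeg.add lowdeg_alg_mult)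
      ultimately have "x - y \<in> I'" by (intro Suc.IH) simp_all
      then have "(x - y) + y \<in> I'" using y by (intro ID'(3))
      then show ?case by simp
    qed
    then show ?thesis using ID(1) alg_Suc_lowdeg[of _ u N] unfolding g_def by blast
  qed
  ultimately show "\<exists>F. finite F \<and> F \<subseteq> I \<and> (\<forall>I'. ideal_in ?C' I' \<longrightarrow> F \<subseteq> I' \<longrightarrow> I \<subseteq> I')" by blast
qed

end

lemma noetherian_subring_alg:
  fixes \<kappa> :: "'k::field \<Rightarrow> 'r::comm_ring_1"
  assumes "evaluation \<kappa>"
  shows "noetherian_subring (evaluation.alg \<kappa> u N)"
proof -
  interpret evaluation \<kappa> by fact
  show ?thesis
  proof (induction N)
    case 0
    have C: "\<exists>c. x = \<kappa> c" if "x \<in> alg u 0" for x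
      using that
    proof (induction rule: alg_induct)
      case (add x y)
      then show ?case using hom_add by metis
    next
      case (mult x y)
      then show ?case using hom_mult by metis
    qed auto
    show ?case
      unfolding noetherian_subring_def
    proof (intro allI impI)
      fix I assume I: "ideal_in (alg u 0) I"
      show "\<exists>F. finite F \<and> F \<subseteq> I \<and> (\<forall>I'. ideal_in (alg u 0) I' \<longrightarrow> F \<subseteq> I' \<longrightarrow> I \<subseteq> I')"
      proof (cases "I = {0}")
        case True
        then show ?thesis by (intro exI[of _ "{}"]) (auto simp: ideal_in_def)
      next
        case False
        then obtain x where x: "x \<in> I" "x \<noteq> 0" using ideal_inD(2)[OF I] by blast
        then obtain c where c: "x = \<kappa> c" using C ideal_inD(1)[OF I] by blast
        then have c0: "c \<noteq> 0" using x hom_zero by auto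
        have "I \<subseteq> I'" if I': "ideal_in (alg u 0) I'" "{x} \<subseteq> I'" for I'
        proof
          fix y assume "y \<in> I"
          then obtain d where d: "y = \<kappa> d" using C ideal_inD(1)[OF I] by blast
          have "\<kappa> (d / c) * x \<in> I'" using ideal_inD(4)[OF I'(1) alg_const] I'(2) by blast
          moreover have "\<kappa> (d / c) * x = y" using c0 by (simp add: c d hom_mult[symmetric])
          ultimately show "y \<in> I'" by simp
        qed
        then show ?thesis using x by (intro exI[of _ "{x}"]) auto
      qed
    qed
  qed (rule hilbert_basis)
qed

text \<open>A homogeneous linear system with an unknown for each element of \<open>X\<close> and an
  equation for each element of \<open>Y\<close>, solved by elimination with the pivot
  \<open>f x0 y\<close>.\<close>

lemma nontrivial_relation:
  fixes f :: "'x \<Rightarrow> 'y \<Rightarrow> 'k::field"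
  assumes "finite Y" "finite X" "card Y < card X"
  shows "\<exists>c. (\<exists>x\<in>X. c x \<noteq> 0) \<and> (\<forall>y\<in>Y. (\<Sum>x\<in>X. c x * f x y) = 0)"
  using assms
proof (induction Y arbitrary: X f rule: finite_induct)
  case empty
  then have "X \<noteq> {}" by auto
  then show ?case by (intro exI[of _ "\<lambda>_. 1"]) auto
next
  case (insert y Y)
  show ?case
  proof (cases "\<forall>x\<in>X. f x y = 0")
    case True
    have "card Y < card X" using insert by simp
    then obtain c where "\<exists>x\<in>X. c x \<noteq> 0" "\<forall>y\<in>Y. (\<Sum>x\<in>X. c x * f x y) = 0"
      using insert.IH[of X f] insert.prems by blast
    then show ?thesis using True by (intro exI[of _ c]) auto
  next
    case False
    then obtain x0 where x0: "x0 \<in> X" "f x0 y \<noteq> 0" by blast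
    define X' where "X' = X - {x0}"
    define f' where "f' x z = f x z - f x y / f x0 y * f x0 z" for x z
    have "card Y < card X'" using insert x0 by (simp add: X'_def)
    then obtain c where c: "\<exists>x\<in>X'. c x \<noteq> 0" "\<And>z. z \<in> Y \<Longrightarrow> (\<Sum>x\<in>X'. c x * f' x z) = 0"
      using insert.IH[of X' f'] insert.prems by (auto simp: X'_def)
    define c0 where "c0 = - (\<Sum>x\<in>X'. c x * (f x y / f x0 y))"
    define c' where "c' = c(x0 := c0)"
    have split: "(\<Sum>x\<in>X. c' x * f x z) = c0 * f x0 z + (\<Sum>x\<in>X'. c x * f x z)" for z
    proof -
      have "(\<Sum>x\<in>X. c' x * f x z) = c' x0 * f x0 z + (\<Sum>x\<in>X'. c' x * f x z)"
        unfolding X'_def using x0 insert.prems by (intro sum.remove) auto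
      then show ?thesis by (simp add: c'_def X'_def)
    qed
    have eq: "(\<Sum>x\<in>X. c' x * f x z) = (\<Sum>x\<in>X'. c x * f' x z)" for z
      unfolding split c0_def f'_def
      by (simp add: right_diff_distrib sum_subtractf sum_distrib_left sum_distrib_right mult_ac)
    have "f' x y = 0" for x using x0 by (simp add: f'_def)
    then have "\<forall>z\<in>insert y Y. (\<Sum>x\<in>X. c' x * f x z) = 0" using c(2) eq by auto
    moreover have "\<exists>x\<in>X. c' x \<noteq> 0" using c(1) by (auto simp: c'_def X'_def)
    ultimately show ?thesis by blast
  qed
qed


section \<open>Free algebras over polynomial rings\<close>

lemma split_off_variable:
  assumes "p \<in> polys_in {i..<n::nat}" "i < n"
  shows "\<exists>p0\<in>polys_in {Suc i..<n}. \<exists>p1\<in>polys_in {i..<n}. p = p0 + Var i * p1"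
  using assms(1)
proof (induction rule: polys_induct)
  case (Const c)
  show ?case by (intro bexI[of _ "Const c"] bexI[of _ 0]) auto
next
  case (Var j)
  show ?case
  proof (cases "j = i")
    case True
    then show ?thesis by (intro bexI[of _ 0] bexI[of _ 1]) auto
  next
    case False
    then show ?thesis using Var by (intro bexI[of _ "Var j"] bexI[of _ 0]) auto
  qed
next
  case (add p q)
  then obtain p0 p1 q0 q1 where *: "p0 \<in> polys_in {Suc i..<n}" "q0 \<in> polys_in {Suc i..<n}"
      "p1 \<in> polys_in {i..<n}" "q1 \<in> polys_in {i..<n}" "p = p0 + Var i * p1" "q = q0 + Var i * q1"
    by blast
  then show ?case by (intro bexI[of _ "p0 + q0"] bexI[of _ "p1 + q1"]) (auto simp: algebra_simps)
next
  case (mult p q)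
  then obtain p0 p1 q0 q1 where *: "p0 \<in> polys_in {Suc i..<n}" "q0 \<in> polys_in {Suc i..<n}"
      "p1 \<in> polys_in {i..<n}" "q1 \<in> polys_in {i..<n}" "p = p0 + Var i * p1" "q = q0 + Var i * q1"
    by blast
  have m: "polys_in {Suc i..<n} \<subseteq> polys_in {i..<n}" by (rule polys_in_mono) auto
  have "p0 * q1 + p1 * q0 + Var i * (p1 * q1) \<in> polys_in {i..<n}"
    using * m assms(2) by (intro polys_in_add polys_in_mult polys_in_Var) auto
  then show ?case using *
    by (intro bexI[of _ "p0 * q0"] bexI[of _ "p0 * q1 + p1 * q0 + Var i * (p1 * q1)"])
      (auto simp: algebra_simps)
qed

text \<open>The induction is on the degree in \<open>x\<^sub>i\<close>, read off after putting a polynomial indeterminate in its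
  place.\<close>

lemma factor_variable:
  fixes p :: "(nat \<Rightarrow>\<^sub>0 nat) \<Rightarrow>\<^sub>0 'k::field"
  assumes "p \<in> polys_in {i..<n}" "i < n" "p \<noteq> 0"
  shows "\<exists>k. \<exists>p0\<in>polys_in {Suc i..<n}. \<exists>p1\<in>polys_in {i..<n}. p0 \<noteq> 0 \<and> p = Var i ^ k * (p0 + Var i * p1)"
proof -
  define \<kappa> :: "'k \<Rightarrow> ((nat \<Rightarrow>\<^sub>0 nat) \<Rightarrow>\<^sub>0 'k) poly" where "\<kappa> c = [:Const c:]" for c
  interpret K: evaluation \<kappa>
    unfolding evaluation_def by unfold_locales (auto simp: \<kappa>_def Const_add Const_mult)
  define \<tau> where "\<tau> = ev \<kappa> (\<lambda>j. if j = i then [:0, 1:] else [:Var j:])"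
  have eval_back: "poly (\<tau> q) (Var i) = q" for q
  proof -
    have "comm_ring_hom (\<lambda>q. poly (\<tau> q) (Var i))"
      unfolding \<tau>_def by unfold_locales (auto simp: K.ev_add K.ev_mult K.E.hom_one)
    then have "poly (\<tau> q) (Var i) = ev Const Var q"
      by (rule EC.ev_unique[where V = UNIV]) (auto simp: \<tau>_def \<kappa>_def)
    then show ?thesis by (simp add: ev_Const_Var)
  qed
  have inj: "\<tau> q \<noteq> 0" if "q \<noteq> 0" for q using that eval_back[of q] by auto
  show ?thesis
    using assms(1,3)
  proof (induction "Polynomial.degree (\<tau> p)" arbitrary: p rule: less_induct)
    case less
    obtain p0 p1 where p: "p0 \<in> polys_in {Suc i..<n}" "p1 \<in> polys_in {i..<n}" "p = p0 + Var i * p1"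
      using split_off_variable[OF less.prems(1) assms(2)] by blast
    show ?case
    proof (cases "p0 = 0")
      case False
      then show ?thesis using p by (intro exI[of _ 0]) auto
    next
      case True
      then have p1: "p = Var i * p1" "p1 \<noteq> 0" using p less.prems by auto
      have "\<tau> p = [:0, 1:] * \<tau> p1" by (simp add: p1(1) \<tau>_def K.ev_mult)
      then have "Polynomial.degree (\<tau> p) = Suc (Polynomial.degree (\<tau> p1))"
        using inj[OF p1(2)] by (simp add: degree_pCons_eq)
      then obtain k q0 q1 where "q0 \<in> polys_in {Suc i..<n}" "q1 \<in> polys_in {i..<n}" "q0 \<noteq> 0"
          "p1 = Var i ^ k * (q0 + Var i * q1)"
        using less.hyps[of p1] p(2) p1(2) by auto
      then show ?thesis using p1(1) by (intro exI[of _ "Suc k"]) (auto simp: mult_ac)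
    qed
  qed
qed

text \<open>Each exponent is bounded separately, not the total degree, so that the admissible
  monomials form a box whose size is a power of \<open>K + 1\<close>.\<close>

definition bounded_polys :: "nat \<Rightarrow> nat \<Rightarrow> ((nat \<Rightarrow>\<^sub>0 nat) \<Rightarrow>\<^sub>0 'k::comm_ring_1) set" where
  "bounded_polys d K = {b \<in> polys_in {..<d}. \<forall>m\<in>Poly_Mapping.keys b. \<forall>i. Poly_Mapping.lookup m i \<le> K}"

lemma bounded_polys_add: "p \<in> bounded_polys d K \<Longrightarrow> q \<in> bounded_polys d K \<Longrightarrow> p + q \<in> bounded_polys d K"
  using Poly_Mapping.keys_add[of p q] by (auto simp: bounded_polys_def)

lemma bounded_polys_mult:
  assumes p: "p \<in> bounded_polys d K" and q: "q \<in> bounded_polys d L"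
  shows "p * q \<in> bounded_polys d (K + L)"
proof -
  have "Poly_Mapping.lookup m i \<le> K + L" if m: "m \<in> Poly_Mapping.keys (p * q)" for m i
  proof -
    obtain a b where "m = a + b" "a \<in> Poly_Mapping.keys p" "b \<in> Poly_Mapping.keys q"
      using keys_mult[of p q] m by auto
    then show ?thesis using p q by (auto simp: bounded_polys_def lookup_add intro: add_mono)
  qed
  then show ?thesis using p q by (auto simp: bounded_polys_def)
qed

lemma bounded_polys_mono: "p \<in> bounded_polys d K \<Longrightarrow> K \<le> L \<Longrightarrow> p \<in> bounded_polys d L"
  by (fastforce simp: bounded_polys_def intro: order_trans)

lemma bounded_polys_0: "0 \<in> bounded_polys d K"
  by (simp add: bounded_polys_def)

lemma bounded_polys_sum: "(\<And>i. i \<in> I \<Longrightarrow> f i \<in> bounded_polys d K) \<Longrightarrow> sum f I \<in> bounded_polys d K"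
  by (induction I rule: infinite_finite_induct) (auto intro: bounded_polys_add bounded_polys_0)

lemma bounded_polys_ex:
  assumes "p \<in> polys_in {..<d}"
  shows "\<exists>K. p \<in> bounded_polys d K"
proof -
  obtain e where "\<And>m i. m \<in> Poly_Mapping.keys p \<Longrightarrow> Poly_Mapping.lookup m i < e"
    using inj_on_weight[OF assms] by metis
  then show ?thesis using assms by (intro exI[of _ e]) (auto simp: bounded_polys_def less_imp_le)
qed

definition exponent_of :: "nat \<Rightarrow> (nat \<Rightarrow> nat) \<Rightarrow> (nat \<Rightarrow>\<^sub>0 nat)" where
  "exponent_of d h = (\<Sum>i<d. Poly_Mapping.single i (h i))"

lemma lookup_exponent_of: "Poly_Mapping.lookup (exponent_of d h) i = (if i < d then h i else 0)"
  by (simp add: exponent_of_def lookup_sum lookup_single when_def)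

text \<open>The map \<open>\<psi>\<close> presents \<open>A\<close> as an image of a ring given by a
  type, where calculations use type class operations. The \<open>u i\<close> generate
  \<open>A\<close> as an algebra; the \<open>e S\<close> form a basis of it over the polynomial ring
  in the parameters \<open>\<theta>\<close>.\<close>

locale free_algebra = cring A + evaluation \<kappa>
  for A :: "('a, 'm) ring_scheme" (structure) and \<kappa> :: "'k::alg_closed_field \<Rightarrow> 'r::comm_ring_1" +
  fixes \<psi> :: "'r \<Rightarrow> 'a" and u :: "nat \<Rightarrow> 'r" and N :: nat
    and \<theta> :: "nat \<Rightarrow> 'r" and d :: nat and \<S> :: "'s set" and e :: "'s \<Rightarrow> 'r"
  assumes psi_closed [simp]: "\<psi> p \<in> carrier A"
    and psi_add: "\<psi> (p + q) = \<psi> p \<oplus> \<psi> q"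
    and psi_mult: "\<psi> (p * q) = \<psi> p \<otimes> \<psi> q"
    and psi_1: "\<psi> 1 = \<one>"
    and psi_surj: "a \<in> carrier A \<Longrightarrow> \<exists>p\<in>alg u N. a = \<psi> p"
    and fin: "finite \<S>"
    and span: "\<exists>b. (\<forall>S. b S \<in> polys_in {..<d}) \<and> \<psi> p = \<psi> (\<Sum>S\<in>\<S>. ev \<kappa> \<theta> (b S) * e S)"
    and indep: "(\<And>S. S \<in> \<S> \<Longrightarrow> b S \<in> polys_in {..<d}) \<Longrightarrow>
      \<psi> (\<Sum>S\<in>\<S>. ev \<kappa> \<theta> (b S) * e S) = \<zero> \<Longrightarrow> S \<in> \<S> \<Longrightarrow> b S = 0"
begin

lemma psi_0: "\<psi> 0 = \<zero>"
  using psi_add[of 0 0] by (metis add.l_cancel_one' add_0 psi_closed)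

lemma psi_uminus: "\<psi> (- p) = \<ominus> \<psi> p"
  using psi_add[of "- p" p] minus_equality[of "\<psi> (- p)" "\<psi> p"] by (simp add: psi_0)

lemma psi_minus: "\<psi> (p - q) = \<psi> p \<ominus> \<psi> q"
  using psi_add[of p "- q"] by (simp add: psi_uminus minus_eq)

lemma psi_cong_mult: "\<psi> p = \<psi> q \<Longrightarrow> \<psi> (r * p) = \<psi> (r * q)"
  by (simp add: psi_mult)

lemma psi_sum_cong: "(\<And>i. i \<in> I \<Longrightarrow> \<psi> (f i) = \<psi> (g i)) \<Longrightarrow> \<psi> (sum f I) = \<psi> (sum g I)"
  by (induction I rule: infinite_finite_induct) (auto simp: psi_add)

text \<open>Ideals of \<open>A\<close> are pulled back to \<open>alg u N\<close>, where the basis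
  theorem applies, and generators are pushed forward again.\<close>

lemma noetherian_A: "noetherian_ring A"
proof (rule noetherian_ringI)
  fix I assume I: "ideal I A"
  interpret I: ideal I A by fact
  define J where "J X = {x \<in> alg u N. \<psi> x \<in> X}" for X
  have J: "ideal_in (alg u N) (J X)" if "ideal X A" for X
    using additive_subgroup.a_closed[OF ideal.axioms(1)[OF that]]
      additive_subgroup.zero_closed[OF ideal.axioms(1)[OF that]] ideal.I_l_closed[OF that]
    by (auto simp: J_def ideal_in_def psi_add psi_mult psi_0 alg_add alg_mult alg_0)
  obtain F where F: "finite F" "F \<subseteq> J I" "\<And>I'. ideal_in (alg u N) I' \<Longrightarrow> F \<subseteq> I' \<Longrightarrow> J I \<subseteq> I'"
    using noetherian_subringE[OF noetherian_subring_alg[OF evaluation_axioms] J[OF I]] by metis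
  have sub: "\<psi> ` F \<subseteq> carrier A" by auto
  have JJ: "J I \<subseteq> J (genideal A (\<psi> ` F))"
    using F(2) genideal_self[OF sub] by (intro F(3) J genideal_ideal sub) (auto simp: J_def)
  have "I \<subseteq> genideal A (\<psi> ` F)"
  proof
    fix a assume a: "a \<in> I"
    then obtain p where p: "p \<in> alg u N" "a = \<psi> p" using psi_surj I.Icarr by blast
    then have "p \<in> J I" using a by (simp add: J_def)
    then have "p \<in> J (genideal A (\<psi> ` F))" using JJ by blast
    then show "a \<in> genideal A (\<psi> ` F)" using p by (simp add: J_def)
  qed
  moreover have "genideal A (\<psi> ` F) \<subseteq> I"
    using F(2) by (intro genideal_minimal I) (auto simp: J_def)
  ultimately show "\<exists>X\<subseteq>carrier A. finite X \<and> I = genideal A X"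
    using F(1) sub by (intro exI[of _ "\<psi> ` F"]) auto
qed

text \<open>The weak Nullstellensatz: the residue field is generated by the finitely many
  \<open>u i\<close>, so by Zariski's lemma every element is congruent to a constant.\<close>

lemma maximal_ideal_constants:
  assumes m: "maximalideal \<mm> A"
  shows "\<exists>c. \<psi> (p - \<kappa> c) \<in> \<mm>"
proof -
  interpret m: maximalideal \<mm> A by fact
  interpret mp: primeideal \<mm> A using maximalideal_prime[OF m] .
  define M where "M = {p. \<psi> p \<in> \<mm>}"
  interpret M: prime_algebra \<kappa> M
  proof unfold_locales
    show "1 \<notin> M" using m.one_imp_carrier m.I_notcarr by (auto simp: M_def psi_1)
    show "x * y \<in> M \<Longrightarrow> x \<in> M \<or> y \<in> M" for x y
      using mp.I_prime by (auto simp: M_def psi_mult)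
  qed (auto simp: M_def psi_0 psi_add psi_mult m.I_l_closed)
  have field: "\<exists>b'\<in>alg u N. b * b' - 1 \<in> M" if b: "b \<notin> M" for b
  proof -
    obtain X where X: "ideal X A" "\<mm> \<subseteq> X" "\<psi> b \<in> X"
        "\<forall>x\<in>X. \<exists>m\<in>\<mm>. \<exists>r\<in>carrier A. x = m \<oplus> r \<otimes> \<psi> b"
      by (rule ideal_adjoin[OF m.is_ideal psi_closed[of b]]) (rule that)
    have "X = carrier A"
      using m.I_maximal[OF X(1,2)] X(3) b ideal.Icarr[OF X(1)] by (auto simp: M_def)
    then obtain m r where mr: "m \<in> \<mm>" "r \<in> carrier A" "\<one> = m \<oplus> r \<otimes> \<psi> b"
      using X(4) one_closed by blast
    obtain b' where b': "b' \<in> alg u N" "r = \<psi> b'" using psi_surj[OF mr(2)] by blast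
    have "\<psi> (b * b' - 1) = \<psi> b \<otimes> r \<ominus> (m \<oplus> r \<otimes> \<psi> b)"
      using mr(3) by (simp add: psi_minus psi_mult psi_1 b')
    also have "\<dots> = \<ominus> m"
      using mr m.Icarr[OF mr(1)] by (simp add: m_comm minus_eq minus_add a_ac r_neg r_neg1)
    also have "\<dots> \<in> \<mm>" using mr(1) by (rule m.a_inv_closed)
    finally show ?thesis using b' by (auto simp: M_def)
  qed
  have gen: "\<exists>c. u i - \<kappa> c \<in> M" if "i < N" for i
    using M.zariski_lemma[of u N i] field that by blast
  obtain q where q: "q \<in> alg u N" "\<psi> p = \<psi> q" using psi_surj[OF psi_closed] by blast
  obtain c where "q - \<kappa> c \<in> M" using M.alg_cong_const[OF gen q(1)] by blast
  then show ?thesis using q(2) by (auto simp: M_def psi_minus)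
qed

section \<open>Regular sequences obtained by specializing the parameters\<close>

context
  fixes c :: "nat \<Rightarrow> 'k"
begin

definition \<sigma> :: "nat \<Rightarrow> ((nat \<Rightarrow>\<^sub>0 nat) \<Rightarrow>\<^sub>0 'k) \<Rightarrow> ((nat \<Rightarrow>\<^sub>0 nat) \<Rightarrow>\<^sub>0 'k)" where
  "\<sigma> i = ev Const (\<lambda>j. if j < i then Const (c j) else Var j)"

text \<open>The ideal of the first \<open>i\<close> elements
  \<open>\<theta> j - \<kappa> (c j)\<close>, described through coefficients. As coefficients are
  unique, the question of zero divisors in \<open>A\<close> becomes one in the polynomial
  ring.\<close>

definition spec_ideal :: "nat \<Rightarrow> 'a set" where
  "spec_ideal i = {\<psi> (\<Sum>S\<in>\<S>. ev \<kappa> \<theta> (b S) * e S) | b. \<forall>S\<in>\<S>. b S \<in> polys_in {..<d} \<and> \<sigma> i (b S) = 0}"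

lemma \<sigma>_add: "\<sigma> i (p + q) = \<sigma> i p + \<sigma> i q" and \<sigma>_mult: "\<sigma> i (p * q) = \<sigma> i p * \<sigma> i q"
  and \<sigma>_0: "\<sigma> i 0 = 0" and \<sigma>_minus: "\<sigma> i (p - q) = \<sigma> i p - \<sigma> i q"
  and \<sigma>_uminus: "\<sigma> i (- p) = - \<sigma> i p"
  and \<sigma>_Const: "\<sigma> i (Const a) = Const a" and \<sigma>_Var: "\<sigma> i (Var j) = (if j < i then Const (c j) else Var j)"
  by (simp_all add: \<sigma>_def EC.ev_add EC.ev_mult EC.E.hom_minus EC.E.hom_uminus)

lemma spec_ideal_add: "x \<in> spec_ideal i \<Longrightarrow> y \<in> spec_ideal i \<Longrightarrow> x \<oplus> y \<in> spec_ideal i"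
proof -
  assume "x \<in> spec_ideal i" "y \<in> spec_ideal i"
  then obtain b b' where b: "\<forall>S\<in>\<S>. b S \<in> polys_in {..<d} \<and> \<sigma> i (b S) = 0"
      "x = \<psi> (\<Sum>S\<in>\<S>. ev \<kappa> \<theta> (b S) * e S)"
      "\<forall>S\<in>\<S>. b' S \<in> polys_in {..<d} \<and> \<sigma> i (b' S) = 0"
      "y = \<psi> (\<Sum>S\<in>\<S>. ev \<kappa> \<theta> (b' S) * e S)"
    by (auto simp: spec_ideal_def)
  then show ?thesis
    unfolding spec_ideal_def
    by (intro CollectI exI[of _ "\<lambda>S. b S + b' S"])
      (auto simp: psi_add[symmetric] ev_add ring_distribs sum.distrib \<sigma>_add)
qed

lemma spec_ideal_zero: "\<zero> \<in> spec_ideal i"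
  unfolding spec_ideal_def by (intro CollectI exI[of _ "\<lambda>_. 0"]) (auto simp: psi_0 \<sigma>_0)

lemma spec_ideal_mem:
  assumes "b \<in> polys_in {..<d}" "\<sigma> i b = 0"
  shows "\<psi> (ev \<kappa> \<theta> b * x) \<in> spec_ideal i"
proof -
  obtain g where g: "\<And>S. g S \<in> polys_in {..<d}" "\<psi> x = \<psi> (\<Sum>S\<in>\<S>. ev \<kappa> \<theta> (g S) * e S)"
    using span[of x] by blast
  have "\<psi> (ev \<kappa> \<theta> b * x) = \<psi> (\<Sum>S\<in>\<S>. ev \<kappa> \<theta> (b * g S) * e S)"
    using psi_cong_mult[OF g(2), of "ev \<kappa> \<theta> b"] by (simp add: sum_distrib_left ev_mult mult_ac)
  then show ?thesis
    unfolding spec_ideal_def using assms g(1)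
    by (intro CollectI exI[of _ "\<lambda>S. b * g S"]) (auto simp: \<sigma>_mult)
qed

lemma spec_ideal_sum: "(\<And>j. j \<in> I \<Longrightarrow> \<psi> (f j) \<in> spec_ideal i) \<Longrightarrow> \<psi> (sum f I) \<in> spec_ideal i"
  by (induction I rule: infinite_finite_induct) (auto simp: psi_add psi_0 spec_ideal_zero intro: spec_ideal_add)

lemma spec_ideal_mult: "a \<in> carrier A \<Longrightarrow> x \<in> spec_ideal i \<Longrightarrow> a \<otimes> x \<in> spec_ideal i"
proof -
  assume "a \<in> carrier A" "x \<in> spec_ideal i"
  then obtain b r where b: "\<forall>S\<in>\<S>. b S \<in> polys_in {..<d} \<and> \<sigma> i (b S) = 0"
      "x = \<psi> (\<Sum>S\<in>\<S>. ev \<kappa> \<theta> (b S) * e S)" "a = \<psi> r"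
    using psi_surj by (fastforce simp: spec_ideal_def)
  have "a \<otimes> x = \<psi> (\<Sum>S\<in>\<S>. ev \<kappa> \<theta> (b S) * (r * e S))"
    by (simp add: b psi_mult[symmetric] sum_distrib_left mult_ac)
  also have "\<dots> \<in> spec_ideal i" using b(1) by (intro spec_ideal_sum spec_ideal_mem) auto
  finally show ?thesis .
qed

lemma ideal_spec_ideal: "ideal (spec_ideal i) A"
proof (rule idealI)
  show "ring A" by (rule ring_axioms)
  have carr: "spec_ideal i \<subseteq> carrier A" by (auto simp: spec_ideal_def)
  show "subgroup (spec_ideal i) (add_monoid A)"
  proof (rule group.subgroupI)
    show "group (add_monoid A)" by (rule a_group)
    show "spec_ideal i \<noteq> {}" using spec_ideal_zero by blast
    fix x assume x: "x \<in> spec_ideal i"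
    have "\<ominus> \<one> \<otimes> x \<in> spec_ideal i" using x by (intro spec_ideal_mult) auto
    moreover have "\<ominus> \<one> \<otimes> x = \<ominus> x" using x carr by (auto simp: l_minus)
    ultimately show "inv\<^bsub>add_monoid A\<^esub> x \<in> spec_ideal i" by (simp add: a_inv_def)
  qed (use carr spec_ideal_add in auto)
  fix a x assume a: "a \<in> spec_ideal i" "x \<in> carrier A"
  show 1: "x \<otimes> a \<in> spec_ideal i" using a spec_ideal_mult by blast
  have "a \<in> carrier A" using a carr by blast
  then show "a \<otimes> x \<in> spec_ideal i" using 1 a m_comm[of a x] by simp
qed

text \<open>A polynomial and its specialization differ by a combination of the
  \<open>Var j - Const (c j)\<close>; this is checked on generators and carried through sums and
  products.\<close>

lemma genideal_eq_spec_ideal: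
  assumes "i \<le> d"
  shows "genideal A ((\<lambda>j. \<psi> (\<theta> j - \<kappa> (c j))) ` {..<i}) = spec_ideal i"
proof
  let ?X = "(\<lambda>j. \<psi> (\<theta> j - \<kappa> (c j))) ` {..<i}"
  have X: "?X \<subseteq> carrier A" by auto
  note I = genideal_ideal[OF X]
  interpret I: ideal "genideal A ?X" A by (rule I)
  have "\<psi> (\<theta> j - \<kappa> (c j)) \<in> spec_ideal i" if "j < i" for j
  proof -
    have "Var j - Const (c j) \<in> polys_in {..<d}"
      using that assms by (intro polys_in_minus polys_in_Var polys_in_Const) auto
    then have "\<psi> (ev \<kappa> \<theta> (Var j - Const (c j)) * 1) \<in> spec_ideal i"
      using that by (intro spec_ideal_mem) (auto simp: \<sigma>_minus \<sigma>_Var \<sigma>_Const)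
    then show ?thesis by (simp add: E.hom_minus)
  qed
  then show "genideal A ?X \<subseteq> spec_ideal i" by (intro genideal_minimal ideal_spec_ideal) auto
  have *: "\<psi> (ev \<kappa> \<theta> (b - \<sigma> i b)) \<in> genideal A ?X" if "b \<in> polys_in {..<d}" for b
    using that
  proof (induction rule: polys_induct)
    case (Const a)
    show ?case using I.zero_closed by (simp add: \<sigma>_Const psi_0)
  next
    case (Var j)
    show ?case using genideal_self[OF X] I.zero_closed by (auto simp: \<sigma>_Var psi_0 E.hom_minus)
  next
    case (add p q)
    have "\<psi> (ev \<kappa> \<theta> (p - \<sigma> i p)) \<oplus> \<psi> (ev \<kappa> \<theta> (q - \<sigma> i q)) \<in> genideal A ?X"
      using add by (rule I.a_closed)
    then show ?case by (simp add: psi_add[symmetric] ev_add[symmetric] \<sigma>_add algebra_simps)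
  next
    case (mult p q)
    have "\<psi> (ev \<kappa> \<theta> p) \<otimes> \<psi> (ev \<kappa> \<theta> (q - \<sigma> i q)) \<oplus> \<psi> (ev \<kappa> \<theta> (\<sigma> i q)) \<otimes> \<psi> (ev \<kappa> \<theta> (p - \<sigma> i p)) \<in> genideal A ?X"
      using mult by (intro I.a_closed I.I_l_closed) auto
    then show ?case
      by (simp add: psi_add[symmetric] psi_mult[symmetric] ev_add[symmetric] ev_mult[symmetric] \<sigma>_mult algebra_simps)
  qed
  show "spec_ideal i \<subseteq> genideal A ?X"
  proof
    fix x assume "x \<in> spec_ideal i"
    then obtain b where b: "\<forall>S\<in>\<S>. b S \<in> polys_in {..<d} \<and> \<sigma> i (b S) = 0"
        "x = \<psi> (\<Sum>S\<in>\<S>. ev \<kappa> \<theta> (b S) * e S)"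
      by (auto simp: spec_ideal_def)
    have sumI: "\<psi> (sum f T) \<in> genideal A ?X" if "\<And>S. S \<in> T \<Longrightarrow> \<psi> (f S) \<in> genideal A ?X" for f and T :: "'s set"
      using that by (induction T rule: infinite_finite_induct) (auto simp: psi_add psi_0)
    have mem: "\<psi> (ev \<kappa> \<theta> (b S) * e S) \<in> genideal A ?X" if "S \<in> \<S>" for S
    proof -
      have "\<psi> (ev \<kappa> \<theta> (b S - \<sigma> i (b S))) \<in> genideal A ?X" using b that by (intro *) auto
      then show ?thesis using b that by (simp add: psi_mult I.I_r_closed)
    qed
    show "x \<in> genideal A ?X" unfolding b(2) by (rule sumI, rule mem)
  qed
qed

text \<open>Uniqueness of coefficients gives \<open>(Var i - Const (c i)) * g S = b S\<close>. The
  substitution \<open>\<sigma> i\<close> fixes the first factor and kills the right-hand side, so it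
  kills \<open>g S\<close>, the polynomial ring being a domain.\<close>

lemma spec_ideal_regular:
  assumes "i < d" "a \<in> carrier A" "\<psi> (\<theta> i - \<kappa> (c i)) \<otimes> a \<in> spec_ideal i"
  shows "a \<in> spec_ideal i"
proof -
  obtain r where r: "a = \<psi> r" using psi_surj[OF assms(2)] by blast
  obtain g where g: "\<And>S. g S \<in> polys_in {..<d}" "\<psi> r = \<psi> (\<Sum>S\<in>\<S>. ev \<kappa> \<theta> (g S) * e S)"
    using span[of r] by blast
  obtain b where b: "\<And>S. S \<in> \<S> \<Longrightarrow> b S \<in> polys_in {..<d}" "\<And>S. S \<in> \<S> \<Longrightarrow> \<sigma> i (b S) = 0"
      "\<psi> (\<theta> i - \<kappa> (c i)) \<otimes> a = \<psi> (\<Sum>S\<in>\<S>. ev \<kappa> \<theta> (b S) * e S)"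
    using assms(3) by (auto simp: spec_ideal_def)
  let ?l = "Var i - Const (c i)"
  have l: "?l \<in> polys_in {..<d}"
    using assms(1) by (intro polys_in_minus polys_in_Var polys_in_Const) auto
  have "\<psi> (\<theta> i - \<kappa> (c i)) \<otimes> a = \<psi> (\<Sum>S\<in>\<S>. ev \<kappa> \<theta> (?l * g S) * e S)"
    unfolding r using psi_cong_mult[OF g(2), of "\<theta> i - \<kappa> (c i)"]
    by (simp add: psi_mult[symmetric] sum_distrib_left ev_mult E.hom_minus mult_ac)
  then have "\<psi> ((\<Sum>S\<in>\<S>. ev \<kappa> \<theta> (?l * g S) * e S) - (\<Sum>S\<in>\<S>. ev \<kappa> \<theta> (b S) * e S)) = \<zero>"
    using b(3) by (simp add: psi_minus)
  then have 0: "\<psi> (\<Sum>S\<in>\<S>. ev \<kappa> \<theta> (?l * g S - b S) * e S) = \<zero>"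
    by (simp add: E.hom_minus left_diff_distrib sum_subtractf)
  have "\<sigma> i (g S) = 0" if S: "S \<in> \<S>" for S
  proof -
    have "?l * g S - b S = 0"
      by (rule indep[OF _ 0 S]) (use l g b in auto)
    then have "\<sigma> i (?l * g S) = 0" using b(2)[OF S] by simp
    then have "?l * \<sigma> i (g S) = 0" by (simp add: \<sigma>_mult \<sigma>_minus \<sigma>_Var \<sigma>_Const)
    moreover have "?l \<noteq> 0"
    proof
      assume "?l = 0"
      then have "ev id (\<lambda>_. c i + 1) ?l = 0" by simp
      then show False by (simp add: EI.E.hom_minus)
    qed
    ultimately show ?thesis by simp
  qed
  then show ?thesis unfolding r g(2) spec_ideal_def using g(1) by blast
qed

end

lemma regular_sequence_in_maximal:
  assumes m: "maximalideal \<mm> A"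
  shows "\<exists>xs. regular_sequence A xs \<and> set xs \<subseteq> \<mm> \<and> length xs = d"
proof -
  interpret m: maximalideal \<mm> A by fact
  have "\<forall>i. \<exists>a. \<psi> (\<theta> i - \<kappa> a) \<in> \<mm>" using maximal_ideal_constants[OF m] by blast
  then obtain c where c: "\<And>i. \<psi> (\<theta> i - \<kappa> (c i)) \<in> \<mm>" by metis
  define xs where "xs = map (\<lambda>i. \<psi> (\<theta> i - \<kappa> (c i))) [0..<d]"
  have take: "set (take i xs) = (\<lambda>j. \<psi> (\<theta> j - \<kappa> (c j))) ` {..<i}" if "i \<le> d" for i
    using that by (auto simp: xs_def take_map)
  have sub: "set xs \<subseteq> \<mm>" using c by (auto simp: xs_def)
  have "genideal A (set xs) \<subseteq> \<mm>" by (intro genideal_minimal m.is_ideal sub)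
  then have "genideal A (set xs) \<noteq> carrier A" using m.I_notcarr m.Icarr by blast
  then have "regular_sequence A xs"
    unfolding regular_sequence_def
    using take genideal_eq_spec_ideal[of _ c] spec_ideal_regular[of _ _ c] by (auto simp: xs_def)
  then show ?thesis using sub by (intro exI[of _ xs]) (simp add: xs_def)
qed

text \<open>Multiplication by an \<open>x j\<close> raises the exponents in the coefficients by at
  most a constant \<open>C\<close>. The monomials in the \<open>x j\<close> with exponents below
  \<open>s\<close> number \<open>s ^ (d + 1)\<close>, while their coefficient vectors lie in a space
  whose dimension grows only like \<open>s ^ d\<close>.\<close>

lemma algebraic_dependence:
  fixes x :: "nat \<Rightarrow> 'r"
  shows "\<exists>G\<in>polys_in {..<Suc d}. G \<noteq> 0 \<and> \<psi> (ev \<kappa> x G) = \<zero>"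
proof -
  define Rep where "Rep K = {p. \<exists>b. (\<forall>S\<in>\<S>. b S \<in> bounded_polys d K) \<and> \<psi> p = \<psi> (\<Sum>S\<in>\<S>. ev \<kappa> \<theta> (b S) * e S)}" for K
  have Rep_mono: "p \<in> Rep L" if "p \<in> Rep K" "K \<le> L" for p K L
    using that bounded_polys_mono unfolding Rep_def by blast
  have Rep_ex: "\<exists>K. p \<in> Rep K" for p
  proof -
    obtain b where b: "\<And>S. b S \<in> polys_in {..<d}" "\<psi> p = \<psi> (\<Sum>S\<in>\<S>. ev \<kappa> \<theta> (b S) * e S)"
      using span[of p] by blast
    obtain K where K: "\<And>S. b S \<in> bounded_polys d (K S)" using bounded_polys_ex[OF b(1)] by metis
    have "b S \<in> bounded_polys d (sum K \<S>)" if "S \<in> \<S>" for S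
      using bounded_polys_mono[OF K] member_le_sum[OF that, of K] fin by auto
    then show ?thesis using b(2) by (auto simp: Rep_def)
  qed
  have "\<forall>j S. \<exists>K. x j * e S \<in> Rep K" using Rep_ex by blast
  then obtain K2 where K2: "\<And>j S. x j * e S \<in> Rep (K2 j S)" by metis
  obtain K1 where "1 \<in> Rep K1" using Rep_ex by blast
  note K = this K2
  \<comment> \<open>A sum in place of a maximum: \<open>C\<close> bounds the exponents in the
    coefficients of 1 and of every \<open>x j * e S\<close>.\<close>
  define C where "C = K1 + (\<Sum>j<Suc d. \<Sum>S\<in>\<S>. K2 j S)"
  have one: "1 \<in> Rep C" by (rule Rep_mono[OF K(1)]) (simp add: C_def)
  have xe: "x j * e S \<in> Rep C" if "j < Suc d" "S \<in> \<S>" for j S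
  proof (rule Rep_mono[OF K(2)])
    have "K2 j S \<le> (\<Sum>S\<in>\<S>. K2 j S)" using that fin by (intro member_le_sum) auto
    also have "\<dots> \<le> (\<Sum>j<Suc d. \<Sum>S\<in>\<S>. K2 j S)"
      using that by (intro member_le_sum[of j "{..<Suc d}" "\<lambda>j. \<Sum>S\<in>\<S>. K2 j S"]) auto
    finally show "K2 j S \<le> C" by (simp add: C_def)
  qed
  have step: "x j * p \<in> Rep (K + C)" if p: "p \<in> Rep K" and j: "j < Suc d" for j p K
  proof -
    obtain b where b: "\<And>S. S \<in> \<S> \<Longrightarrow> b S \<in> bounded_polys d K" "\<psi> p = \<psi> (\<Sum>S\<in>\<S>. ev \<kappa> \<theta> (b S) * e S)"
      using p by (auto simp: Rep_def)
    have "\<forall>S\<in>\<S>. \<exists>g. (\<forall>U\<in>\<S>. g U \<in> bounded_polys d C) \<and> \<psi> (x j * e S) = \<psi> (\<Sum>U\<in>\<S>. ev \<kappa> \<theta> (g U) * e U)"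
      using xe[OF j] by (auto simp: Rep_def)
    then obtain g where g: "\<And>S U. S \<in> \<S> \<Longrightarrow> U \<in> \<S> \<Longrightarrow> g S U \<in> bounded_polys d C"
        "\<And>S. S \<in> \<S> \<Longrightarrow> \<psi> (x j * e S) = \<psi> (\<Sum>U\<in>\<S>. ev \<kappa> \<theta> (g S U) * e U)"
      unfolding bchoice_iff by blast
    have "\<psi> (x j * p) = \<psi> (\<Sum>S\<in>\<S>. ev \<kappa> \<theta> (b S) * (x j * e S))"
      using psi_cong_mult[OF b(2), of "x j"] by (simp add: sum_distrib_left mult_ac)
    also have "\<dots> = \<psi> (\<Sum>S\<in>\<S>. ev \<kappa> \<theta> (b S) * (\<Sum>U\<in>\<S>. ev \<kappa> \<theta> (g S U) * e U))"
      by (intro psi_sum_cong psi_cong_mult g)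
    also have "(\<Sum>S\<in>\<S>. ev \<kappa> \<theta> (b S) * (\<Sum>U\<in>\<S>. ev \<kappa> \<theta> (g S U) * e U))
        = (\<Sum>S\<in>\<S>. \<Sum>U\<in>\<S>. ev \<kappa> \<theta> (b S * g S U) * e U)"
      by (simp add: sum_distrib_left ev_mult mult_ac)
    also have "\<dots> = (\<Sum>U\<in>\<S>. ev \<kappa> \<theta> (\<Sum>S\<in>\<S>. b S * g S U) * e U)"
      by (subst sum.swap) (simp add: ev_sum0 sum_distrib_right)
    finally show ?thesis
      unfolding Rep_def using b(1) g(1)
      by (intro CollectI exI[of _ "\<lambda>U. \<Sum>S\<in>\<S>. b S * g S U"])
        (auto intro!: bounded_polys_sum bounded_polys_mult)
  qed
  have pow: "x j ^ k * p \<in> Rep (K + k * C)" if "p \<in> Rep K" "j < Suc d" for j p K k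
  proof (induction k)
    case (Suc k)
    show ?case using step[OF Suc that(2)] by (simp add: algebra_simps)
  qed (use that in simp)
  have mono: "(\<Prod>j<n. x j ^ h j) \<in> Rep (C + n * (s * C))" if "n \<le> Suc d" "\<And>j. j < n \<Longrightarrow> h j \<le> s" for n h s
    using that
  proof (induction n)
    case (Suc n)
    have "x n ^ h n * (\<Prod>j<n. x j ^ h j) \<in> Rep (C + n * (s * C) + h n * C)"
      using Suc by (intro pow) auto
    moreover have "C + n * (s * C) + h n * C \<le> C + Suc n * (s * C)" using Suc.prems by simp
    ultimately show ?case using Rep_mono by (simp add: mult.commute)
  qed (use one in simp)
  \<comment> \<open>\<open>Q\<close> is chosen so that \<open>L + 1 \<le> s * Q\<close>, which
    bounds the number of equations by \<open>card \<S> * (s * Q) ^ d\<close>; as \<open>s\<close>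
    exceeds \<open>card \<S> * Q ^ d\<close>, this is less than the number
    \<open>s ^ (d + 1)\<close> of unknowns.\<close>
  define Q where "Q = C + Suc d * C + 1"
  define s where "s = card \<S> * Q ^ d + 1"
  define X where "X = PiE {..<Suc d} (\<lambda>_. {..<s})"
  define L where "L = C + Suc d * (s * C)"
  define Y where "Y = \<S> \<times> PiE {..<d} (\<lambda>_. {..L})"
  have "\<forall>h\<in>X. \<exists>b. (\<forall>S\<in>\<S>. b S \<in> bounded_polys d L) \<and> \<psi> (\<Prod>j<Suc d. x j ^ h j) = \<psi> (\<Sum>S\<in>\<S>. ev \<kappa> \<theta> (b S) * e S)"
  proof
    fix h assume "h \<in> X"
    then have "(\<Prod>j<Suc d. x j ^ h j) \<in> Rep L"
      unfolding L_def by (intro mono) (auto simp: X_def PiE_def Pi_def less_imp_le simp del: lessThan_Suc)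
    then show "\<exists>b. (\<forall>S\<in>\<S>. b S \<in> bounded_polys d L) \<and> \<psi> (\<Prod>j<Suc d. x j ^ h j) = \<psi> (\<Sum>S\<in>\<S>. ev \<kappa> \<theta> (b S) * e S)"
      by (simp add: Rep_def)
  qed
  then obtain b where b: "\<And>h S. h \<in> X \<Longrightarrow> S \<in> \<S> \<Longrightarrow> b h S \<in> bounded_polys d L"
      "\<And>h. h \<in> X \<Longrightarrow> \<psi> (\<Prod>j<Suc d. x j ^ h j) = \<psi> (\<Sum>S\<in>\<S>. ev \<kappa> \<theta> (b h S) * e S)"
    unfolding bchoice_iff by blast
  have finX: "finite X" and finY: "finite Y" using fin by (auto simp: X_def Y_def intro!: finite_PiE)
  have "card Y < card X"
  proof -
    have "card Y = card \<S> * (L + 1) ^ d" by (simp add: Y_def card_cartesian_product card_PiE)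
    also have "L + 1 \<le> s * Q"
    proof -
      have "C + 1 \<le> s * (C + 1)" by (simp add: s_def)
      then show ?thesis by (simp add: L_def Q_def algebra_simps)
    qed
    then have "card \<S> * (L + 1) ^ d \<le> card \<S> * (s * Q) ^ d" by (intro mult_le_mono2 power_mono) auto
    also have "\<dots> = (card \<S> * Q ^ d) * s ^ d" by (simp add: power_mult_distrib)
    also have "\<dots> < s * s ^ d" by (intro mult_strict_right_mono) (auto simp: s_def)
    also have "\<dots> = card X" by (simp add: X_def card_PiE)
    finally show ?thesis .
  qed
  then obtain c where c: "\<exists>h\<in>X. c h \<noteq> 0"
      "\<And>y. y \<in> Y \<Longrightarrow> (\<Sum>h\<in>X. c h * Poly_Mapping.lookup (b h (fst y)) (exponent_of d (snd y))) = 0"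
    using nontrivial_relation[OF finY finX, of "\<lambda>h y. Poly_Mapping.lookup (b h (fst y)) (exponent_of d (snd y))"]
    by blast
  define G where "G = (\<Sum>h\<in>X. Poly_Mapping.single (exponent_of (Suc d) h) (c h))"
  have inj: "exponent_of (Suc d) h = exponent_of (Suc d) h' \<longleftrightarrow> h = h'" if "h \<in> X" "h' \<in> X" for h h'
  proof
    assume eq: "exponent_of (Suc d) h = exponent_of (Suc d) h'"
    have "h i = h' i" for i
    proof (cases "i < Suc d")
      case True
      then show ?thesis using arg_cong[OF eq, of "\<lambda>m. Poly_Mapping.lookup m i"] by (simp add: lookup_exponent_of)
    next
      case False
      then show ?thesis using that by (simp add: X_def PiE_def extensional_def)
    qed
    then show "h = h'" by auto
  qed auto
  have "G \<in> polys_in {..<Suc d}"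
    unfolding G_def
  proof (intro polys_in_sum)
    fix h
    have "Poly_Mapping.keys (exponent_of (Suc d) h) \<subseteq> {..<Suc d}"
      by (auto simp: in_keys_iff lookup_exponent_of split: if_splits)
    then show "Poly_Mapping.single (exponent_of (Suc d) h) (c h) \<in> polys_in {..<Suc d}"
      by (auto simp: polys_in_def)
  qed
  moreover have "G \<noteq> 0"
  proof -
    obtain h0 where h0: "h0 \<in> X" "c h0 \<noteq> 0" using c(1) by blast
    have "Poly_Mapping.lookup G (exponent_of (Suc d) h0) = (\<Sum>h\<in>X. if h = h0 then c h else 0)"
      unfolding G_def lookup_sum
      using inj h0 by (intro sum.cong refl) (auto simp: lookup_single when_def)
    then show ?thesis using h0 finX by auto
  qed
  moreover have "\<psi> (ev \<kappa> x G) = \<zero>"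
  proof -
    have mon: "mon x (exponent_of (Suc d) h) = (\<Prod>j<Suc d. x j ^ h j)" for h
    proof -
      have "mon x (exponent_of (Suc d) h) = (\<Prod>j<Suc d. x j ^ Poly_Mapping.lookup (exponent_of (Suc d) h) j)"
        by (rule mon_superset) (auto simp: in_keys_iff lookup_exponent_of split: if_splits)
      then show ?thesis by (simp add: lookup_exponent_of)
    qed
    have "\<psi> (ev \<kappa> x G) = \<psi> (\<Sum>h\<in>X. \<kappa> (c h) * (\<Prod>j<Suc d. x j ^ h j))"
      unfolding G_def by (simp add: ev_sum0 mon del: prod.lessThan_Suc)
    also have "\<dots> = \<psi> (\<Sum>h\<in>X. \<kappa> (c h) * (\<Sum>S\<in>\<S>. ev \<kappa> \<theta> (b h S) * e S))"
      by (intro psi_sum_cong psi_cong_mult b)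
    also have "(\<Sum>h\<in>X. \<kappa> (c h) * (\<Sum>S\<in>\<S>. ev \<kappa> \<theta> (b h S) * e S))
        = (\<Sum>h\<in>X. \<Sum>S\<in>\<S>. ev \<kappa> \<theta> (Const (c h) * b h S) * e S)"
      by (simp add: sum_distrib_left ev_mult mult_ac)
    also have "\<dots> = (\<Sum>S\<in>\<S>. ev \<kappa> \<theta> (\<Sum>h\<in>X. Const (c h) * b h S) * e S)"
      by (subst sum.swap) (simp add: ev_sum0 sum_distrib_right)
    also have "\<dots> = 0"
    proof (intro sum.neutral ballI)
      fix S assume S: "S \<in> \<S>"
      have "(\<Sum>h\<in>X. Const (c h) * b h S) = 0"
      proof (rule poly_mapping_eqI)
        fix m
        have lk: "Poly_Mapping.lookup (\<Sum>h\<in>X. Const (c h) * b h S) m = (\<Sum>h\<in>X. c h * Poly_Mapping.lookup (b h S) m)"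
          by (simp add: lookup_sum Const_def lookup_single_0_mult)
        show "Poly_Mapping.lookup (\<Sum>h\<in>X. Const (c h) * b h S) m = Poly_Mapping.lookup 0 m"
        proof (cases "\<exists>h\<in>X. m \<in> Poly_Mapping.keys (b h S)")
          case True
          then obtain h where h: "h \<in> X" "m \<in> Poly_Mapping.keys (b h S)" by blast
          then have m: "Poly_Mapping.keys m \<subseteq> {..<d}" "\<And>i. Poly_Mapping.lookup m i \<le> L"
            using b(1)[OF h(1) S] by (auto simp: bounded_polys_def polys_in_def)
          define hm where "hm = restrict (Poly_Mapping.lookup m) {..<d}"
          have "exponent_of d hm = m"
            by (rule poly_mapping_eqI) (use m(1) in \<open>auto simp: lookup_exponent_of hm_def in_keys_iff\<close>)
          moreover have "(S, hm) \<in> Y" using S m(2) by (auto simp: Y_def hm_def)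
          ultimately show ?thesis using c(2)[of "(S, hm)"] lk by simp
        next
          case False
          then show ?thesis unfolding lk by (auto simp: in_keys_iff intro!: sum.neutral)
        qed
      qed
      then show "ev \<kappa> \<theta> (\<Sum>h\<in>X. Const (c h) * b h S) * e S = 0" by simp
    qed
    finally show ?thesis by (simp add: psi_0)
  qed
  ultimately show ?thesis by blast
qed

text \<open>The lowest power of the first variable can be cancelled modulo the first prime of the chain;
  the rest of the relation without that variable then lies in the second prime.\<close>

lemma no_relation_along_chain:
  assumes P: "prime_chain A n P"
    and x: "\<And>j. j < n \<Longrightarrow> \<psi> (x j) \<in> P (Suc j)" "\<And>j. j < n \<Longrightarrow> \<psi> (x j) \<notin> P j"
    and G: "G \<in> polys_in {i..<n}" "G \<noteq> 0" "\<psi> (ev \<kappa> x G) \<in> P i" and i: "i \<le> n"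
  shows False
  using G i
proof (induction "n - i" arbitrary: i G)
  case 0
  then have "i = n" by simp
  interpret p: primeideal "P i" A using P \<open>i = n\<close> by (simp add: prime_chain_def)
  have "\<exists>c. g = Const c" if "g \<in> polys_in {i..<n}" for g :: "(nat \<Rightarrow>\<^sub>0 nat) \<Rightarrow>\<^sub>0 'k"
    using that
  proof (induction rule: polys_induct)
    case (add p q)
    then show ?case using Const_add by metis
  next
    case (mult p q)
    then show ?case using Const_mult by metis
  qed (use \<open>i = n\<close> in auto)
  then obtain c where c: "G = Const c" using 0 by blast
  then have c0: "c \<noteq> 0" using 0 by auto
  have "\<psi> (\<kappa> (inverse c)) \<otimes> \<psi> (\<kappa> c) \<in> P i" using 0(4) unfolding c by (intro p.I_l_closed) auto
  then have "\<one> \<in> P i" using c0 by (simp add: psi_mult[symmetric] hom_mult[symmetric] psi_1 hom_one)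
  then show False using p.one_imp_carrier p.I_notcarr by simp
next
  case (Suc k)
  then have i: "i < n" by simp
  interpret p: primeideal "P i" A using P i by (simp add: prime_chain_def)
  interpret q: primeideal "P (Suc i)" A using P i by (simp add: prime_chain_def)
  obtain k' G0 G1 where G: "G0 \<in> polys_in {Suc i..<n}" "G1 \<in> polys_in {i..<n}" "G0 \<noteq> 0"
      "G = Var i ^ k' * (G0 + Var i * G1)"
    using factor_variable[OF Suc.prems(1) i Suc.prems(2)] by blast
  have "\<psi> (x i ^ l * y) \<in> P i \<Longrightarrow> \<psi> y \<in> P i" for l y
  proof (induction l)
    case (Suc l)
    then have "\<psi> (x i) \<otimes> \<psi> (x i ^ l * y) \<in> P i" by (simp add: psi_mult[symmetric] mult_ac)
    then have "\<psi> (x i ^ l * y) \<in> P i"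
      using p.I_prime[OF psi_closed psi_closed] x(2)[OF i] by metis
    then show ?case by (rule Suc.IH)
  qed simp
  then have "\<psi> (ev \<kappa> x (G0 + Var i * G1)) \<in> P i"
    using Suc.prems(3) unfolding G(4) by (simp add: ev_mult E.hom_power)
  moreover have "P i \<subseteq> P (Suc i)" using P i unfolding prime_chain_def by blast
  ultimately have 1: "\<psi> (ev \<kappa> x (G0 + Var i * G1)) \<in> P (Suc i)" by blast
  have "\<psi> (x i) \<otimes> \<psi> (ev \<kappa> x G1) \<in> P (Suc i)" using x(1)[OF i] by (intro q.I_r_closed) auto
  then have "\<psi> (ev \<kappa> x (G0 + Var i * G1)) \<ominus> \<psi> (x i) \<otimes> \<psi> (ev \<kappa> x G1) \<in> P (Suc i)"
    using 1 unfolding minus_eq by (intro q.a_closed q.a_inv_closed)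
  then have "\<psi> (ev \<kappa> x G0) \<in> P (Suc i)"
    by (simp add: psi_mult[symmetric] psi_minus[symmetric] ev_add ev_mult)
  moreover have "k = n - Suc i" using Suc.hyps(2) by simp
  ultimately show False using Suc.hyps(1)[of "Suc i" G0] G i by simp
qed

lemma no_long_prime_chain: "\<not> prime_chain A (Suc d) P"
proof
  assume P: "prime_chain A (Suc d) P"
  have "\<exists>p. \<psi> p \<in> P (Suc j) \<and> \<psi> p \<notin> P j" if j: "j < Suc d" for j
  proof -
    have "P j \<subset> P (Suc j)" using P j by (simp add: prime_chain_def)
    then obtain a where a: "a \<in> P (Suc j)" "a \<notin> P j" by blast
    interpret p: primeideal "P (Suc j)" A using P j by (simp add: prime_chain_def)
    obtain p where "a = \<psi> p" using psi_surj[OF p.Icarr[OF a(1)]] by blast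
    then show ?thesis using a by (intro exI[of _ p]) simp
  qed
  then have "\<forall>j. \<exists>p. j < Suc d \<longrightarrow> \<psi> p \<in> P (Suc j) \<and> \<psi> p \<notin> P j" by blast
  then obtain x where x: "\<And>j. j < Suc d \<Longrightarrow> \<psi> (x j) \<in> P (Suc j)" "\<And>j. j < Suc d \<Longrightarrow> \<psi> (x j) \<notin> P j"
    by metis
  obtain G where "G \<in> polys_in {..<Suc d}" and G: "G \<noteq> 0" "\<psi> (ev \<kappa> x G) = \<zero>"
    using algebraic_dependence[of x] by blast
  then have G0: "G \<in> polys_in {0..<Suc d}" unfolding lessThan_atLeast0 by simp
  interpret p: primeideal "P 0" A using P by (simp add: prime_chain_def)
  have "\<psi> (ev \<kappa> x G) \<in> P 0"
    unfolding G(2) using additive_subgroup.zero_closed[OF p.additive_subgroup_axioms] .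
  then show False using no_relation_along_chain[OF P x G0 G(1)] by simp
qed

theorem cohen_macaulay_A: "cohen_macaulay A"
  using cohen_macaulayI[OF noetherian_A no_long_prime_chain regular_sequence_in_maximal] .

end


section \<open>Generators over the ring of parameters\<close>

definition ymon :: "nat set \<Rightarrow> 'k::comm_ring_1 mpoly" where
  "ymon S = (\<Prod>j\<in>S. Var (0, j))"

text \<open>The theta come at the indices below \<open>n\<close>, the moments eta at
  \<open>n\<close>, \<open>n + 1\<close> and \<open>n + 2\<close>; a single sequence lets one
  substitution embed the parameter ring.\<close>

definition param :: "nat \<Rightarrow> (nat \<Rightarrow> 'k::comm_ring_1) \<Rightarrow> nat \<Rightarrow> 'k mpoly" where
  "param n a i = (if i < n then Var (1, i) - Const (a i ^ 2) * Var (0, i)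
     else (\<Sum>j<n. Const (a j ^ (i - n)) * Var (0, j)))"

text \<open>Size m contributes C(n + m - 4, m) sets for n >= 4, and these numbers add up to C(n, 3).
  For n = 3 only the empty set remains.\<close>

definition basis_sets :: "nat \<Rightarrow> nat set set" where
  "basis_sets n = {S. card S \<le> 3 \<and> S \<subseteq> {..<n + card S - 4}}"

lemma finite_basis_sets: "finite (basis_sets n)"
proof (rule finite_subset)
  show "basis_sets n \<subseteq> Pow {..<n + 3}" by (auto simp: basis_sets_def)
qed auto

locale moment_points =
  fixes n :: nat and a :: "nat \<Rightarrow> 'k::field_char_0"
  assumes n3: "3 \<le> n"
    and a_inj: "i < n \<Longrightarrow> j < n \<Longrightarrow> i \<noteq> j \<Longrightarrow> a i \<noteq> a j"
    and a_sum: "i < n \<Longrightarrow> j < n \<Longrightarrow> i \<noteq> j \<Longrightarrow> a i + a j \<noteq> 0"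
begin

abbreviation "R \<equiv> polys_in ({..<2} \<times> {..<n}) :: 'k mpoly set"
abbreviation "B \<equiv> polys_in {..<n + 3} :: ((nat \<Rightarrow>\<^sub>0 nat) \<Rightarrow>\<^sub>0 'k) set"
abbreviation "subst \<equiv> ev Const (param n a)"

lemma y_in_R: "j < n \<Longrightarrow> Var (0, j) \<in> R" and z_in_R: "j < n \<Longrightarrow> Var (1, j) \<in> R"
  by auto

lemma param_in_R: "param n a i \<in> R"
  unfolding param_def by (auto intro!: polys_in_minus polys_in_mult polys_in_sum y_in_R z_in_R)

lemma subst_in_R: "subst b \<in> R"
  by (rule ev_Const_in[where V = UNIV]) (auto simp: param_in_R)

lemma ymon_in_R: "S \<subseteq> {..<n} \<Longrightarrow> ymon S \<in> R"
  unfolding ymon_def by (auto intro!: polys_in_prod)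

lemma basis_sets_sub: "S \<in> basis_sets n \<Longrightarrow> S \<subseteq> {..<n}"
  by (fastforce simp: basis_sets_def)

text \<open>Besides \<open>K\<close> and \<open>j\<close> exactly two indices p and q are left.
  Weighting the \<open>y_i\<close> by the quadratic polynomial with roots \<open>a p\<close> and
  \<open>a q\<close> gives a combination of the three moments in which the two unwanted variables
  drop out and \<open>y_j\<close> has a nonzero coefficient.\<close>

lemma y_relation:
  assumes K: "K \<subseteq> {..<n}" "card K = n - 3" and j: "j < n"
  shows "\<exists>c c'. Var (0, j) = (\<Sum>i\<in>K. Const (c i) * Var (0, i)) + (\<Sum>l<3. Const (c' l) * param n a (n + l))"
proof (cases "j \<in> K")
  case True
  have "(\<Sum>i\<in>K. Const (if i = j then 1 else 0) * Var (0, i)) = (Var (0, j) :: 'k mpoly)"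
    using True finite_subset[OF K(1)] by (simp add: if_distrib if_distribR cong: if_cong)
  then show ?thesis by (intro exI[of _ "\<lambda>i. if i = j then 1 else 0"] exI[of _ "\<lambda>_. 0"]) simp
next
  case False
  have finK: "finite K" using K(1) finite_subset by blast
  have "card ({..<n} - K) = 3" using K n3 finK by (simp add: card_Diff_subset)
  then have "card ({..<n} - K - {j}) = 2" using j False by (simp add: card_Diff_subset)
  then obtain p q where pq: "{..<n} - K - {j} = {p, q}" "p \<noteq> q" by (auto simp: card_2_iff)
  then have pq': "p < n" "q < n" "p \<noteq> j" "q \<noteq> j" "p \<notin> K" "q \<notin> K" by auto
  define f where "f x = (x - a p) * (x - a q)" for x
  have fj: "f (a j) \<noteq> 0" using pq' j a_inj[of j p] a_inj[of j q] by (auto simp: f_def)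
  have dec: "{..<n} = insert j (insert p (insert q K))" using pq j K by auto
  have "(\<Sum>i<n. Const (f (a i)) * Var (0, i)) = Const (f (a j)) * (Var (0, j) :: 'k mpoly) + (\<Sum>i\<in>K. Const (f (a i)) * Var (0, i))"
    unfolding dec using pq' pq(2) False finK by (simp add: f_def)
  moreover have "(\<Sum>i<n. Const (f (a i)) * Var (0, i)) = (\<Sum>l<3. Const ([a p * a q, - (a p + a q), 1] ! l) * param n a (n + l))"
  proof -
    have "(\<Sum>l<3. Const ([a p * a q, - (a p + a q), 1] ! l * a i ^ l)) = (Const (f (a i)) :: 'k mpoly)" for i
    proof -
      have "(\<Sum>l<3. [a p * a q, - (a p + a q), 1] ! l * a i ^ l) = f (a i)"
        by (simp add: numeral_3_eq_3 f_def power2_eq_square algebra_simps)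
      then show ?thesis by (simp only: EC.hom_sum[symmetric])
    qed
    moreover have "(\<Sum>l<3. Const ([a p * a q, - (a p + a q), 1] ! l) * param n a (n + l))
        = (\<Sum>i<n. (\<Sum>l<3. Const ([a p * a q, - (a p + a q), 1] ! l * a i ^ l)) * Var (0, i))"
      unfolding param_def by (simp add: sum_distrib_left sum_distrib_right Const_mult mult.assoc) (rule sum.swap)
    ultimately show ?thesis by simp
  qed
  ultimately have eq: "Const (f (a j)) * Var (0, j)
      = (\<Sum>l<3. Const ([a p * a q, - (a p + a q), 1] ! l) * param n a (n + l)) - (\<Sum>i\<in>K. Const (f (a i)) * Var (0, i))"
    by (simp add: algebra_simps)
  have "Var (0, j) = Const (1 / f (a j)) * (Const (f (a j)) * (Var (0, j) :: 'k mpoly))"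
    using fj by (simp add: mult.assoc[symmetric] Const_mult[symmetric])
  also have "\<dots> = (\<Sum>i\<in>K. Const (- f (a i) / f (a j)) * Var (0, i))
      + (\<Sum>l<3. Const ([a p * a q, - (a p + a q), 1] ! l / f (a j)) * param n a (n + l))"
    unfolding eq by (simp add: right_diff_distrib sum_distrib_left mult.assoc[symmetric]
        Const_mult[symmetric] EC.hom_uminus sum_negf)
  finally show ?thesis
    by (intro exI[of _ "\<lambda>i. - f (a i) / f (a j)"] exI[of _ "\<lambda>l. [a p * a q, - (a p + a q), 1] ! l / f (a j)"])
qed

end

text \<open>The ideal stays abstract: spanning needs only one relation for each four columns. The
  \<open>K\<close> in \<open>minors4\<close> are proper subsets of \<open>J\<close>, so all other
  terms have fewer factors y, with coefficients in the parameters.\<close>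

locale minor_relations = moment_points +
  fixes I :: "'a mpoly set"
  assumes I_sub: "I \<subseteq> polys_in ({..<2} \<times> {..<n})" and I_0: "0 \<in> I"
    and I_add: "x \<in> I \<Longrightarrow> y \<in> I \<Longrightarrow> x + y \<in> I"
    and I_mult: "r \<in> polys_in ({..<2} \<times> {..<n}) \<Longrightarrow> x \<in> I \<Longrightarrow> r * x \<in> I"
    and minors4: "J \<subseteq> {..<n} \<Longrightarrow> card J = 4 \<Longrightarrow> \<exists>V g. V \<noteq> 0 \<and> (\<forall>K. g K \<in> polys_in {..<n + 3}) \<and>
      Const V * ymon J - (\<Sum>K\<in>Pow J - {J}. ev Const (param n a) (g K) * ymon K) \<in> I"
begin

definition basis_span :: "'a mpoly set" where
  "basis_span = {f. \<exists>b. (\<forall>S. b S \<in> B) \<and> f - (\<Sum>S\<in>basis_sets n. subst (b S) * ymon S) \<in> I}"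

lemma basis_span_I: "f \<in> I \<Longrightarrow> f \<in> basis_span"
  unfolding basis_span_def by (intro CollectI exI[of _ "\<lambda>_. 0"]) auto

lemma basis_span_0: "0 \<in> basis_span" using basis_span_I I_0 .

lemma basis_span_add: "f \<in> basis_span \<Longrightarrow> g \<in> basis_span \<Longrightarrow> f + g \<in> basis_span"
proof -
  assume "f \<in> basis_span" "g \<in> basis_span"
  then obtain b c where *: "\<And>S. b S \<in> B" "\<And>S. c S \<in> B"
      "f - (\<Sum>S\<in>basis_sets n. subst (b S) * ymon S) \<in> I" "g - (\<Sum>S\<in>basis_sets n. subst (c S) * ymon S) \<in> I"
    by (auto simp: basis_span_def)
  have "(f - (\<Sum>S\<in>basis_sets n. subst (b S) * ymon S)) + (g - (\<Sum>S\<in>basis_sets n. subst (c S) * ymon S)) \<in> I"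
    using * by (intro I_add)
  also have "(f - (\<Sum>S\<in>basis_sets n. subst (b S) * ymon S)) + (g - (\<Sum>S\<in>basis_sets n. subst (c S) * ymon S))
      = (f + g) - (\<Sum>S\<in>basis_sets n. subst (b S + c S) * ymon S)"
    by (simp add: EC.ev_add ring_distribs sum.distrib)
  finally show ?thesis unfolding basis_span_def using * by (intro CollectI exI[of _ "\<lambda>S. b S + c S"]) auto
qed

lemma basis_span_subst: "b \<in> B \<Longrightarrow> f \<in> basis_span \<Longrightarrow> subst b * f \<in> basis_span"
proof -
  assume b: "b \<in> B" and "f \<in> basis_span"
  then obtain c where *: "\<And>S. c S \<in> B" "f - (\<Sum>S\<in>basis_sets n. subst (c S) * ymon S) \<in> I"
    by (auto simp: basis_span_def)
  have "subst b * (f - (\<Sum>S\<in>basis_sets n. subst (c S) * ymon S)) \<in> I"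
    using * by (intro I_mult subst_in_R)
  also have "subst b * (f - (\<Sum>S\<in>basis_sets n. subst (c S) * ymon S))
      = subst b * f - (\<Sum>S\<in>basis_sets n. subst (b * c S) * ymon S)"
    by (simp add: EC.ev_mult right_diff_distrib sum_distrib_left mult_ac)
  finally show ?thesis unfolding basis_span_def using * b by (intro CollectI exI[of _ "\<lambda>S. b * c S"]) auto
qed

lemma basis_span_Const: "f \<in> basis_span \<Longrightarrow> Const c * f \<in> basis_span"
  using basis_span_subst[of "Const c" f] by simp

lemma basis_span_sum: "(\<And>i. i \<in> T \<Longrightarrow> f i \<in> basis_span) \<Longrightarrow> sum f T \<in> basis_span"
  by (induction T rule: infinite_finite_induct) (auto simp: basis_span_0 basis_span_add)

lemma basis_span_basis: "S \<in> basis_sets n \<Longrightarrow> ymon S \<in> basis_span"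
proof -
  assume S: "S \<in> basis_sets n"
  have "(\<Sum>U\<in>basis_sets n. subst (if U = S then 1 else 0) * ymon U)
      = (\<Sum>U\<in>basis_sets n. if U = S then ymon U else 0)"
    by (rule sum.cong) (auto simp: EC.E.hom_one)
  also have "\<dots> = ymon S" using S finite_basis_sets by simp
  finally show ?thesis
    unfolding basis_span_def by (intro CollectI exI[of _ "\<lambda>U. if U = S then 1 else 0"]) (auto simp: I_0)
qed

text \<open>Lists allow repeated factors, which sets do not: multiplying a basis element by some
  \<open>Var (0, j)\<close> can create a square.\<close>

definition yprod :: "nat list \<Rightarrow> 'a mpoly" where
  "yprod js = (\<Prod>j\<leftarrow>js. Var (0, j))"

lemma ymon_yprod: "finite S \<Longrightarrow> ymon S = yprod (sorted_list_of_set S)"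
  unfolding ymon_def yprod_def by (subst prod.distinct_set_conv_list[symmetric]) auto

text \<open>A filtration by the number of factors y. \<open>top\<close> provides the squarefree
  leading terms with constant coefficients; \<open>low\<close> absorbs every product with fewer
  factors, repetitions and parameter coefficients included. For \<open>m \<le> 3\<close> the leading
  terms are those of \<open>basis_sets\<close>.\<close>

inductive_set yspan :: "nat \<Rightarrow> 'a mpoly set" for m where
  zero: "0 \<in> yspan m"
| add: "f \<in> yspan m \<Longrightarrow> g \<in> yspan m \<Longrightarrow> f + g \<in> yspan m"
| top: "card S = m \<Longrightarrow> S \<subseteq> {..<n + m - 4} \<Longrightarrow> Const c * ymon S \<in> yspan m"
| low: "length js < m \<Longrightarrow> set js \<subseteq> {..<n} \<Longrightarrow> b \<in> B \<Longrightarrow> subst b * yprod js \<in> yspan m"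

lemma yspan_sum: "(\<And>i. i \<in> T \<Longrightarrow> f i \<in> yspan m) \<Longrightarrow> sum f T \<in> yspan m"
  by (induction T rule: infinite_finite_induct) (auto intro: yspan.intros)

text \<open>Removing \<open>S\<close> from \<open>{..<n + m - 3}\<close> leaves exactly
  \<open>n - 3\<close> indices, as \<open>y_relation\<close> requires. Rewriting \<open>y_j\<close>
  through them yields sets \<open>insert i S\<close> without repetition and within the bound for
  \<open>Suc m\<close>, while the moment terms only keep the factors from \<open>S\<close> and fall
  into \<open>low\<close>.\<close>

lemma yspan_mult:
  assumes "f \<in> yspan m" "m \<le> 3" "j < n"
  shows "Var (0, j) * f \<in> yspan (Suc m)"
  using assms(1)
proof (induction rule: yspan.induct)
  case (low js b)
  have "subst b * yprod (j # js) \<in> yspan (Suc m)" using low assms by (intro yspan.low) auto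
  then show ?case by (simp add: yprod_def mult_ac)
next
  case (top S c)
  have m4: "n + Suc m - 4 = n + m - 3" using n3 by simp
  have finS: "finite S" using top finite_subset by blast
  have Ssub: "S \<subseteq> {..<n + m - 3}" using top by fastforce
  define K where "K = {..<n + m - 3} - S"
  have "card K = n - 3"
    unfolding K_def using Ssub top(1) n3 finS by (simp add: card_Diff_subset)
  moreover have "K \<subseteq> {..<n}" unfolding K_def using assms(2) n3 by auto
  ultimately obtain d d' where eq: "Var (0, j) = (\<Sum>i\<in>K. Const (d i) * Var (0, i))
      + (\<Sum>l<3. Const (d' l) * param n a (n + l))"
    using y_relation[of K j] assms(3) by blast
  have 1: "Const (d i) * Var (0, i) * (Const c * ymon S) \<in> yspan (Suc m)" if i: "i \<in> K" for i
  proof -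
    have "Const (d i) * Var (0, i) * (Const c * ymon S) = Const (d i * c) * ymon (insert i S)"
      using i finS by (simp add: ymon_def K_def Const_mult mult_ac)
    also have "\<dots> \<in> yspan (Suc m)"
      using i finS top Ssub unfolding K_def by (intro yspan.top) (auto simp: m4)
    finally show ?thesis .
  qed
  have 2: "Const (d' l) * param n a (n + l) * (Const c * ymon S) \<in> yspan (Suc m)" if l: "l < 3" for l
  proof -
    have "subst (Const (d' l * c) * Var (n + l)) * yprod (sorted_list_of_set S) \<in> yspan (Suc m)"
      using top finS Ssub assms(2) l n3
      by (intro yspan.low) (auto intro!: polys_in_mult polys_in_Var)
    then show ?thesis using finS by (simp add: ymon_yprod EC.ev_mult Const_mult mult_ac)
  qed
  show ?case
    unfolding eq ring_distribs sum_distrib_right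
    by (intro yspan.add yspan_sum 1 2) auto
qed (auto simp: ring_distribs intro: yspan.intros)

lemma yprod_yspan: "length js = m \<Longrightarrow> m \<le> 4 \<Longrightarrow> set js \<subseteq> {..<n} \<Longrightarrow> yprod js \<in> yspan m"
proof (induction js arbitrary: m)
  case Nil
  then show ?case using yspan.top[of "{}" 0 1] by (simp add: yprod_def ymon_def)
next
  case (Cons j js)
  then have "Var (0, j) * yprod js \<in> yspan (Suc (length js))" by (intro yspan_mult) auto
  then show ?case using Cons.prems by (simp add: yprod_def)
qed

text \<open>Length 4 suffices, since a basis set has at most three elements and one multiplication
  adds one factor. At length 4 the bound \<open>n + m - 4\<close> is \<open>n\<close>, and the
  relation for four columns trades each leading term for shorter products.\<close>

lemma yprod_basis_span: "length js \<le> 4 \<Longrightarrow> set js \<subseteq> {..<n} \<Longrightarrow> yprod js \<in> basis_span"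
proof (induction "length js" arbitrary: js rule: less_induct)
  case less
  define m where "m = length js"
  have top: "ymon S \<in> basis_span" if S: "card S = m" "S \<subseteq> {..<n + m - 4}" for S
  proof (cases "m \<le> 3")
    case True
    then show ?thesis using S by (intro basis_span_basis) (auto simp: basis_sets_def)
  next
    case False
    then have m: "m = 4" using less.prems by (simp add: m_def)
    have S': "S \<subseteq> {..<n}" "card S = 4" using S m by auto
    obtain V g where V: "V \<noteq> 0" "\<And>K. g K \<in> B"
        "Const V * ymon S - (\<Sum>K\<in>Pow S - {S}. subst (g K) * ymon K) \<in> I"
      using minors4[OF S'] by blast
    have finS: "finite S" using S' finite_subset by blast
    have "ymon K \<in> basis_span" if K: "K \<in> Pow S - {S}" for K
    proof -
      have finK: "finite K" using K finS finite_subset by blast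
      have "card K < 4" using K S'(2) psubset_card_mono[OF finS, of K] by auto
      then show ?thesis
        unfolding ymon_yprod[OF finK] using K S' finK m
        by (intro less.hyps) (auto simp: m_def[symmetric])
    qed
    then have "(\<Sum>K\<in>Pow S - {S}. subst (g K) * ymon K) \<in> basis_span" using V(2) by (intro basis_span_sum basis_span_subst) auto
    then have "(Const V * ymon S - (\<Sum>K\<in>Pow S - {S}. subst (g K) * ymon K)) + (\<Sum>K\<in>Pow S - {S}. subst (g K) * ymon K) \<in> basis_span"
      by (intro basis_span_add[OF basis_span_I[OF V(3)]])
    then have "Const (1 / V) * (Const V * ymon S) \<in> basis_span" by (intro basis_span_Const[where f = "Const V * ymon S"]) simp
    then show ?thesis using V(1) by (simp add: mult.assoc[symmetric] Const_mult[symmetric])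
  qed
  have "f \<in> basis_span" if "f \<in> yspan m" for f
    using that
  proof (induction rule: yspan.induct)
    case (low js' b)
    then show ?case using less.hyps[of js'] less.prems by (intro basis_span_subst) (auto simp: m_def)
  qed (auto intro: basis_span_0 basis_span_add basis_span_Const top)
  moreover have "yprod js \<in> yspan m" using less.prems by (intro yprod_yspan) (auto simp: m_def)
  ultimately show ?case by blast
qed

lemma basis_span_y: "j < n \<Longrightarrow> f \<in> basis_span \<Longrightarrow> Var (0, j) * f \<in> basis_span"
proof -
  assume j: "j < n" and "f \<in> basis_span"
  then obtain b where b: "\<And>S. b S \<in> B" "f - (\<Sum>S\<in>basis_sets n. subst (b S) * ymon S) \<in> I"
    by (auto simp: basis_span_def)
  have "Var (0, j) * ymon S \<in> basis_span" if S: "S \<in> basis_sets n" for S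
  proof -
    have finS: "finite S" using basis_sets_sub[OF S] finite_subset by blast
    have "yprod (j # sorted_list_of_set S) \<in> basis_span"
      using j S basis_sets_sub[OF S] finS by (intro yprod_basis_span) (auto simp: basis_sets_def)
    then show ?thesis using finS by (simp add: ymon_yprod yprod_def)
  qed
  then have "(\<Sum>S\<in>basis_sets n. subst (b S) * (Var (0, j) * ymon S)) \<in> basis_span"
    using b(1) by (intro basis_span_sum basis_span_subst)
  moreover have "Var (0, j) * (f - (\<Sum>S\<in>basis_sets n. subst (b S) * ymon S)) \<in> basis_span"
    using b(2) j by (intro basis_span_I I_mult y_in_R)
  ultimately have "(\<Sum>S\<in>basis_sets n. subst (b S) * (Var (0, j) * ymon S))
      + Var (0, j) * (f - (\<Sum>S\<in>basis_sets n. subst (b S) * ymon S)) \<in> basis_span" by (rule basis_span_add)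
  then show ?thesis by (simp add: right_diff_distrib sum_distrib_left mult_ac)
qed

lemma basis_span_mult: "p \<in> R \<Longrightarrow> f \<in> basis_span \<Longrightarrow> p * f \<in> basis_span"
proof (induction arbitrary: f rule: polys_induct)
  case (Var ij)
  then consider j where "ij = (0, j)" "j < n" | j where "ij = (1, j)" "j < n"
    by (cases ij) (auto simp: less_2_cases_iff)
  then show ?case
  proof cases
    case (2 j)
    \<comment> \<open>z_j is theta_j + a_j^2 y_j, so multiplication by z_j reduces to a parameter
      and to y_j.\<close>
    have "subst (Var j) * f + Const (a j ^ 2) * (Var (0, j) * f) \<in> basis_span"
      using 2 Var(2) by (intro basis_span_add basis_span_subst basis_span_Const basis_span_y) auto
    then show ?thesis using 2 by (simp add: param_def algebra_simps)
  qed (use Var basis_span_y in auto)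
qed (auto simp: ring_distribs mult.assoc intro: basis_span_Const basis_span_add)

theorem spanning: "p \<in> R \<Longrightarrow> \<exists>b. (\<forall>S. b S \<in> B) \<and> p - (\<Sum>S\<in>basis_sets n. subst (b S) * ymon S) \<in> I"
proof -
  assume p: "p \<in> R"
  have "1 \<in> basis_span" using basis_span_basis[of "{}"] by (simp add: basis_sets_def ymon_def)
  then have "p * 1 \<in> basis_span" using p by (intro basis_span_mult)
  then show ?thesis by (simp add: basis_span_def)
qed

end


section \<open>Independence on the orbit\<close>

text \<open>Being polynomial is a property of functions here, so that curves can be written as plain
  terms and their limits at 0 are values.\<close>

definition polyfun :: "('k::comm_ring_1 \<Rightarrow> 'k) \<Rightarrow> bool" where
  "polyfun f \<longleftrightarrow> (\<exists>P. \<forall>s. f s = poly P s)"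

lemma polyfun_const: "polyfun (\<lambda>_. c)"
  unfolding polyfun_def by (intro exI[of _ "[:c:]"]) simp

lemma polyfun_id: "polyfun (\<lambda>s. s)"
  unfolding polyfun_def by (intro exI[of _ "[:0, 1:]"]) simp

lemma polyfun_add: "polyfun f \<Longrightarrow> polyfun g \<Longrightarrow> polyfun (\<lambda>s. f s + g s)"
  unfolding polyfun_def by (metis poly_add)

lemma polyfun_mult: "polyfun f \<Longrightarrow> polyfun g \<Longrightarrow> polyfun (\<lambda>s. f s * g s)"
  unfolding polyfun_def by (metis poly_mult)

lemma polyfun_diff: "polyfun f \<Longrightarrow> polyfun g \<Longrightarrow> polyfun (\<lambda>s. f s - g s)"
  unfolding polyfun_def by (metis poly_diff)

lemma polyfun_minus: "polyfun f \<Longrightarrow> polyfun (\<lambda>s. - f s)"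
  unfolding polyfun_def by (metis poly_minus)

lemma polyfun_power: "polyfun f \<Longrightarrow> polyfun (\<lambda>s. f s ^ k)"
  unfolding polyfun_def by (metis poly_power)

lemma polyfun_sum: "(\<And>i. i \<in> I \<Longrightarrow> polyfun (f i)) \<Longrightarrow> polyfun (\<lambda>s. \<Sum>i\<in>I. f i s)"
  by (induction I rule: infinite_finite_induct) (auto intro: polyfun_const polyfun_add)

lemma polyfun_prod: "(\<And>i. i \<in> I \<Longrightarrow> polyfun (f i)) \<Longrightarrow> polyfun (\<lambda>s. \<Prod>i\<in>I. f i s)"
  by (induction I rule: infinite_finite_induct) (auto intro: polyfun_const polyfun_mult)

lemmas polyfun_intros = polyfun_const polyfun_id polyfun_add polyfun_mult polyfun_diff polyfun_minus
  polyfun_power polyfun_sum polyfun_prod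

text \<open>An algebraic passage to the limit: \<open>f s * D s * s\<close> vanishes identically and
  neither \<open>D\<close> nor the identity is the zero polynomial. In the application
  \<open>D\<close> is the determinant that keeps the curve inside the orbit.\<close>

lemma polyfun_zero_at_0:
  fixes f :: "'k::field_char_0 \<Rightarrow> 'k"
  assumes "polyfun f" "polyfun D" "D 0 \<noteq> 0" "\<And>s. s \<noteq> 0 \<Longrightarrow> D s \<noteq> 0 \<Longrightarrow> f s = 0"
  shows "f 0 = 0"
proof -
  obtain P Q where P: "\<And>s. f s = poly P s" and Q: "\<And>s. D s = poly Q s"
    using assms(1,2) unfolding polyfun_def by blast
  have "poly (P * (Q * [:0, 1:])) s = 0" for s using assms(4)[of s] by (auto simp: P Q)
  then have "P * (Q * [:0, 1:]) = 0" using poly_all_0_iff_0 by blast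
  moreover have "Q \<noteq> 0" using assms(3) Q by auto
  ultimately show ?thesis by (auto simp: P)
qed

text \<open>\<open>L u v w\<close> applies the functional with moments \<open>h0\<close>,
  \<open>h1\<close>, \<open>h2\<close> to the Lagrange polynomial that is 1 at \<open>u\<close> and
  0 at \<open>v\<close> and \<open>w\<close>; the three values are the weights at three points that
  reproduce these moments.\<close>

lemma lagrange_moments:
  fixes x y z h0 h1 h2 :: "'k::field"
  assumes ne: "x \<noteq> y" "x \<noteq> z" "y \<noteq> z"
  defines "L u v w \<equiv> (h2 - (v + w) * h1 + v * w * h0) / ((u - v) * (u - w))"
  shows "L x y z + L y x z + L z x y = h0"
    and "x * L x y z + y * L y x z + z * L z x y = h1"
    and "x ^ 2 * L x y z + y ^ 2 * L y x z + z ^ 2 * L z x y = h2"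
proof -
  \<comment> \<open>The Vandermonde determinant serves as common denominator of the three weights,
    which turns each claim into a polynomial identity.\<close>
  define d where "d = (x - y) * (x - z) * (y - z)"
  define M where "M v w = h2 - (v + w) * h1 + v * w * h0" for v w
  have d: "d \<noteq> 0" using ne by (simp add: d_def)
  have "L x y z = M y z * (y - z) / d"
    using ne by (simp add: L_def M_def d_def)
  moreover have "d = (y - x) * (y - z) * (z - x)" by (simp add: d_def algebra_simps)
  then have "L y x z = M x z * (z - x) / d"
    using ne by (simp add: L_def M_def)
  moreover have "d = (z - x) * (z - y) * (x - y)" by (simp add: d_def algebra_simps)
  then have "L z x y = M x y * (x - y) / d"
    using ne by (simp add: L_def M_def)
  ultimately have *: "u * L x y z + v * L y x z + w * L z x y = c"
    if "u * (M y z * (y - z)) + v * (M x z * (z - x)) + w * (M x y * (x - y)) = c * d" for u v w c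
    using that d by (simp add: add_divide_distrib[symmetric])
  show "L x y z + L y x z + L z x y = h0"
    using *[of 1 1 1 h0] by (simp add: M_def d_def algebra_simps)
  show "x * L x y z + y * L y x z + z * L z x y = h1"
    by (rule *) (simp add: M_def d_def algebra_simps)
  show "x ^ 2 * L x y z + y ^ 2 * L y x z + z ^ 2 * L z x y = h2"
    by (rule *) (simp add: M_def d_def power2_eq_square algebra_simps)
qed

text \<open>A set \<open>S\<close> of the basis family is completed by the last \<open>3 - |S|\<close> indices; every member of
  the family inside this completion lies already in \<open>S\<close>, so the system is triangular.\<close>

lemma triangular_system:
  fixes c :: "nat set \<Rightarrow> 'k::field"
  assumes n3: "3 \<le> n"
    and eq: "\<And>T. T \<subseteq> {..<n} \<Longrightarrow> card T = 3 \<Longrightarrow> (\<Sum>S\<in>basis_sets n. c S * (\<Prod>j\<in>S. y T j)) = 0"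
    and y: "\<And>T j. T \<subseteq> {..<n} \<Longrightarrow> card T = 3 \<Longrightarrow> j < n \<Longrightarrow> y T j = 0 \<longleftrightarrow> j \<notin> T"
    and S: "S \<in> basis_sets n"
  shows "c S = 0"
  using S
proof (induction "card S" arbitrary: S rule: less_induct)
  case less
  define m where "m = card S"
  have S: "m \<le> 3" "S \<subseteq> {..<n + m - 4}" using less.prems by (auto simp: basis_sets_def m_def)
  have finS: "finite S" using S finite_subset by blast
  define T where "T = S \<union> {n + m - 3..<n}"
  have dis: "S \<inter> {n + m - 3..<n} = {}" using S by fastforce
  have cT: "card T = 3" unfolding T_def using dis finS S n3 by (simp add: card_Un_disjoint m_def[symmetric])
  have T: "T \<subseteq> {..<n}" unfolding T_def using S n3 by fastforce
  have sub: "S' \<subseteq> S" if S': "S' \<in> basis_sets n" "S' \<subseteq> T" for S'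
  proof -
    define m' where "m' = card S'"
    have m': "m' \<le> 3" "S' \<subseteq> {..<n + m' - 4}" using S' by (auto simp: basis_sets_def m'_def)
    show ?thesis
    proof (cases "m' \<le> m")
      case True
      then have "S' \<inter> {n + m - 3..<n} = {}" using m' by fastforce
      then show ?thesis using S'(2) by (auto simp: T_def)
    next
      case False
      \<comment> \<open>The interval has only \<open>m' - m - 1\<close> elements, so a larger
        \<open>S'\<close> would be one element short; this case is contradictory.\<close>
      have "S' \<subseteq> S \<union> {n + m - 3..<n + m' - 4}"
      proof
        fix i assume "i \<in> S'"
        then have "i \<in> T" "i < n + m' - 4" using S'(2) m'(2) by auto
        then show "i \<in> S \<union> {n + m - 3..<n + m' - 4}" by (auto simp: T_def)
      qed
      then have "m' \<le> card (S \<union> {n + m - 3..<n + m' - 4})"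
        unfolding m'_def using finS by (intro card_mono) auto
      also have "\<dots> \<le> m + (m' - m - 1)"
        using card_Un_le[of S "{n + m - 3..<n + m' - 4}"] False n3 by (simp add: m_def)
      finally show ?thesis using False by simp
    qed
  qed
  have fam: "S' \<subseteq> {..<n}" if "S' \<in> basis_sets n" for S' using that by (fastforce simp: basis_sets_def)
  have "c S' * (\<Prod>j\<in>S'. y T j) = 0" if S': "S' \<in> basis_sets n - {S}" for S'
  proof (cases "S' \<subseteq> T")
    case True
    then have "S' \<subset> S" using sub S' by blast
    then have "c S' = 0" using less.hyps[of S'] S' psubset_card_mono[OF finS] by auto
    then show ?thesis by simp
  next
    case False
    then obtain j where "j \<in> S'" "j \<notin> T" by blast
    moreover have "finite S'" using fam S' finite_subset by blast
    moreover have "j < n" using fam S' \<open>j \<in> S'\<close> by blast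
    ultimately have "(\<Prod>j\<in>S'. y T j) = 0" using y[OF T cT] by (intro prod_zero) auto
    then show ?thesis by simp
  qed
  then have "(\<Sum>S'\<in>basis_sets n - {S}. c S' * (\<Prod>j\<in>S'. y T j)) = 0"
    by (intro sum.neutral) blast
  then have "c S * (\<Prod>j\<in>S. y T j) = 0"
    using eq[OF T cT] sum.remove[OF finite_basis_sets less.prems, of "\<lambda>S'. c S' * (\<Prod>j\<in>S'. y T j)"]
    by simp
  moreover have "(\<Prod>j\<in>S. y T j) \<noteq> 0"
    using finS T y[OF T cT] by (auto simp: T_def)
  ultimately show ?case by simp
qed

context moment_points
begin

text \<open>The orbit of the normalized matrix with columns (1, a_j): its two rows are linear
  polynomials evaluated at the a_j, up to scaling of columns.\<close>

definition in_orbit :: "(nat \<times> nat \<Rightarrow> 'k) \<Rightarrow> bool" where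
  "in_orbit x \<longleftrightarrow> (\<exists>t p0 p1 q0 q1. p0 * q1 - p1 * q0 \<noteq> 0 \<and> (\<forall>j<n. t j \<noteq> 0) \<and>
     (\<forall>j<n. x (0, j) = t j * (p0 + p1 * a j) \<and> x (1, j) = t j * (q0 + q1 * a j)))"

lemma ev_param:
  "ev id x (param n a i) = (if i < n then x (1, i) - a i ^ 2 * x (0, i) else (\<Sum>j<n. a j ^ (i - n) * x (0, j)))"
  by (simp add: param_def EI.E.hom_minus EI.ev_mult EI.ev_sum0)

lemma ev_ymon: "ev id x (ymon S) = (\<Prod>j\<in>S. x (0, j))"
  by (simp add: ymon_def EI.E.hom_prod)

text \<open>The eta are left out of the count: on the degenerating curves only the theta are made to
  vanish.\<close>

definition theta_degree :: "(nat \<Rightarrow>\<^sub>0 nat) \<Rightarrow> nat" where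
  "theta_degree m = (\<Sum>i<n. Poly_Mapping.lookup m i)"

definition theta_part :: "nat \<Rightarrow> ((nat \<Rightarrow>\<^sub>0 nat) \<Rightarrow>\<^sub>0 'k) \<Rightarrow> ((nat \<Rightarrow>\<^sub>0 nat) \<Rightarrow>\<^sub>0 'k)" where
  "theta_part k b = (\<Sum>m\<in>{m \<in> Poly_Mapping.keys b. theta_degree m = k}. Poly_Mapping.single m (Poly_Mapping.lookup b m))"

lemma mon_theta_scale:
  fixes x :: "nat \<Rightarrow> 'k"
  assumes "Poly_Mapping.keys m \<subseteq> {..<n + 3}"
  shows "mon (\<lambda>i. if i < n then s * x i else x i) m = s ^ theta_degree m * mon x m"
proof -
  have M: "mon f m = (\<Prod>i<n + 3. f i ^ Poly_Mapping.lookup m i)" for f :: "nat \<Rightarrow> 'k"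
    by (rule mon_superset) (use assms in auto)
  have "mon (\<lambda>i. if i < n then s * x i else x i) m
      = (\<Prod>i<n + 3. (if i < n then s ^ Poly_Mapping.lookup m i else 1) * x i ^ Poly_Mapping.lookup m i)"
    unfolding M by (intro prod.cong) (auto simp: power_mult_distrib)
  also have "\<dots> = (\<Prod>i<n + 3. if i < n then s ^ Poly_Mapping.lookup m i else 1) * mon x m"
    unfolding M by (simp add: prod.distrib)
  also have "(\<Prod>i<n + 3. if i < n then s ^ Poly_Mapping.lookup m i else 1) = (\<Prod>i<n. s ^ Poly_Mapping.lookup m i)"
    by (rule prod.mono_neutral_cong_right) auto
  also have "\<dots> = s ^ theta_degree m" by (simp add: theta_degree_def power_sum)
  finally show ?thesis .
qed

text \<open>Along a curve in the orbit on which the first \<open>n\<close> parameters vanish to first order at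
  \<open>s = 0\<close>, only the lowest-order part of the coefficients survives in the limit.\<close>

lemma leading_part_on_curve:
  assumes b: "\<And>S. S \<in> basis_sets n \<Longrightarrow> b S \<in> B"
    and low: "\<And>S m. S \<in> basis_sets n \<Longrightarrow> m \<in> Poly_Mapping.keys (b S) \<Longrightarrow> k \<le> theta_degree m"
    and van: "\<And>x. in_orbit x \<Longrightarrow> ev id x (\<Sum>S\<in>basis_sets n. subst (b S) * ymon S) = 0"
    and x: "\<And>ij. polyfun (\<lambda>s. x s ij)" "\<And>i. polyfun (\<lambda>s. X s i)"
    and X: "\<And>s i. i < n \<Longrightarrow> ev id (x s) (param n a i) = s * X s i"
      "\<And>s i. n \<le> i \<Longrightarrow> i < n + 3 \<Longrightarrow> ev id (x s) (param n a i) = X s i"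
    and D: "polyfun D" "D 0 \<noteq> 0" "\<And>s. s \<noteq> 0 \<Longrightarrow> D s \<noteq> 0 \<Longrightarrow> in_orbit (x s)"
  shows "(\<Sum>S\<in>basis_sets n. ev id (X 0) (theta_part k (b S)) * (\<Prod>j\<in>S. x 0 (0, j))) = 0"
proof -
  \<comment> \<open>The coefficient along the curve with \<open>s ^ k\<close> divided out; it
    remains polynomial in \<open>s\<close> because \<open>k\<close> is at most every theta-degree
    that occurs.\<close>
  define \<Phi> where "\<Phi> S s = (\<Sum>m\<in>Poly_Mapping.keys (b S).
      Poly_Mapping.lookup (b S) m * s ^ (theta_degree m - k) * mon (X s) m)" for S s
  define F where "F s = (\<Sum>S\<in>basis_sets n. \<Phi> S s * (\<Prod>j\<in>S. x s (0, j)))" for s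
  have eq: "s ^ k * F s = ev id (x s) (\<Sum>S\<in>basis_sets n. subst (b S) * ymon S)" for s
  proof -
    have "ev id (x s) (subst (b S)) = s ^ k * \<Phi> S s" if S: "S \<in> basis_sets n" for S
    proof -
      have "ev id (x s) (subst (b S)) = ev id (\<lambda>i. ev id (x s) (param n a i)) (b S)" by (rule EI.ev_ev)
      also have "\<dots> = ev id (\<lambda>i. if i < n then s * X s i else X s i) (b S)"
        by (rule EI.ev_cong[OF b[OF S]]) (auto simp: X)
      also have "\<dots> = (\<Sum>m\<in>Poly_Mapping.keys (b S). Poly_Mapping.lookup (b S) m * (s ^ theta_degree m * mon (X s) m))"
        unfolding ev_def using b[OF S] by (intro sum.cong refl) (auto simp: mon_theta_scale polys_in_def)
      also have "\<dots> = (\<Sum>m\<in>Poly_Mapping.keys (b S). s ^ k * (Poly_Mapping.lookup (b S) m * s ^ (theta_degree m - k) * mon (X s) m))"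
      proof (intro sum.cong refl)
        fix m assume "m \<in> Poly_Mapping.keys (b S)"
        then have "s ^ theta_degree m = s ^ k * s ^ (theta_degree m - k)"
          using low[OF S] by (simp add: power_add[symmetric])
        then show "Poly_Mapping.lookup (b S) m * (s ^ theta_degree m * mon (X s) m)
            = s ^ k * (Poly_Mapping.lookup (b S) m * s ^ (theta_degree m - k) * mon (X s) m)" by simp
      qed
      finally show ?thesis by (simp add: \<Phi>_def sum_distrib_left)
    qed
    then show ?thesis by (simp add: F_def EI.ev_sum0 EI.ev_mult ev_ymon sum_distrib_left mult.assoc)
  qed
  have "F 0 = 0"
  proof (rule polyfun_zero_at_0[OF _ D(1,2)])
    show "polyfun F" unfolding F_def \<Phi>_def mon_def by (intro polyfun_intros x)
    fix s assume "s \<noteq> 0" "D s \<noteq> 0"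
    then show "F s = 0" using eq[of s] van[OF D(3)] by simp
  qed
  moreover have "\<Phi> S 0
      = ev id (X 0) (theta_part k (b S))" if S: "S \<in> basis_sets n" for S
  proof -
    have "\<Phi> S 0
        = (\<Sum>m\<in>Poly_Mapping.keys (b S). if theta_degree m = k then Poly_Mapping.lookup (b S) m * mon (X 0) m else 0)"
      unfolding \<Phi>_def
    proof (intro sum.cong refl)
      fix m assume "m \<in> Poly_Mapping.keys (b S)"
      then have "k \<le> theta_degree m" using low[OF S] by blast
      \<comment> \<open>The bound matters because of truncated subtraction: with it, exponent 0
        occurs exactly for theta-degree \<open>k\<close>.\<close>
      then have "0 ^ (theta_degree m - k) = (if theta_degree m = k then 1 else (0::'k))"
        by (simp add: zero_power)
      then show "Poly_Mapping.lookup (b S) m * 0 ^ (theta_degree m - k) * mon (X 0) m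
          = (if theta_degree m = k then Poly_Mapping.lookup (b S) m * mon (X 0) m else 0)" by simp
    qed
    also have "\<dots> = (\<Sum>m\<in>{m \<in> Poly_Mapping.keys (b S). theta_degree m = k}. Poly_Mapping.lookup (b S) m * mon (X 0) m)"
      by (rule sum.inter_filter[symmetric]) simp
    finally show ?thesis by (simp add: theta_part_def EI.ev_sum0)
  qed
  ultimately show ?thesis by (simp add: F_def)
qed

definition lagrange_coeff :: "(nat \<Rightarrow> 'k) \<Rightarrow> nat \<Rightarrow> nat \<Rightarrow> nat \<Rightarrow> 'k" where
  "lagrange_coeff H j p q = (H (n + 2) - (a p + a q) * H (n + 1) + a p * a q * H n) / ((a j - a p) * (a j - a q))"

text \<open>The nonvanishing that the curves need, for all 3-sets at once: \<open>H j\<close> enters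
  the column scalars outside the 3-set, and the Lagrange weights become the coordinates y_j inside
  it.\<close>

definition generic :: "(nat \<Rightarrow> 'k) \<Rightarrow> bool" where
  "generic H \<longleftrightarrow> (\<forall>j<n. H j \<noteq> 0) \<and>
     (\<forall>j<n. \<forall>p<n. \<forall>q<n. j \<noteq> p \<longrightarrow> j \<noteq> q \<longrightarrow> p \<noteq> q \<longrightarrow> lagrange_coeff H j p q \<noteq> 0)"

text \<open>With \<open>c(x) = \<Prod>\<^sub>T (x - a\<^sub>j) + s \<gamma>(x)\<close> and \<open>c = q - x\<^sup>2 p\<close>, the point
  \<open>x\<^sub>j = t\<^sub>j (p(a\<^sub>j), q(a\<^sub>j))\<close> of the orbit has parameters \<open>t\<^sub>j c(a\<^sub>j)\<close>; the scalars \<open>t\<^sub>j\<close> and the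
  quadratic polynomial \<open>\<gamma>\<close> are chosen to prescribe the limit of the parameters at \<open>s = 0\<close>.\<close>

lemma curve_exists:
  assumes H: "generic H" and T: "T \<subseteq> {..<n}" "card T = 3"
  obtains x X D y where "\<And>ij. polyfun (\<lambda>s. x s ij)" "\<And>i. polyfun (\<lambda>s. X s i)"
    "\<And>s i. i < n \<Longrightarrow> ev id (x s) (param n a i) = s * X s i"
    "\<And>s i. n \<le> i \<Longrightarrow> i < n + 3 \<Longrightarrow> ev id (x s) (param n a i) = X s i"
    "polyfun D" "D 0 \<noteq> 0" "\<And>s. s \<noteq> 0 \<Longrightarrow> D s \<noteq> 0 \<Longrightarrow> in_orbit (x s)"
    "\<And>i. i < n + 3 \<Longrightarrow> X 0 i = H i" "\<And>j. j < n \<Longrightarrow> x 0 (0, j) = y j"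
    "\<And>j. j < n \<Longrightarrow> y j = 0 \<longleftrightarrow> j \<notin> T"
proof -
  obtain t0 t1 t2 where Teq: "T = {t0, t1, t2}" and dist: "t0 \<noteq> t1" "t0 \<noteq> t2" "t1 \<noteq> t2"
    using T(2) by (auto simp: card_3_iff)
  have tn: "t0 < n" "t1 < n" "t2 < n" using T(1) Teq by auto
  define A0 A1 A2 where "A0 = a t0" and "A1 = a t1" and "A2 = a t2"
  have ne: "A0 \<noteq> A1" "A0 \<noteq> A2" "A1 \<noteq> A2" using a_inj tn dist by (auto simp: A0_def A1_def A2_def)
  have su: "A0 + A1 \<noteq> 0" "A0 + A2 \<noteq> 0" "A1 + A2 \<noteq> 0" using a_sum tn dist by (auto simp: A0_def A1_def A2_def)
  define s1 s2 s3 where "s1 = A0 + A1 + A2" and "s2 = A0 * A1 + A0 * A2 + A1 * A2" and "s3 = A0 * A1 * A2"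
  \<comment> \<open>Weights on \<open>T\<close> whose moments of orders 0, 1, 2 are
    \<open>H n\<close>, \<open>H (n + 1)\<close>, \<open>H (n + 2)\<close>, so that the limit point
    has the prescribed eta.\<close>
  define y where "y j = (if j = t0 then lagrange_coeff H t0 t1 t2 else if j = t1 then lagrange_coeff H t1 t0 t2
      else if j = t2 then lagrange_coeff H t2 t0 t1 else 0)" for j
  have y0: "y j = 0 \<longleftrightarrow> j \<notin> T" if "j < n" for j
    using H tn dist unfolding generic_def y_def Teq by auto
  define cT where "cT z = (z - A0) * (z - A1) * (z - A2)" for z
  have cT0: "cT (a j) \<noteq> 0" if "j < n" "j \<notin> T" for j
    using a_inj[OF that(1)] that tn unfolding cT_def Teq A0_def A1_def A2_def by auto
  \<comment> \<open>Comparing z^3 - s1 z^2 + s2 z - s3 with q - z^2 p gives p = s1 - z. At one root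
    this is the sum of the other two, which is nonzero by \<open>a_sum\<close>.\<close>
  define p where "p z = s1 - z" for z
  have pT: "p (a j) \<noteq> 0" if "j \<in> T" for j
    using that su unfolding Teq p_def s1_def A0_def A1_def A2_def by (auto simp: add.commute)
  \<comment> \<open>On \<open>T\<close> the scalar is dictated by the limit of y_j, outside
    \<open>T\<close> by the limit of theta_j / s.\<close>
  define \<tau> where "\<tau> j = (if j \<in> T then y j / p (a j) else H j / cT (a j))" for j
  have \<tau>0: "\<tau> j \<noteq> 0" if "j < n" for j
    using that y0[OF that] pT cT0 H by (auto simp: \<tau>_def generic_def)
  \<comment> \<open>The cubic vanishes on \<open>T\<close>, so theta_j / s equals \<tau>_j
    \<gamma>(a_j) there; \<gamma> is the Lagrange interpolation that makes this value H_j.\<close>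
  define G0 G1 G2 where "G0 = H t0 / \<tau> t0" and "G1 = H t1 / \<tau> t1" and "G2 = H t2 / \<tau> t2"
  define e0 e1 e2 where "e0 = G0 / ((A0 - A1) * (A0 - A2))" and "e1 = G1 / ((A1 - A0) * (A1 - A2))"
    and "e2 = G2 / ((A2 - A0) * (A2 - A1))"
  define g0 g1 g2 where "g0 = e0 * A1 * A2 + e1 * A0 * A2 + e2 * A0 * A1"
    and "g1 = - e0 * (A1 + A2) - e1 * (A0 + A2) - e2 * (A0 + A1)" and "g2 = e0 + e1 + e2"
  define \<gamma> where "\<gamma> z = g0 + g1 * z + g2 * z ^ 2" for z
  have \<gamma>': "\<gamma> z = e0 * ((z - A1) * (z - A2)) + e1 * ((z - A0) * (z - A2)) + e2 * ((z - A0) * (z - A1))" for z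
    by (simp add: \<gamma>_def g0_def g1_def g2_def power2_eq_square algebra_simps)
  have \<gamma>T: "\<tau> j * \<gamma> (a j) = H j" if "j \<in> T" for j
  proof -
    have "\<gamma> A0 = G0" "\<gamma> A1 = G1" "\<gamma> A2 = G2"
      unfolding \<gamma>' e0_def e1_def e2_def using ne by simp_all
    then show ?thesis
      using that \<tau>0 tn unfolding Teq G0_def G1_def G2_def A0_def A1_def A2_def by auto
  qed
  \<comment> \<open>Outside \<open>T\<close> the factor \<open>s\<close> sends the whole column to
    0, so that the limit is supported on \<open>T\<close>.\<close>
  define t where "t s j = (if j \<in> T then \<tau> j else s * \<tau> j)" for s j
  \<comment> \<open>The cubic plus \<open>s\<close> times \<gamma> is split as Q - z^2 P: the
    coefficients in degrees 2 and 3 go to P, those in degrees 0 and 1 to Q.\<close>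
  define P Q where "P s z = (s1 - s * g2) - z" and "Q s z = (s * g0 - s3) + (s2 + s * g1) * z" for s z
  have PQ: "Q s z - z ^ 2 * P s z = cT z + s * \<gamma> z" for s z
    by (simp add: P_def Q_def cT_def \<gamma>_def s1_def s2_def s3_def power2_eq_square algebra_simps)
  define x where "x s ij = t s (snd ij) * (if fst ij = 0 then P s (a (snd ij)) else Q s (a (snd ij)))" for s and ij :: "nat \<times> nat"
  define X where "X s i = (if i < n then (if i \<in> T then H i else \<tau> i * (cT (a i) + s * \<gamma> (a i)))
      else (\<Sum>j<n. a j ^ (i - n) * x s (0, j)))" for s i
  \<comment> \<open>The determinant p0 q1 - p1 q0 with p1 = -1. At s = 0 it is s1 s2 - s3, the
    product of the three sums of two roots.\<close>
  define D where "D s = (s1 - s * g2) * (s2 + s * g1) + (s * g0 - s3)" for s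
  have x0: "x 0 (0, j) = y j" if "j < n" for j
    using that pT y0[OF that] by (auto simp: x_def t_def P_def p_def \<tau>_def)
  have pfx: "polyfun (\<lambda>s. x s ij)" for ij
    unfolding x_def t_def P_def Q_def by (cases "snd ij \<in> T"; cases "fst ij = 0") (simp_all, (intro polyfun_intros)+)
  have pfX: "polyfun (\<lambda>s. X s i)" for i
    unfolding X_def by (cases "i < n"; cases "i \<in> T") (simp_all, (intro polyfun_intros pfx)+)
  have par: "ev id (x s) (param n a i) = s * X s i" if i: "i < n" for s i
  proof -
    have "ev id (x s) (param n a i) = t s i * (Q s (a i) - a i ^ 2 * P s (a i))"
      using i by (simp add: ev_param x_def algebra_simps)
    also have "\<dots> = t s i * (cT (a i) + s * \<gamma> (a i))" by (simp add: PQ)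
    also have "\<dots> = s * X s i"
    proof (cases "i \<in> T")
      case True
      then have "cT (a i) = 0" by (auto simp: Teq cT_def A0_def A1_def A2_def)
      then show ?thesis using True i \<gamma>T[OF True] by (simp add: t_def X_def mult.left_commute)
    qed (use i in \<open>simp add: t_def X_def mult_ac\<close>)
    finally show ?thesis .
  qed
  have par': "ev id (x s) (param n a i) = X s i" if i: "n \<le> i" for s i
    using i by (simp add: ev_param X_def)
  have pfD: "polyfun D" unfolding D_def by (intro polyfun_intros)
  have D0: "D 0 \<noteq> 0"
  proof -
    have "D 0 = (A0 + A1) * (A0 + A2) * (A1 + A2)"
      by (simp add: D_def s1_def s2_def s3_def algebra_simps)
    then show ?thesis using su by simp
  qed
  have orb: "in_orbit (x s)" if s: "s \<noteq> 0" "D s \<noteq> 0" for s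
    unfolding in_orbit_def
  proof (intro exI conjI)
    have "(s1 - s * g2) * (s2 + s * g1) - (- 1) * (s * g0 - s3) = D s" by (simp add: D_def)
    then show "(s1 - s * g2) * (s2 + s * g1) - (- 1) * (s * g0 - s3) \<noteq> 0" using s(2) by (simp only:) simp
    show "\<forall>j<n. t s j \<noteq> 0" using s(1) \<tau>0 by (simp add: t_def)
    show "\<forall>j<n. x s (0, j) = t s j * ((s1 - s * g2) + (- 1) * a j) \<and> x s (1, j) = t s j * ((s * g0 - s3) + (s2 + s * g1) * a j)"
      by (simp add: x_def P_def Q_def)
  qed
  have X0: "X 0 i = H i" if i: "i < n + 3" for i
  proof (cases "i < n")
    case True
    then show ?thesis using cT0[OF True] by (auto simp: X_def \<tau>_def)
  next
    case False
    then obtain l where l: "i = n + l" "l < 3" using i by (metis add_less_cancel_left le_add_diff_inverse not_less)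
    have "X 0 i = (\<Sum>j<n. a j ^ l * y j)" using False l x0 by (simp add: X_def)
    also have "\<dots> = (\<Sum>j\<in>T. a j ^ l * y j)"
      using T y0 by (intro sum.mono_neutral_right) auto
    also have "\<dots> = A0 ^ l * lagrange_coeff H t0 t1 t2 + A1 ^ l * lagrange_coeff H t1 t0 t2 + A2 ^ l * lagrange_coeff H t2 t0 t1"
      using dist by (simp add: Teq y_def A0_def A1_def A2_def)
    also have "\<dots> = H (n + l)"
    proof -
      consider "l = 0" | "l = 1" | "l = 2" using l by linarith
      then show ?thesis
        unfolding lagrange_coeff_def A0_def[symmetric] A1_def[symmetric] A2_def[symmetric]
        by cases (use lagrange_moments[OF ne, of "H (n + 2)" "H (n + 1)" "H n"] in simp_all)
    qed
    finally show ?thesis by (simp add: l)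
  qed
  show thesis
    by (rule that[of x X D y]) (fact pfx pfX par pfD D0 orb X0 x0 y0 | erule par')+
qed

text \<open>Genericity follows from the nonvanishing of one product of nonzero linear forms, which
  lets \<open>poly_zero_if_vanishing_generic\<close> discard the bad \<open>H\<close>.\<close>

lemma generic_poly:
  "\<exists>N::(nat \<Rightarrow>\<^sub>0 nat) \<Rightarrow>\<^sub>0 'k. N \<noteq> 0 \<and> (\<forall>H. ev id H N \<noteq> 0 \<longrightarrow> generic H)"
proof -
  define I where "I = {(j, p, q). j < n \<and> p < n \<and> q < n \<and> j \<noteq> p \<and> j \<noteq> q \<and> p \<noteq> q}"
  have "I \<subseteq> {..<n} \<times> {..<n} \<times> {..<n}" by (auto simp: I_def)
  then have finI: "finite I" by (rule finite_subset) auto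
  define l :: "nat \<times> nat \<times> nat \<Rightarrow> (nat \<Rightarrow>\<^sub>0 nat) \<Rightarrow>\<^sub>0 'k" where
    "l = (\<lambda>(j, p, q). Var (n + 2) - Const (a p + a q) * Var (n + 1) + Const (a p * a q) * Var n)"
  define N where "N = (\<Prod>j<n. Var j) * (\<Prod>i\<in>I. l i)"
  have evl: "ev id H (l (j, p, q)) = H (n + 2) - (a p + a q) * H (n + 1) + a p * a q * H n" for H j p q
    by (simp add: l_def EI.ev_add EI.ev_mult EI.E.hom_minus)
  have "l i \<noteq> 0" for i
  proof -
    obtain j p q where i: "i = (j, p, q)" by (cases i)
    have "ev id (\<lambda>k. if k = n + 2 then 1 else 0) (l i) = 1" unfolding i evl by simp
    then show ?thesis by auto
  qed
  then have "N \<noteq> 0" using finI by (simp add: N_def)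
  moreover have "generic H" if N: "ev id H N \<noteq> 0" for H
  proof -
    have "(\<Prod>j<n. H j) \<noteq> 0" "(\<Prod>i\<in>I. ev id H (l i)) \<noteq> 0"
      using N by (auto simp: N_def EI.ev_mult EI.E.hom_prod)
    then have 1: "\<And>j. j < n \<Longrightarrow> H j \<noteq> 0" and 2: "\<And>i. i \<in> I \<Longrightarrow> ev id H (l i) \<noteq> 0" using finI by auto
    show ?thesis
      unfolding generic_def
    proof (intro conjI allI impI 1)
      fix j p q assume *: "j < n" "p < n" "q < n" "j \<noteq> p" "j \<noteq> q" "p \<noteq> q"
      then have "ev id H (l (j, p, q)) \<noteq> 0" by (intro 2) (simp add: I_def)
      then show "lagrange_coeff H j p q \<noteq> 0" unfolding lagrange_coeff_def evl using a_inj * by simp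
    qed
  qed
  ultimately show ?thesis by blast
qed

theorem independence:
  assumes b: "\<And>S. S \<in> basis_sets n \<Longrightarrow> b S \<in> B"
    and van: "\<And>x. in_orbit x \<Longrightarrow> ev id x (\<Sum>S\<in>basis_sets n. subst (b S) * ymon S) = 0"
    and S: "S \<in> basis_sets n"
  shows "b S = 0"
proof (rule ccontr)
  assume "b S \<noteq> 0"
  then obtain m0 where "m0 \<in> Poly_Mapping.keys (b S)"
    by (metis poly_mapping_eqI lookup_zero in_keys_iff)
  \<comment> \<open>One \<open>k\<close> serves all coefficients: the least theta-degree that occurs
    anywhere. Some \<open>theta_part k\<close> is then nonzero, although the triangular system kills
    all of them at every generic \<open>H\<close>.\<close>
  define \<Omega> where "\<Omega> = {theta_degree m | m S. S \<in> basis_sets n \<and> m \<in> Poly_Mapping.keys (b S)}"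
  define k where "k = (LEAST k. k \<in> \<Omega>)"
  have "theta_degree m0 \<in> \<Omega>" using S \<open>m0 \<in> _\<close> by (auto simp: \<Omega>_def)
  then have "k \<in> \<Omega>" unfolding k_def by (rule LeastI)
  have low: "k \<le> theta_degree m" if "S \<in> basis_sets n" "m \<in> Poly_Mapping.keys (b S)" for S m
    unfolding k_def by (rule Least_le) (use that in \<open>auto simp: \<Omega>_def\<close>)
  obtain N :: "(nat \<Rightarrow>\<^sub>0 nat) \<Rightarrow>\<^sub>0 'k" where N: "N \<noteq> 0" "\<And>H. ev id H N \<noteq> 0 \<Longrightarrow> generic H"
    using generic_poly by blast
  have zero: "theta_part k (b U) = 0" if U: "U \<in> basis_sets n" for U
  proof (rule poly_zero_if_vanishing_generic[OF N(1)])
    fix H assume "ev id H N \<noteq> 0"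
    then have H: "generic H" by (rule N(2))
    have "\<exists>y. (\<Sum>S\<in>basis_sets n. ev id H (theta_part k (b S)) * (\<Prod>j\<in>S. y j)) = 0 \<and> (\<forall>j<n. y j = 0 \<longleftrightarrow> j \<notin> T)"
      if T: "T \<subseteq> {..<n}" "card T = 3" for T
    proof (rule curve_exists[OF H T])
      fix x X D y assume *: "\<And>ij. polyfun (\<lambda>s. x s ij)" "\<And>i. polyfun (\<lambda>s. X s i)"
          "\<And>s i. i < n \<Longrightarrow> ev id (x s) (param n a i) = s * X s i"
          "\<And>s i. n \<le> i \<Longrightarrow> i < n + 3 \<Longrightarrow> ev id (x s) (param n a i) = X s i"
          "polyfun D" "D 0 \<noteq> 0" "\<And>s. s \<noteq> 0 \<Longrightarrow> D s \<noteq> 0 \<Longrightarrow> in_orbit (x s)"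
          and **: "\<And>i. i < n + 3 \<Longrightarrow> X 0 i = H i" "\<And>j. j < n \<Longrightarrow> x 0 (0, j) = y j"
          "\<And>j. j < n \<Longrightarrow> y j = 0 \<longleftrightarrow> j \<notin> T"
      have "(\<Sum>S\<in>basis_sets n. ev id (X 0) (theta_part k (b S)) * (\<Prod>j\<in>S. x 0 (0, j))) = 0"
        using leading_part_on_curve[OF b low van *] .
      moreover have "ev id (X 0) (theta_part k (b S)) = ev id H (theta_part k (b S))"
        if S: "S \<in> basis_sets n" for S
      proof (rule EI.ev_cong)
        show "theta_part k (b S) \<in> B"
          unfolding theta_part_def using b[OF S]
          by (intro polys_in_sum) (auto simp: polys_in_def)
      qed (use ** in auto)
      moreover have "(\<Prod>j\<in>S. x 0 (0, j)) = (\<Prod>j\<in>S. y j)" if S: "S \<in> basis_sets n" for S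
        using basis_sets_sub[OF S] ** by (intro prod.cong) auto
      ultimately have "(\<Sum>S\<in>basis_sets n. ev id H (theta_part k (b S)) * (\<Prod>j\<in>S. y j)) = 0" by simp
      then show ?thesis using **(3) by (intro exI[of _ y]) simp
    qed
    then have "\<forall>T. \<exists>y. T \<subseteq> {..<n} \<longrightarrow> card T = 3 \<longrightarrow>
        (\<Sum>S\<in>basis_sets n. ev id H (theta_part k (b S)) * (\<Prod>j\<in>S. y j)) = 0 \<and> (\<forall>j<n. y j = 0 \<longleftrightarrow> j \<notin> T)"
      by blast
    then obtain y where y: "\<And>T. T \<subseteq> {..<n} \<Longrightarrow> card T = 3 \<Longrightarrow>
        (\<Sum>S\<in>basis_sets n. ev id H (theta_part k (b S)) * (\<Prod>j\<in>S. y T j)) = 0 \<and> (\<forall>j<n. y T j = 0 \<longleftrightarrow> j \<notin> T)"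
      by metis
    show "ev id H (theta_part k (b U)) = 0"
      by (rule triangular_system[OF n3 _ _ U, where y = y and c = "\<lambda>S. ev id H (theta_part k (b S))"])
        (use y in blast)+
  qed
  obtain m U where m: "U \<in> basis_sets n" "m \<in> Poly_Mapping.keys (b U)" "k = theta_degree m"
    using \<open>k \<in> \<Omega>\<close> by (auto simp: \<Omega>_def)
  have "Poly_Mapping.lookup (theta_part k (b U)) m = Poly_Mapping.lookup (b U) m"
    using m by (simp add: theta_part_def lookup_sum lookup_single when_def)
  then show False using zero[OF m(1)] m(2) by (simp add: in_keys_iff)
qed

end


section \<open>Kernels of column submatrices\<close>

lemma vec2_nonzero:
  assumes "x \<noteq> 0 \<or> y \<noteq> (0::'k::field)"
  shows "vec 2 (\<lambda>c. if c = 0 then x else y) \<noteq> 0\<^sub>v 2"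
proof
  assume eq: "vec 2 (\<lambda>c. if c = 0 then x else y) = 0\<^sub>v 2"
  show False
    using arg_cong[OF eq, of "\<lambda>w. w $ 0"] arg_cong[OF eq, of "\<lambda>w. w $ 1"] assms by simp
qed

text \<open>A vanishing minor yields an explicit dependency between the two columns.\<close>

lemma uniform_rank_two_minor:
  fixes v :: "'k::field mat"
  assumes v: "v \<in> carrier_mat 2 n" and u: "uniform_rank_two v" and ij: "i < n" "j < n" "i \<noteq> j"
  shows "v $$ (0, i) * v $$ (1, j) - v $$ (0, j) * v $$ (1, i) \<noteq> 0"
proof
  assume D: "v $$ (0, i) * v $$ (1, j) - v $$ (0, j) * v $$ (1, i) = 0"
  have ind: "inj_on (col v) {i, j}" "\<not> module.lin_dep class_ring (module_vec TYPE('k) 2) (col v ` {i, j})"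
    using u ij v by (auto simp: uniform_rank_two_def columns_independent_def)
  define A where "A = mat 2 2 (\<lambda>(r, c). v $$ (r, if c = 0 then i else j))"
  have A: "A \<in> carrier_mat 2 2" by (simp add: A_def)
  have "col A 0 = col v i" "col A 1 = col v j"
    using v ij by (auto intro!: eq_vecI simp: A_def)
  moreover have "[0..<2] = [0, 1::nat]" by (simp add: upt_rec)
  ultimately have cols: "cols A = [col v i, col v j]" by (simp add: cols_def A_def)
  \<comment> \<open>The kernel vector is read off the first row; if that row vanishes it is read off
    the second, and if both vanish any nonzero vector will do.\<close>
  define w0 w1 where "w0 = (if v $$ (0, i) = 0 \<and> v $$ (0, j) = 0 then if v $$ (1, i) = 0 \<and> v $$ (1, j) = 0
      then 1 else v $$ (1, j) else v $$ (0, j))"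
    and "w1 = (if v $$ (0, i) = 0 \<and> v $$ (0, j) = 0 then if v $$ (1, i) = 0 \<and> v $$ (1, j) = 0
      then 0 else - v $$ (1, i) else - v $$ (0, i))"
  define w where "w = vec 2 (\<lambda>c. if c = 0 then w0 else w1)"
  have "w0 \<noteq> 0 \<or> w1 \<noteq> 0" by (auto simp: w0_def w1_def)
  then have "w \<noteq> 0\<^sub>v 2" unfolding w_def by (rule vec2_nonzero)
  moreover have "A *\<^sub>v w = 0\<^sub>v 2"
  proof (rule eq_vecI)
    fix r assume "r < dim_vec (0\<^sub>v 2 :: 'k vec)"
    then have r: "r < 2" by simp
    have "(A *\<^sub>v w) $ r = v $$ (r, i) * w0 + v $$ (r, j) * w1"
      using r by (simp add: A_def w_def scalar_prod_def numeral_2_eq_2)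
    also have "\<dots> = 0" using D r by (auto simp: w0_def w1_def less_2_cases_iff algebra_simps)
    finally show "(A *\<^sub>v w) $ r = 0\<^sub>v 2 $ r" using r by simp
  qed (simp add: A_def)
  ultimately have "module.lin_dep class_ring (module_vec TYPE('k) 2) (set (cols A))"
    using ind(1) ij by (intro vec_space.lin_depI[OF A, of w]) (auto simp: w_def cols)
  then show False using ind(2) by (simp add: cols)
qed

lemma column_submatrix_simps:
  assumes "v \<in> carrier_mat r n" "J \<subseteq> {..<n}"
  shows "column_submatrix v J \<in> carrier_mat r (card J)"
    and "i < r \<Longrightarrow> l < card J \<Longrightarrow> column_submatrix v J $$ (i, l) = v $$ (i, pick J l)"
proof -
  have eq: "{j. j < dim_col v \<and> j \<in> J} = J" "{i. i < dim_row v \<and> i \<in> UNIV} = {..<r}"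
    using assms by auto
  show "column_submatrix v J \<in> carrier_mat r (card J)"
    using eq by (intro carrier_matI) (simp_all add: dim_submatrix)
  show "i < r \<Longrightarrow> l < card J \<Longrightarrow> column_submatrix v J $$ (i, l) = v $$ (i, pick J l)"
    using eq by (subst submatrix_index) (simp_all add: pick_UNIV)
qed

lemma pick_bij: "finite J \<Longrightarrow> bij_betw (pick J) {..<card J} J"
proof -
  assume fin: "finite J"
  have inj: "inj_on (pick J) {..<card J}"
    using pick_mono_le[of _ J] by (intro linorder_inj_onI) (auto, fastforce)
  moreover have "pick J ` {..<card J} = J"
    using pick_in_set_le[of _ J] card_image[OF inj] fin by (intro card_subset_eq) auto
  ultimately show ?thesis by (simp add: bij_betw_def)
qed

lemma perp_kernel:
  fixes v :: "'k::field mat"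
  assumes v: "v \<in> carrier_mat 2 n" and J: "J \<subseteq> {..<n}" and P: "is_perp (column_submatrix v J) P"
    and i: "i < dim_row P" and r: "r < 2"
  shows "(\<Sum>l<card J. v $$ (r, pick J l) * P $$ (i, l)) = 0"
proof -
  let ?w = "column_submatrix v J"
  note w = column_submatrix_simps[OF v J]
  have Pd: "dim_col P = card J" using P w(1) by (auto simp: is_perp_def)
  interpret kernel 2 "card J" ?w by unfold_locales (rule w)
  have "basis (set (rows P))" using P w(1) by (auto simp: is_perp_def)
  then have "set (rows P) \<subseteq> mat_kernel ?w" by (simp add: Ker.basis_def)
  then have "row P i \<in> mat_kernel ?w" using i by (auto simp: rows_def)
  then have "(?w *\<^sub>v row P i) $ r = 0" using mat_kernelD[OF w(1)] r by simp
  then show ?thesis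
    using r w i Pd by (simp add: scalar_prod_def lessThan_atLeast0)
qed

text \<open>The rank fixes the shape of the kernel matrix: for four columns it has two rows, so the
  tensor matrix is square of size 4 and has a single maximal minor.\<close>

lemma rank_eq_two:
  fixes v :: "'k::field mat"
  assumes v: "v \<in> carrier_mat 2 n" and u: "uniform_rank_two v" and J: "J \<subseteq> {..<n}" "card J \<ge> 2"
  shows "vec_space.rank 2 (column_submatrix v J) = 2"
proof -
  let ?w = "column_submatrix v J"
  note w = column_submatrix_simps[OF v J(1)]
  interpret vec_space "TYPE('k)" 2 .
  have finJ: "finite J" using J finite_subset by blast
  obtain i j where ij: "i \<in> J" "j \<in> J" "i \<noteq> j" using J(2)
    by (metis card_le_Suc0_iff_eq finJ not_less_eq_eq numeral_2_eq_2)
  have ind: "inj_on (col v) {i, j}" "lin_indpt (col v ` {i, j})"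
    using u ij v J by (auto simp: uniform_rank_two_def columns_independent_def)
  have "col v j \<in> set (cols ?w)" if j: "j \<in> J" for j
  proof -
    have "j \<in> pick J ` {..<card J}" using pick_bij[OF finJ] j by (simp add: bij_betw_def)
    then obtain l where l: "l < card J" "j = pick J l" by auto
    have "col v j = col ?w l" using l w v J j by (intro eq_vecI) auto
    then show ?thesis using l w(1) by (auto simp: cols_def)
  qed
  then have "rank ?w \<ge> card (col v ` {i, j})" using ij ind by (intro rank_ge_card_indpt[OF w(1)]) auto
  moreover have "card (col v ` {i, j}) = 2" using ind(1) ij(3) by (simp add: card_image)
  moreover have "rank ?w \<le> 2"
  proof -
    obtain S where S: "maximal S (\<lambda>T. T \<subseteq> set (cols ?w) \<and> lin_indpt T)"
      using maximal_exists_superset[of "set (cols ?w)" "\<lambda>T. T \<subseteq> set (cols ?w) \<and> lin_indpt T" "{}"]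
        finite_lin_indpt2[of "{}"] by (metis List.finite_set empty_iff empty_subsetI finite.emptyI)
    then have "S \<subseteq> set (cols ?w)" "lin_indpt S" by (auto simp: maximal_def)
    then have "card S \<le> dim" using cols_dim[of ?w] w(1) by (intro li_le_dim(2)) auto
    then show ?thesis using rank_card_indpt[OF w(1) S] dim_is_n by simp
  qed
  ultimately show ?thesis by simp
qed

lemma perp_rows_independent:
  fixes v :: "'k::field mat"
  assumes v: "v \<in> carrier_mat 2 n" and u: "uniform_rank_two v" and J: "J \<subseteq> {..<n}" "card J = 4"
    and P: "is_perp (column_submatrix v J) P"
  shows "P \<in> carrier_mat 2 4"
    and "(\<And>l. l < 4 \<Longrightarrow> x * P $$ (0, l) + y * P $$ (1, l) = 0) \<Longrightarrow> x = 0 \<and> y = 0"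
proof -
  let ?w = "column_submatrix v J"
  note w = column_submatrix_simps[OF v J(1)]
  have w4: "?w \<in> carrier_mat 2 4" using w(1) J by simp
  have "vec_space.rank 2 ?w = 2" using J by (intro rank_eq_two[OF v u J(1)]) simp
  then show P4: "P \<in> carrier_mat 2 4" using P w4 by (auto simp: is_perp_def)
  assume eq: "\<And>l. l < 4 \<Longrightarrow> x * P $$ (0, l) + y * P $$ (1, l) = 0"
  interpret kernel 2 4 ?w by unfold_locales (rule w4)
  have bas: "basis (set (rows P))" and dist: "distinct (rows P)" using P w4 by (auto simp: is_perp_def)
  then have "\<not> Ker.lin_dep (set (rows P))" "set (rows P) \<subseteq> mat_kernel ?w" by (simp_all add: Ker.basis_def)
  then have ind: "\<not> NC.lin_dep (set (rows P))" using lindep_same by blast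
  show "x = 0 \<and> y = 0"
  proof (rule ccontr)
    assume xy: "\<not> (x = 0 \<and> y = 0)"
    define z where "z = vec 2 (\<lambda>c. if c = 0 then x else y)"
    have "z \<noteq> 0\<^sub>v 2" unfolding z_def by (rule vec2_nonzero) (use xy in blast)
    moreover have "P\<^sup>T *\<^sub>v z = 0\<^sub>v 4"
    proof (rule eq_vecI)
      fix l assume "l < dim_vec (0\<^sub>v 4 :: 'k vec)"
      then have l: "l < 4" by simp
      have "(P\<^sup>T *\<^sub>v z) $ l = x * P $$ (0, l) + y * P $$ (1, l)"
        using l P4 by (simp add: z_def scalar_prod_def numeral_2_eq_2 mult.commute)
      then show "(P\<^sup>T *\<^sub>v z) $ l = 0\<^sub>v 4 $ l" using eq l by simp
    qed (use P4 in auto)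
    ultimately have "NC.lin_dep (set (cols (P\<^sup>T)))"
      using P4 dist by (intro NC.lin_depI[of "P\<^sup>T" 2 z]) (auto simp: z_def)
    then show False using ind by simp
  qed
qed

text \<open>The moments are paired with the polynomial of degree \<open>k - 1\<close> that vanishes
  at all points except \<open>a l0\<close>.\<close>

lemma vandermonde_zero:
  fixes a m :: "nat \<Rightarrow> 'k::field"
  assumes inj: "inj_on a {..<k}" and m: "\<And>e. e < k \<Longrightarrow> (\<Sum>l<k. m l * a l ^ e) = 0" and l0: "l0 < k"
  shows "m l0 = 0"
proof -
  define f where "f = (\<Prod>l\<in>{..<k} - {l0}. [:- a l, 1:])"
  have "Polynomial.degree f = (\<Sum>l\<in>{..<k} - {l0}. Polynomial.degree [:- a l, 1:])"
    unfolding f_def by (rule degree_prod_sum_eq) simp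
  also have "\<dots> < k" using l0 by simp
  finally have deg: "Polynomial.degree f < k" .
  have "(\<Sum>l<k. m l * poly f (a l)) = (\<Sum>l<k. \<Sum>e\<le>Polynomial.degree f. Polynomial.coeff f e * (m l * a l ^ e))"
    by (simp add: poly_altdef sum_distrib_left mult_ac)
  also have "\<dots> = (\<Sum>e\<le>Polynomial.degree f. Polynomial.coeff f e * (\<Sum>l<k. m l * a l ^ e))"
    by (subst sum.swap) (simp add: sum_distrib_left)
  also have "\<dots> = 0" using m deg by (intro sum.neutral) auto
  finally have "(\<Sum>l<k. m l * poly f (a l)) = 0" .
  moreover have "(\<Sum>l<k. m l * poly f (a l)) = m l0 * poly f (a l0)"
  proof -
    have "poly f (a l) = 0" if "l \<in> {..<k} - {l0}" for l
      using that by (auto simp: f_def poly_prod)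
    then show ?thesis using l0 by (subst sum.remove[of _ l0]) auto
  qed
  moreover have "poly f (a l0) \<noteq> 0"
    using inj l0 by (auto simp: f_def poly_prod inj_on_def)
  ultimately show ?thesis by simp
qed


section \<open>The ideal of minors\<close>

lemma eval_at_ev: "eval_at y p = ev id (\<lambda>ij. y $$ ij) p"
  by (simp add: eval_at_def ev_def mon_def)

lemma const_poly_Const: "const_poly = Const" and indet_Var: "indet i j = Var (i, j)"
  by (simp_all add: fun_eq_iff const_poly_def Const_def indet_def Var_def)

lemma carrier_coord_ring: "carrier (coord_ring r n) = polys_in ({..<r} \<times> {..<n})"
  by (simp add: coord_ring_def polys_in_def)

lemma coord_ring_simps:
  "mult (coord_ring r n) = (*)" "add (coord_ring r n) = (+)" "one (coord_ring r n) = 1" "zero (coord_ring r n) = 0"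
  by (simp_all add: coord_ring_def)

lemma cring_coord_ring: "cring (coord_ring r n :: 'k::comm_ring_1 mpoly ring)" (is "cring ?R")
proof (rule cringI)
  show "abelian_group ?R"
  proof (rule abelian_groupI)
    fix x assume "x \<in> carrier ?R"
    then show "\<exists>y\<in>carrier ?R. y \<oplus>\<^bsub>?R\<^esub> x = \<zero>\<^bsub>?R\<^esub>"
      by (intro bexI[of _ "- x"]) (auto simp: carrier_coord_ring coord_ring_simps)
  qed (auto simp: carrier_coord_ring coord_ring_simps add_ac)
  show "comm_monoid ?R"
    by (rule comm_monoidI) (auto simp: carrier_coord_ring coord_ring_simps mult_ac)
qed (simp add: coord_ring_simps ring_distribs)

lemma signof_in_polys: "signof p \<in> polys_in V"
  by (auto simp: sign_def)

lemma det_in_polys: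
  assumes "A \<in> carrier_mat n n" "\<And>i j. i < n \<Longrightarrow> j < n \<Longrightarrow> A $$ (i, j) \<in> polys_in V"
  shows "det A \<in> polys_in V"
  unfolding det_def'[OF assms(1)]
proof (intro polys_in_sum polys_in_mult polys_in_prod signof_in_polys)
  fix p i assume "p \<in> {p. p permutes {0..<n}}" "i \<in> {0..<n}"
  then show "A $$ (i, p i) \<in> polys_in V" by (intro assms(2)) (auto simp: permutes_in_image)
qed

lemma pick_lessThan: "l < k \<Longrightarrow> pick {..<k} l = l"
proof -
  assume l: "l < k"
  have "pick {..<k} l < k" using pick_in_set_le[of l "{..<k}"] l by simp
  then have "{a \<in> {..<k}. a < pick {..<k} l} = {..<pick {..<k} l}" by auto
  then show ?thesis using card_pick_le[of l "{..<k}"] l by simp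
qed

lemma orbit_entries:
  fixes v :: "'k::field mat"
  assumes v: "v \<in> carrier_mat 2 n" and y: "y \<in> orbit 2 n v"
  shows "y \<in> carrier_mat 2 n"
    and "\<exists>(g :: nat \<Rightarrow> nat \<Rightarrow> 'k) s. (\<forall>j<n. s j \<noteq> 0) \<and> (\<forall>i<2. \<forall>j<n. y $$ (i, j) = (g i 0 * v $$ (0, j) + g i 1 * v $$ (1, j)) * s j)"
proof -
  obtain g s where g: "g \<in> carrier_mat 2 2" "\<forall>j<n. s j \<noteq> 0" "y = g * v * mat_diag n s"
    using y by (auto simp: orbit_def)
  have gv: "g * v \<in> carrier_mat 2 n" using g v by simp
  then show "y \<in> carrier_mat 2 n" using g by simp
  have "y $$ (i, j) = (g $$ (i, 0) * v $$ (0, j) + g $$ (i, 1) * v $$ (1, j)) * s j" if "i < 2" "j < n" for i j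
    unfolding g(3) mat_diag_mult_right[OF gv] using that g v by (simp add: scalar_prod_def numeral_2_eq_2)
  then show "\<exists>(g :: nat \<Rightarrow> nat \<Rightarrow> 'k) s. (\<forall>j<n. s j \<noteq> 0) \<and> (\<forall>i<2. \<forall>j<n. y $$ (i, j) = (g i 0 * v $$ (0, j) + g i 1 * v $$ (1, j)) * s j)"
    using g(2) by (intro exI[of _ "\<lambda>i k. g $$ (i, k)"] exI[of _ s]) auto
qed

lemma orbit_mem:
  fixes v :: "'k::field mat"
  assumes v: "v \<in> carrier_mat 2 n" and g: "g00 * g11 - g01 * g10 \<noteq> 0" and s: "\<And>j. j < n \<Longrightarrow> s j \<noteq> 0"
  shows "\<exists>y\<in>orbit 2 n v. \<forall>j<n. y $$ (0, j) = (g00 * v $$ (0, j) + g01 * v $$ (1, j)) * s j \<and>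
    y $$ (1, j) = (g10 * v $$ (0, j) + g11 * v $$ (1, j)) * s j"
proof -
  define D where "D = g00 * g11 - g01 * g10"
  define g where "g = mat 2 2 (\<lambda>(i, k). if i = 0 then if k = 0 then g00 else g01 else if k = 0 then g10 else g11)"
  define h where "h = mat 2 2 (\<lambda>(i, k). if i = 0 then if k = 0 then g11 / D else - g01 / D else if k = 0 then - g10 / D else g00 / D)"
  have gh: "g \<in> carrier_mat 2 2" "h \<in> carrier_mat 2 2" by (simp_all add: g_def h_def)
  have D: "D \<noteq> 0" using g by (simp add: D_def)
  have 1: "g00 * g11 = D + g01 * g10" by (simp add: D_def)
  have "g * h = 1\<^sub>m 2" "h * g = 1\<^sub>m 2"
    by (rule eq_matI; use D 1 in \<open>auto simp: g_def h_def scalar_prod_def numeral_2_eq_2 less_Suc_eq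
      diff_divide_distrib[symmetric] add_divide_distrib[symmetric] mult_ac\<close>)+
  then have "invertible_mat g"
    unfolding invertible_mat_def inverts_mat_def using gh by (auto intro!: exI[of _ h])
  then have mem: "g * v * mat_diag n s \<in> orbit 2 n v" unfolding orbit_def using gh s by blast
  have gv: "g * v \<in> carrier_mat 2 n" using gh v by simp
  have "(g * v * mat_diag n s) $$ (i, j) = (g $$ (i, 0) * v $$ (0, j) + g $$ (i, 1) * v $$ (1, j)) * s j"
    if "i < 2" "j < n" for i j
    unfolding mat_diag_mult_right[OF gv] using that gh v by (simp add: scalar_prod_def numeral_2_eq_2)
  then show ?thesis by (intro bexI[OF _ mem]) (simp add: g_def)
qed

abbreviation "perp_matrix n J P \<equiv> column_submatrix (generic_matrix 2 n) J \<odot>\<^sub>c map_mat const_poly P"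

lemma perp_matrix_simps:
  fixes P :: "'k::comm_ring_1 mat"
  assumes J: "J \<subseteq> {..<n}" and P: "dim_col P = card J"
  shows "dim_row (perp_matrix n J P) = 2 * dim_row P" "dim_col (perp_matrix n J P) = card J"
    and "r < 2 * dim_row P \<Longrightarrow> l < card J \<Longrightarrow> perp_matrix n J P $$ (r, l)
      = Var (r div dim_row P, pick J l) * Const (P $$ (r mod dim_row P, l))"
proof -
  have gm: "(generic_matrix 2 n :: 'k mpoly mat) \<in> carrier_mat 2 n" by (simp add: generic_matrix_def)
  note w = column_submatrix_simps[OF gm J]
  show "dim_row (perp_matrix n J P) = 2 * dim_row P" "dim_col (perp_matrix n J P) = card J"
    using carrier_matD[OF w(1)] by (simp_all add: columnwise_tensor_def)
  assume r: "r < 2 * dim_row P" and l: "l < card J"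
  have "r div dim_row P < 2" using r by (simp add: less_mult_imp_div_less)
  moreover have "r mod dim_row P < dim_row P" using r by (intro mod_less_divisor) (cases "dim_row P", auto)
  moreover have "pick J l < n" using pick_in_set_le[OF l] J by auto
  ultimately show "perp_matrix n J P $$ (r, l)
      = Var (r div dim_row P, pick J l) * Const (P $$ (r mod dim_row P, l))"
    using carrier_matD[OF w(1)] w(2) l r P by (simp add: columnwise_tensor_def generic_matrix_def indet_Var const_poly_Const)
qed

text \<open>At the point \<open>x\<^sub>j = s\<^sub>j g v\<^sub>j\<close> the vector with entries \<open>1/s\<^sub>j\<close> lies in the kernel of the
  evaluated matrix.\<close>

lemma minors_vanish:
  fixes v :: "'k::field mat"
  assumes v: "v \<in> carrier_mat 2 n" and J: "J \<subseteq> {..<n}" "J \<noteq> {}"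
    and P: "is_perp (column_submatrix v J) P"
    and f: "f \<in> minors (card J) (perp_matrix n J P)"
  shows "f \<in> polys_in ({..<2} \<times> {..<n})" and "y \<in> orbit 2 n v \<Longrightarrow> eval_at y f = 0"
proof -
  let ?X = "perp_matrix n J P" and ?k = "card J"
  have Pd: "dim_col P = ?k" using P column_submatrix_simps[OF v J(1)] by (auto simp: is_perp_def)
  note X = perp_matrix_simps[OF J(1) Pd]
  obtain I K where IK: "f = det (submatrix ?X I K)" "I \<subseteq> {..<2 * dim_row P}" "K \<subseteq> {..<?k}" "card I = ?k" "card K = ?k"
    using f by (auto simp: minors_def X)
  have K: "K = {..<?k}" using IK(3,5) by (intro card_subset_eq) auto
  have finI: "finite I" using IK(2) finite_subset by blast
  have cI: "{i. i < dim_row ?X \<and> i \<in> I} = I" "{j. j < dim_col ?X \<and> j \<in> K} = {..<?k}" using IK K X by auto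
  define S where "S = submatrix ?X I K"
  have Sc: "S \<in> carrier_mat ?k ?k" unfolding S_def using cI IK by (intro carrier_matI) (simp_all add: dim_submatrix)
  have pI: "pick I r < 2 * dim_row P" if "r < ?k" for r using pick_in_set_le[of r I] IK that by auto
  have S: "S $$ (r, l) = Var (pick I r div dim_row P, pick J l) * Const (P $$ (pick I r mod dim_row P, l))"
    if "r < ?k" "l < ?k" for r l
    unfolding S_def using cI IK that X(3)[OF pI] by (subst submatrix_index) (simp_all add: K pick_lessThan)
  have pJ: "pick J l < n" if "l < ?k" for l using pick_in_set_le[OF that] J by auto
  have dv: "pick I r div dim_row P < 2" "pick I r mod dim_row P < dim_row P" if "r < ?k" for r
  proof -
    show "pick I r div dim_row P < 2" using pI[OF that] by (simp add: less_mult_imp_div_less)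
    show "pick I r mod dim_row P < dim_row P" using pI[OF that] by (intro mod_less_divisor) (cases "dim_row P", auto)
  qed
  show "f \<in> polys_in ({..<2} \<times> {..<n})"
    unfolding IK(1) S_def[symmetric]
    by (rule det_in_polys[OF Sc]) (use S dv pJ in \<open>auto intro!: polys_in_mult polys_in_Var\<close>)
  assume y: "y \<in> orbit 2 n v"
  obtain g :: "nat \<Rightarrow> nat \<Rightarrow> 'k" and s where gs0: "\<forall>j<n. s j \<noteq> 0"
      "\<forall>i<2. \<forall>j<n. y $$ (i, j) = (g i 0 * v $$ (0, j) + g i 1 * v $$ (1, j)) * s j"
    using orbit_entries(2)[OF v y] by (elim exE conjE) (rule that)
  note gs = gs0[rule_format]
  have e: "eval_at y = ev id (\<lambda>ij. y $$ ij)" by (rule ext) (rule eval_at_ev)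
  have hom: "comm_ring_hom (eval_at y)" unfolding e by (rule EI.comm_ring_hom_ev)
  define E where "E = map_mat (eval_at y) S"
  have Ec: "E \<in> carrier_mat ?k ?k" using Sc by (simp add: E_def)
  have E: "E $$ (r, l) = y $$ (pick I r div dim_row P, pick J l) * P $$ (pick I r mod dim_row P, l)"
    if "r < ?k" "l < ?k" for r l
    using that Sc by (simp add: E_def S e EI.ev_mult)
  define w where "w = vec ?k (\<lambda>l. 1 / s (pick J l))"
  have finJ: "finite J" using J finite_subset by blast
  then have k0: "0 < ?k" using J by (simp add: card_gt_0_iff)
  have "w $ 0 \<noteq> 0" using k0 gs(1)[OF pJ[OF k0]] by (simp add: w_def)
  then have "w \<noteq> 0\<^sub>v ?k" using k0 by auto
  moreover have "E *\<^sub>v w = 0\<^sub>v ?k"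
  proof (rule eq_vecI)
    fix r assume "r < dim_vec (0\<^sub>v ?k :: 'k vec)"
    then have r: "r < ?k" by simp
    define i k where "i = pick I r div dim_row P" and "k = pick I r mod dim_row P"
    have ik: "i < 2" "k < dim_row P" using dv[OF r] by (simp_all add: i_def k_def)
    have "(E *\<^sub>v w) $ r = (\<Sum>l<?k. E $$ (r, l) * (1 / s (pick J l)))"
      using r Ec by (simp add: scalar_prod_def w_def lessThan_atLeast0)
    also have "\<dots> = (\<Sum>l<?k. g i 0 * (v $$ (0, pick J l) * P $$ (k, l)) + g i 1 * (v $$ (1, pick J l) * P $$ (k, l)))"
      using r gs pJ ik by (intro sum.cong refl) (simp add: E i_def[symmetric] k_def[symmetric] algebra_simps)
    also have "\<dots> = 0"
      using perp_kernel[OF v J(1) P ik(2), of 0] perp_kernel[OF v J(1) P ik(2), of 1]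
      by (simp add: sum.distrib sum_distrib_left[symmetric])
    finally show "(E *\<^sub>v w) $ r = 0\<^sub>v ?k $ r" using r by simp
  qed (use Ec in simp)
  ultimately have "det E = 0" unfolding det_0_iff_vec_prod_zero[OF Ec] by (intro exI[of _ w]) (simp add: w_def)
  then show "eval_at y f = 0" unfolding E_def comm_ring_hom.hom_det[OF hom] IK(1) S_def[symmetric] .
qed

text \<open>A row vector annihilating the constant matrix yields two kernel vectors whose entrywise
  combination is orthogonal to \<open>1, a, a\<^sup>2, a\<^sup>3\<close>.\<close>

lemma minor_four_expansion:
  fixes v :: "'k::field mat"
  assumes v: "v \<in> carrier_mat 2 n" and u: "uniform_rank_two v" and J: "J \<subseteq> {..<n}" "card J = 4"
    and P: "is_perp (column_submatrix v J) P"
    and c: "\<And>j. j < n \<Longrightarrow> c j \<noteq> 0" and a: "inj_on a {..<n}"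
    and ca: "\<And>j. j < n \<Longrightarrow> c j = v $$ (0, j) + \<alpha> * v $$ (1, j)"
      "\<And>j. j < n \<Longrightarrow> c j * a j = v $$ (1, j) + \<beta> * c j"
  shows "\<exists>V g. V \<noteq> 0 \<and> (\<forall>K. g K \<in> polys_in {..<n + 3}) \<and>
      Const V * ymon J - (\<Sum>K\<in>Pow J - {J}. ev Const (param n a) (g K) * ymon K)
        \<in> minors 4 (perp_matrix n J P)"
proof -
  let ?X = "perp_matrix n J P"
  note P4 = perp_rows_independent[OF v u J P]
  have Pd: "dim_col P = card J" "dim_row P = 2" using P4(1) J by auto
  note X = perp_matrix_simps[OF J(1) Pd(1), unfolded Pd(2) J(2)]
  have finJ: "finite J" using J finite_subset by blast
  have bij: "bij_betw (pick J) {..<4} J" using pick_bij[OF finJ] J by simp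
  have pJ: "pick J l < n" if "l < 4" for l using pick_in_set_le[of l J] that J by auto
  \<comment> \<open>The two upper rows are multiples of y_j, the two lower ones of z_j = theta_j +
    a_j^2 y_j. \<open>A\<close> collects the coefficients of y_j and \<open>B\<close> those of
    theta_j.\<close>
  define A where "A = mat 4 4 (\<lambda>(r, l). (if r < 2 then 1 else a (pick J l) ^ 2) * P $$ (r mod 2, l))"
  define B where "B r l = (if r < 2 then 0 else P $$ (r mod 2, l))" for r l
  have Ac: "A \<in> carrier_mat 4 4" by (simp add: A_def)
  have Xc: "?X \<in> carrier_mat 4 4" using X by (intro carrier_matI) simp_all
  have "submatrix ?X {..<4} {..<4} = ?X"
    using X by (intro eq_matI) (auto simp: dim_submatrix submatrix_index pick_lessThan lessThan_def[symmetric])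
  then have mem: "det ?X \<in> minors 4 ?X"
    unfolding minors_def using X by (intro CollectI exI[of _ "{..<4}"]) auto
  have V: "det A \<noteq> 0"
  proof
    assume "det A = 0"
    then have "det (A\<^sup>T) = 0" using det_transpose[OF Ac] by simp
    then obtain w where w: "w \<in> carrier_vec 4" "w \<noteq> 0\<^sub>v 4" "A\<^sup>T *\<^sub>v w = 0\<^sub>v 4"
      using det_0_iff_vec_prod_zero[of "A\<^sup>T" 4] Ac by auto
    define r1 r2 where "r1 l = w $ 0 * P $$ (0, l) + w $ 1 * P $$ (1, l)"
      and "r2 l = w $ 2 * P $$ (0, l) + w $ 3 * P $$ (1, l)" for l
    have r: "r1 l + a (pick J l) ^ 2 * r2 l = 0" if l: "l < 4" for l
    proof -
      have four: "{0..<4} = {0, 1, 2, 3::nat}" by auto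
      have "(A\<^sup>T *\<^sub>v w) $ l = r1 l + a (pick J l) ^ 2 * r2 l"
        using l w(1) unfolding r1_def r2_def
        by (simp add: A_def scalar_prod_def four algebra_simps)
      then show ?thesis using w(3) l by simp
    qed
    have ker: "(\<Sum>l<4. c (pick J l) * P $$ (k, l)) = 0" "(\<Sum>l<4. c (pick J l) * a (pick J l) * P $$ (k, l)) = 0"
      if k: "k < 2" for k
    proof -
      have 0: "(\<Sum>l<4. v $$ (i, pick J l) * P $$ (k, l)) = 0" if "i < 2" for i
        using perp_kernel[OF v J(1) P, of k i] that k Pd J by simp
      have "(\<Sum>l<4. c (pick J l) * P $$ (k, l))
          = (\<Sum>l<4. v $$ (0, pick J l) * P $$ (k, l)) + \<alpha> * (\<Sum>l<4. v $$ (1, pick J l) * P $$ (k, l))"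
        unfolding sum_distrib_left sum.distrib[symmetric]
        using pJ ca(1) by (intro sum.cong refl) (simp add: algebra_simps)
      then show 1: "(\<Sum>l<4. c (pick J l) * P $$ (k, l)) = 0" using 0[of 0] 0[of 1] by simp
      have "(\<Sum>l<4. c (pick J l) * a (pick J l) * P $$ (k, l))
          = (\<Sum>l<4. v $$ (1, pick J l) * P $$ (k, l)) + \<beta> * (\<Sum>l<4. c (pick J l) * P $$ (k, l))"
        unfolding sum_distrib_left sum.distrib[symmetric]
        using pJ ca(2) by (intro sum.cong refl) (simp add: algebra_simps)
      then show "(\<Sum>l<4. c (pick J l) * a (pick J l) * P $$ (k, l)) = 0" using 0[of 1] 1 by simp
    qed
    have comb: "(\<Sum>l<4. f l * (x * P $$ (0, l) + y * P $$ (1, l))) = 0"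
      if "\<And>k. k < 2 \<Longrightarrow> (\<Sum>l<4. f l * P $$ (k, l)) = 0" for f x y
    proof -
      have "(\<Sum>l<4. f l * (x * P $$ (0, l) + y * P $$ (1, l)))
          = x * (\<Sum>l<4. f l * P $$ (0, l)) + y * (\<Sum>l<4. f l * P $$ (1, l))"
        unfolding sum_distrib_left sum.distrib[symmetric] by (simp add: algebra_simps)
      then show ?thesis using that[of 0] that[of 1] by simp
    qed
    have k1: "(\<Sum>l<4. c (pick J l) * r1 l) = 0" "(\<Sum>l<4. c (pick J l) * a (pick J l) * r1 l) = 0"
      and k2: "(\<Sum>l<4. c (pick J l) * r2 l) = 0" "(\<Sum>l<4. c (pick J l) * a (pick J l) * r2 l) = 0"
      unfolding r1_def r2_def by (rule comb, erule ker)+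
    have r': "a (pick J l) ^ 2 * r2 l = - r1 l" if "l < 4" for l
      using r[OF that] by (simp add: eq_neg_iff_add_eq_0 add.commute)
    \<comment> \<open>Orders 0 and 1 use that \<open>r2\<close> is orthogonal to c and to c a.
      Orders 2 and 3 trade a^2 r2 for -r1, which has the same orthogonality; the square in theta_j
      is what makes the four orders consecutive.\<close>
    have mom: "(\<Sum>l<4. (c (pick J l) * r2 l) * a (pick J l) ^ e) = 0" if "e < 4" for e
    proof -
      consider "e = 0" | "e = 1" | "e = 2" | "e = 3" using \<open>e < 4\<close> by linarith
      then show ?thesis
      proof cases
        case 3
        have "(\<Sum>l<4. (c (pick J l) * r2 l) * a (pick J l) ^ e) = - (\<Sum>l<4. c (pick J l) * r1 l)"
          unfolding sum_negf[symmetric]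
        proof (intro sum.cong refl)
          fix l assume "l \<in> {..<4::nat}"
          then have "c (pick J l) * (a (pick J l) ^ 2 * r2 l) = - (c (pick J l) * r1 l)" using r' by simp
          then show "(c (pick J l) * r2 l) * a (pick J l) ^ e = - (c (pick J l) * r1 l)"
            by (simp add: 3 mult_ac)
        qed
        then show ?thesis using k1 by simp
      next
        case 4
        have "(\<Sum>l<4. (c (pick J l) * r2 l) * a (pick J l) ^ e)
            = - (\<Sum>l<4. c (pick J l) * a (pick J l) * r1 l)"
          unfolding sum_negf[symmetric]
        proof (intro sum.cong refl)
          fix l assume "l \<in> {..<4::nat}"
          then have "c (pick J l) * a (pick J l) * (a (pick J l) ^ 2 * r2 l) = - (c (pick J l) * a (pick J l) * r1 l)"
            using r' by simp
          then show "(c (pick J l) * r2 l) * a (pick J l) ^ e = - (c (pick J l) * a (pick J l) * r1 l)"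
            by (simp add: 4 power3_eq_cube power2_eq_square mult_ac)
        qed
        then show ?thesis using k1 by simp
      qed (use k2 in \<open>simp_all add: mult_ac\<close>)
    qed
    have inj: "inj_on (\<lambda>l. a (pick J l)) {..<4}"
      using comp_inj_on[of "pick J" "{..<4}" a] bij inj_on_subset[OF a J(1)]
      by (simp add: bij_betw_def comp_def)
    have r20: "r2 l = 0" if "l < 4" for l
      using vandermonde_zero[OF inj mom that] c[OF pJ[OF that]] by simp
    then have r10: "r1 l = 0" if "l < 4" for l using r[OF that] that by simp
    have "w $ 0 = 0 \<and> w $ 1 = 0" using r10 by (intro P4(2)) (simp add: r1_def)
    moreover have "w $ 2 = 0 \<and> w $ 3 = 0" using r20 by (intro P4(2)) (simp add: r2_def)
    ultimately have "w = 0\<^sub>v 4"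
      using w(1) by (intro eq_vecI) (auto simp: numeral_eq_Suc less_Suc_eq)
    then show False using w(2) by simp
  qed
  define idx where "idx = inv_into {..<4::nat} (pick J)"
  have idx: "bij_betw idx J {..<4}" unfolding idx_def by (rule bij_betw_inv_into[OF bij])
  have pidx: "pick J (idx j) = j" if "j \<in> J" for j
    using bij that unfolding idx_def by (simp add: bij_betw_inv_into_right)
  \<comment> \<open>In the expansion of a permutation product, \<open>K\<close> is the set of
    columns where the y summand is taken; the remaining columns contribute parameters. For
    \<open>K = J\<close> only entries of \<open>A\<close> occur, hence the leading coefficient
    \<open>det A\<close>.\<close>
  define \<epsilon> :: "(nat \<Rightarrow> nat) \<Rightarrow> nat set \<Rightarrow> 'k" where
    "\<epsilon> p K = signof p * ((\<Prod>j\<in>K. A $$ (p (idx j), idx j)) * (\<Prod>j\<in>J - K. B (p (idx j)) (idx j)))" for p K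
  define E where "E K = (\<Sum>p | p permutes {0..<4}. \<epsilon> p K)" for K
  define h where "h K = Const (E K) * (\<Prod>j\<in>J - K. Var j)" for K
  have entry: "?X $$ (r, l) = Const (A $$ (r, l)) * Var (0, pick J l) + Const (B r l) * param n a (pick J l)"
    if rl: "r < 4" "l < 4" for r l
  proof (cases "r < 2")
    case True
    then show ?thesis using rl X(3) by (simp add: A_def B_def mult.commute)
  next
    case False
    then have "r div 2 = 1" using rl by linarith
    then show ?thesis using rl False X(3) pJ
      by (simp add: A_def B_def param_def Const_mult algebra_simps)
  qed
  have sg: "signof p = (Const (signof p) :: 'k mpoly)" for p
    by (rule EC.hom_signof[symmetric])
  have prod: "(\<Prod>l<4. ?X $$ (p l, l)) * Const (signof p) = (\<Sum>K\<in>Pow J. Const (\<epsilon> p K) * (ymon K * (\<Prod>j\<in>J - K. param n a j)))"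
    if p: "p permutes {0..<4}" for p
  proof -
    have p4: "p l < 4" if "l < 4" for l using permutes_in_image[OF p, of l] that by simp
    have "(\<Prod>l<4. ?X $$ (p l, l)) = (\<Prod>j\<in>J. ?X $$ (p (idx j), idx j))"
      by (rule prod.reindex_bij_betw[OF idx, symmetric])
    also have "\<dots> = (\<Prod>j\<in>J. Const (A $$ (p (idx j), idx j)) * Var (0, j) + Const (B (p (idx j)) (idx j)) * param n a j)"
    proof (intro prod.cong refl)
      fix j assume j: "j \<in> J"
      then have "idx j < 4" using idx by (auto simp: bij_betw_def)
      then show "?X $$ (p (idx j), idx j) = Const (A $$ (p (idx j), idx j)) * Var (0, j) + Const (B (p (idx j)) (idx j)) * param n a j"
        using entry p4 pidx[OF j] by simp
    qed
    also have "\<dots> = (\<Sum>K\<in>Pow J. (\<Prod>j\<in>K. Const (A $$ (p (idx j), idx j)) * Var (0, j))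
        * (\<Prod>j\<in>J - K. Const (B (p (idx j)) (idx j)) * param n a j))"
      by (rule prod_add[OF finJ])
    finally show ?thesis
      by (simp add: sum_distrib_right sum_distrib_left \<epsilon>_def ymon_def prod.distrib Const_mult EC.hom_prod mult_ac)
  qed
  have detX: "det ?X = (\<Sum>K\<in>Pow J. ev Const (param n a) (h K) * ymon K)"
  proof -
    have "det ?X = (\<Sum>p | p permutes {0..<4}. \<Sum>K\<in>Pow J. Const (\<epsilon> p K) * (ymon K * (\<Prod>j\<in>J - K. param n a j)))"
      unfolding det_col[OF Xc]
    proof (intro sum.cong refl)
      fix p assume "p \<in> {p. p permutes {0..<4::nat}}"
      then show "signof p * (\<Prod>l<4. ?X $$ (p l, l)) = (\<Sum>K\<in>Pow J. Const (\<epsilon> p K) * (ymon K * (\<Prod>j\<in>J - K. param n a j)))"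
        using prod[of p] unfolding sg by (simp add: mult.commute)
    qed
    also have "\<dots> = (\<Sum>K\<in>Pow J. Const (E K) * (ymon K * (\<Prod>j\<in>J - K. param n a j)))"
      by (subst sum.swap) (simp add: E_def EC.hom_sum sum_distrib_right)
    also have "\<dots> = (\<Sum>K\<in>Pow J. ev Const (param n a) (h K) * ymon K)"
      by (simp add: h_def EC.ev_mult EC.E.hom_prod mult_ac)
    finally show ?thesis .
  qed
  have "E J = det A"
    unfolding E_def det_col[OF Ac]
    by (intro sum.cong refl) (simp add: \<epsilon>_def prod.reindex_bij_betw[OF idx, of "\<lambda>l. A $$ (_ l, l)"])
  then have "det ?X = Const (det A) * ymon J + (\<Sum>K\<in>Pow J - {J}. ev Const (param n a) (h K) * ymon K)"
    unfolding detX using finJ by (subst sum.remove[of _ J]) (auto simp: h_def)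
  also have "\<dots> = Const (det A) * ymon J - (\<Sum>K\<in>Pow J - {J}. ev Const (param n a) (- h K) * ymon K)"
    by (simp add: EC.E.hom_uminus sum_negf)
  finally have eq: "det ?X = \<dots>" .
  have "- h K \<in> polys_in {..<n + 3}" for K
    unfolding h_def using J by (intro polys_in_uminus polys_in_mult polys_in_prod polys_in_Var polys_in_Const) auto
  then show ?thesis using V mem unfolding eq
    by (intro exI[of _ "det A"] exI[of _ "\<lambda>K. - h K"] conjI allI) simp_all
qed


section \<open>Vanishing ideals and the quotient ring\<close>

lemma ideal_vanishing_ideal: "ideal (vanishing_ideal r n Y) (coord_ring r n)"
proof (rule idealI)
  interpret cring "coord_ring r n :: 'a mpoly ring" by (rule cring_coord_ring)
  show "ring (coord_ring r n :: 'a mpoly ring)" by (rule ring_axioms)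
  show "subgroup (vanishing_ideal r n Y) (add_monoid (coord_ring r n))"
  proof (rule group.subgroupI)
    show "group (add_monoid (coord_ring r n :: 'a mpoly ring))" by (rule a_group)
    have "0 \<in> vanishing_ideal r n Y" by (auto simp: vanishing_ideal_def carrier_coord_ring eval_at_ev)
    then show "vanishing_ideal r n Y \<noteq> {}" by blast
    fix p assume p: "p \<in> vanishing_ideal r n Y"
    have "\<ominus>\<^bsub>coord_ring r n\<^esub> p = - p"
      using p by (intro minus_equality) (auto simp: vanishing_ideal_def carrier_coord_ring coord_ring_simps)
    moreover have "- p \<in> vanishing_ideal r n Y"
      using p by (auto simp: vanishing_ideal_def carrier_coord_ring eval_at_ev EI.E.hom_uminus)
    ultimately show "inv\<^bsub>add_monoid (coord_ring r n)\<^esub> p \<in> vanishing_ideal r n Y" by (simp add: a_inv_def)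
  qed (auto simp: vanishing_ideal_def carrier_coord_ring coord_ring_simps eval_at_ev EI.ev_add)
  fix p q :: "'a mpoly" assume "p \<in> vanishing_ideal r n Y" "q \<in> carrier (coord_ring r n)"
  then show "q \<otimes>\<^bsub>coord_ring r n\<^esub> p \<in> vanishing_ideal r n Y" "p \<otimes>\<^bsub>coord_ring r n\<^esub> q \<in> vanishing_ideal r n Y"
    by (auto simp: vanishing_ideal_def carrier_coord_ring coord_ring_simps eval_at_ev EI.ev_mult)
qed

lemma vanishing_ideal_zariski_closure:
  assumes "Y \<subseteq> carrier_mat r n"
  shows "vanishing_ideal r n (zariski_closure r n Y) = vanishing_ideal r n Y"
proof
  have "Y \<subseteq> zariski_closure r n Y" by (auto simp: zariski_closure_def)
  then show "vanishing_ideal r n (zariski_closure r n Y) \<subseteq> vanishing_ideal r n Y"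
    by (auto simp: vanishing_ideal_def)
  show "vanishing_ideal r n Y \<subseteq> vanishing_ideal r n (zariski_closure r n Y)"
  proof
    fix p assume p: "p \<in> vanishing_ideal r n Y"
    then have "Y \<subseteq> zero_locus r n {p}" "{p} \<subseteq> carrier (coord_ring r n)"
      using assms by (auto simp: zero_locus_def vanishing_ideal_def)
    then have "zariski_closure r n Y \<subseteq> zero_locus r n {p}"
      unfolding zariski_closure_def by blast
    then show "p \<in> vanishing_ideal r n (zariski_closure r n Y)"
      using p by (auto simp: vanishing_ideal_def zero_locus_def)
  qed
qed

lemma ideal_coord_ringD:
  assumes "ideal I (coord_ring r n)"
  shows "I \<subseteq> polys_in ({..<r} \<times> {..<n})" "0 \<in> I" "p \<in> I \<Longrightarrow> q \<in> I \<Longrightarrow> p + q \<in> I"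
    "p \<in> polys_in ({..<r} \<times> {..<n}) \<Longrightarrow> q \<in> I \<Longrightarrow> p * q \<in> I"
proof -
  interpret ideal I "coord_ring r n" by fact
  show "I \<subseteq> polys_in ({..<r} \<times> {..<n})" using Icarr by (auto simp: carrier_coord_ring)
  show "0 \<in> I" "p \<in> I \<Longrightarrow> q \<in> I \<Longrightarrow> p + q \<in> I"
    using additive_subgroup.zero_closed[OF additive_subgroup_axioms]
      additive_subgroup.a_closed[OF additive_subgroup_axioms, of p q] by (simp_all add: coord_ring_simps)
  show "p \<in> polys_in ({..<r} \<times> {..<n}) \<Longrightarrow> q \<in> I \<Longrightarrow> p * q \<in> I"
    using I_l_closed[of q p] by (simp add: coord_ring_simps carrier_coord_ring)
qed

lemma quotient_cohen_macaulay:
  fixes I :: "'k::alg_closed_field mpoly set" and e :: "'s \<Rightarrow> 'k mpoly" and \<theta> :: "nat \<Rightarrow> 'k mpoly"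
  assumes I: "ideal I (coord_ring 2 n)" and fin: "finite \<S>"
    and th: "\<And>i. \<theta> i \<in> polys_in ({..<2} \<times> {..<n})"
    and e: "\<And>S. S \<in> \<S> \<Longrightarrow> e S \<in> polys_in ({..<2} \<times> {..<n})"
    and span: "\<And>p. p \<in> polys_in ({..<2} \<times> {..<n}) \<Longrightarrow>
      \<exists>b. (\<forall>S. b S \<in> polys_in {..<d}) \<and> p - (\<Sum>S\<in>\<S>. ev Const \<theta> (b S) * e S) \<in> I"
    and indep: "\<And>b S. (\<And>S. S \<in> \<S> \<Longrightarrow> b S \<in> polys_in {..<d}) \<Longrightarrow>
      (\<Sum>S\<in>\<S>. ev Const \<theta> (b S) * e S) \<in> I \<Longrightarrow> S \<in> \<S> \<Longrightarrow> b S = 0"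
  shows "cohen_macaulay (coord_ring 2 n Quot I)"
proof -
  let ?R = "polys_in ({..<2} \<times> {..<n}) :: 'k mpoly set" and ?A = "coord_ring 2 n Quot I"
  interpret R: cring "coord_ring 2 n :: 'k mpoly ring" by (rule cring_coord_ring)
  interpret I: ideal I "coord_ring 2 n" by fact
  \<comment> \<open>The type has indeterminates for all index pairs. Sending the surplus ones to 0
    gives a retraction onto the coordinate ring and makes \<open>\<psi>\<close> total.\<close>
  define \<rho> :: "'k mpoly \<Rightarrow> 'k mpoly" where "\<rho> = ev Const (\<lambda>ij. if ij \<in> {..<2} \<times> {..<n} then Var ij else 0)"
  have \<rho>_in: "\<rho> p \<in> ?R" for p
    unfolding \<rho>_def by (rule ev_Const_in[where V = UNIV]) auto
  have \<rho>_id: "\<rho> p = p" if "p \<in> ?R" for p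
  proof -
    have "\<rho> p = ev Const Var p" unfolding \<rho>_def by (rule EC.ev_cong[OF that]) simp
    then show ?thesis by (simp add: ev_Const_Var)
  qed
  define \<psi> where "\<psi> p = I +>\<^bsub>coord_ring 2 n\<^esub> \<rho> p" for p
  have hom: "(+>\<^bsub>coord_ring 2 n\<^esub>) I \<in> Ring.ring_hom (coord_ring 2 n) ?A" by (rule I.rcos_ring_hom)
  have \<rho>c: "\<rho> p \<in> carrier (coord_ring 2 n)" for p using \<rho>_in by (simp add: carrier_coord_ring)
  have closed: "\<psi> p \<in> carrier ?A" for p unfolding \<psi>_def using ring_hom_closed[OF hom \<rho>c] .
  have add: "\<psi> (p + q) = \<psi> p \<oplus>\<^bsub>?A\<^esub> \<psi> q" for p q
    using ring_hom_add[OF hom \<rho>c \<rho>c, of p q] by (simp add: \<psi>_def \<rho>_def EC.ev_add coord_ring_simps)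
  have mult: "\<psi> (p * q) = \<psi> p \<otimes>\<^bsub>?A\<^esub> \<psi> q" for p q
    using ring_hom_mult[OF hom \<rho>c \<rho>c, of p q] by (simp add: \<psi>_def \<rho>_def EC.ev_mult coord_ring_simps)
  have one: "\<psi> 1 = \<one>\<^bsub>?A\<^esub>"
    using ring_hom_one[OF hom] by (simp add: \<psi>_def \<rho>_def coord_ring_simps)
  have zero: "\<psi> p = \<zero>\<^bsub>?A\<^esub> \<longleftrightarrow> \<rho> p \<in> I" for p
    using I.rcos_const_imp_mem[OF \<rho>c, of p] R.a_rcos_zero[OF I, of "\<rho> p"]
    by (auto simp: \<psi>_def FactRing_def)
  interpret A: cring ?A by (rule I.quotient_is_cring[OF R.cring_axioms])
  \<comment> \<open>The matrix entries are listed by one index: entry (i, j) has number 2 j +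
    i.\<close>
  define u :: "nat \<Rightarrow> 'k mpoly" where "u k = Var (k mod 2, k div 2)" for k
  have gen: "p \<in> EC.alg u (2 * n)" if "p \<in> ?R" for p
    using that
  proof (induction rule: polys_induct)
    case (Var ij)
    then obtain i j where ij: "ij = (i, j)" "i < 2" "j < n" by auto
    then have "2 * j + i < 2 * n" by simp
    then have "u (2 * j + i) \<in> EC.alg u (2 * n)" by (rule EC.alg_gen)
    moreover have "u (2 * j + i) = Var ij" using ij by (simp add: u_def)
    ultimately show ?case by simp
  qed (auto intro: EC.alg_const EC.alg_add EC.alg_mult)
  have surj: "\<exists>p\<in>EC.alg u (2 * n). a = \<psi> p" if a: "a \<in> carrier ?A" for a
  proof -
    obtain p where p: "p \<in> ?R" "a = I +>\<^bsub>coord_ring 2 n\<^esub> p"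
      using a by (auto simp: FactRing_def A_RCOSETS_def' carrier_coord_ring)
    then show ?thesis using gen[OF p(1)] by (intro bexI[of _ p]) (simp_all add: \<psi>_def \<rho>_id)
  qed
  have sumR: "(\<Sum>S\<in>\<S>. ev Const \<theta> (b S) * e S) \<in> ?R" for b
    using e th by (intro polys_in_sum polys_in_mult ev_Const_in[where V = UNIV]) auto
  interpret free_algebra ?A Const \<psi> u "2 * n" \<theta> d \<S> e
  proof unfold_locales
    fix p
    obtain b where b: "\<forall>S. b S \<in> polys_in {..<d}" "\<rho> p - (\<Sum>S\<in>\<S>. ev Const \<theta> (b S) * e S) \<in> I"
      using span[OF \<rho>_in] by blast
    let ?s = "\<Sum>S\<in>\<S>. ev Const \<theta> (b S) * e S"
    have "\<rho> (\<rho> p - ?s) = \<rho> p - ?s" using sumR \<rho>_in by (intro \<rho>_id) auto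
    then have "\<psi> (\<rho> p - ?s) = \<zero>\<^bsub>?A\<^esub>" using b(2) zero by simp
    then have "\<psi> ((\<rho> p - ?s) + ?s) = \<psi> ?s" unfolding add using closed by simp
    moreover have "\<psi> (\<rho> p) = \<psi> p" using \<rho>_id[OF \<rho>_in] by (simp add: \<psi>_def)
    ultimately have "\<psi> p = \<psi> ?s" by simp
    then show "\<exists>b. (\<forall>S. b S \<in> polys_in {..<d}) \<and> \<psi> p = \<psi> (\<Sum>S\<in>\<S>. ev Const \<theta> (b S) * e S)"
      using b(1) by blast
  next
    fix b S assume b: "\<And>S. S \<in> \<S> \<Longrightarrow> b S \<in> polys_in {..<d}"
      and z: "\<psi> (\<Sum>S\<in>\<S>. ev Const \<theta> (b S) * e S) = \<zero>\<^bsub>?A\<^esub>" and S: "S \<in> \<S>"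
    have "(\<Sum>S\<in>\<S>. ev Const \<theta> (b S) * e S) \<in> I" using z zero \<rho>_id[OF sumR] by simp
    with b show "b S = 0" using S by (rule indep[where b = b])
  qed (use closed add mult one surj fin in auto)
  show ?thesis by (rule cohen_macaulay_A)
qed

text \<open>Independence is required for values on \<open>Y\<close>, which is stronger than
  independence modulo \<open>I\<close>. A polynomial vanishing on \<open>Y\<close> is reduced modulo
  \<open>I\<close> to a combination of the \<open>e S\<close>, whose coefficients must then be 0, so
  the polynomial lies in \<open>I\<close>.\<close>

lemma vanishing_ideal_cohen_macaulay:
  fixes I :: "'k::alg_closed_field mpoly set" and e :: "'s \<Rightarrow> 'k mpoly" and \<theta> :: "nat \<Rightarrow> 'k mpoly"
  assumes I: "ideal I (coord_ring 2 n)" and sub: "I \<subseteq> vanishing_ideal 2 n Y" and fin: "finite \<S>"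
    and th: "\<And>i. \<theta> i \<in> polys_in ({..<2} \<times> {..<n})"
    and e: "\<And>S. S \<in> \<S> \<Longrightarrow> e S \<in> polys_in ({..<2} \<times> {..<n})"
    and span: "\<And>p. p \<in> polys_in ({..<2} \<times> {..<n}) \<Longrightarrow>
      \<exists>b. (\<forall>S. b S \<in> polys_in {..<d}) \<and> p - (\<Sum>S\<in>\<S>. ev Const \<theta> (b S) * e S) \<in> I"
    and indep: "\<And>b S. (\<And>S. S \<in> \<S> \<Longrightarrow> b S \<in> polys_in {..<d}) \<Longrightarrow>
      (\<And>y. y \<in> Y \<Longrightarrow> eval_at y (\<Sum>S\<in>\<S>. ev Const \<theta> (b S) * e S) = 0) \<Longrightarrow> S \<in> \<S> \<Longrightarrow> b S = 0"
  shows "I = vanishing_ideal 2 n Y \<and> cohen_macaulay (coord_ring 2 n Quot I)"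
proof
  show "I = vanishing_ideal 2 n Y"
  proof
    show "vanishing_ideal 2 n Y \<subseteq> I"
    proof
      fix p assume p: "p \<in> vanishing_ideal 2 n Y"
      then obtain b where b: "\<forall>S. b S \<in> polys_in {..<d}" "p - (\<Sum>S\<in>\<S>. ev Const \<theta> (b S) * e S) \<in> I"
        using span[of p] by (auto simp: vanishing_ideal_def carrier_coord_ring)
      let ?s = "\<Sum>S\<in>\<S>. ev Const \<theta> (b S) * e S"
      have "eval_at y ?s = 0" if y: "y \<in> Y" for y
      proof -
        have "eval_at y (p - ?s) = 0" using b(2) sub y by (auto simp: vanishing_ideal_def)
        moreover have "eval_at y p = 0" using p y by (simp add: vanishing_ideal_def)
        ultimately show ?thesis unfolding eval_at_ev by (simp add: EI.E.hom_minus)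
      qed
      then have "b S = 0" if "S \<in> \<S>" for S using indep[of b S] b(1) that by blast
      then have "?s = 0" by simp
      then show "p \<in> I" using b(2) by simp
    qed
  qed (rule sub)
  have "b S = 0" if "\<And>S. S \<in> \<S> \<Longrightarrow> b S \<in> polys_in {..<d}" "(\<Sum>S\<in>\<S>. ev Const \<theta> (b S) * e S) \<in> I" "S \<in> \<S>" for b S
    using indep[of b S] that sub by (auto simp: vanishing_ideal_def)
  then show "cohen_macaulay (coord_ring 2 n Quot I)"
    using quotient_cohen_macaulay[where \<theta> = \<theta> and e = e, OF I fin th e span] by blast
qed

text \<open>Adding \<alpha> times the second row to the first makes its entries nonzero, and \<beta>
  translates the ratios until no two of them are opposite. Finitely many values of each are bad, and
  the field is infinite; solving 2 \<beta> = -(b_i + b_j) uses that 2 is invertible.\<close>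

lemma normal_form:
  fixes v :: "'k::field_char_0 mat"
  assumes v: "v \<in> carrier_mat 2 n" and u: "uniform_rank_two v"
  obtains \<alpha> \<beta> c a where "\<And>j. j < n \<Longrightarrow> c j \<noteq> 0" "\<And>j. j < n \<Longrightarrow> c j = v $$ (0, j) + \<alpha> * v $$ (1, j)"
    "\<And>j. j < n \<Longrightarrow> c j * a j = v $$ (1, j) + \<beta> * c j"
    "\<And>i j. i < n \<Longrightarrow> j < n \<Longrightarrow> i \<noteq> j \<Longrightarrow> a i \<noteq> a j"
    "\<And>i j. i < n \<Longrightarrow> j < n \<Longrightarrow> i \<noteq> j \<Longrightarrow> a i + a j \<noteq> 0"
proof -
  note minor = uniform_rank_two_minor[OF v u]
  have n2: "2 \<le> n" using u v by (auto simp: uniform_rank_two_def)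
  have inf: "infinite (UNIV :: 'k set)" by (rule infinite_UNIV_char_0)
  \<comment> \<open>When the lower entry is 0 the quotient is 0 by convention, which merely excludes
    one more value. Such a column needs no condition on \<alpha>: its upper entry is nonzero, since
    otherwise a minor would vanish.\<close>
  have "finite ((\<lambda>j. - v $$ (0, j) / v $$ (1, j)) ` {..<n})" by simp
  then obtain \<alpha> where \<alpha>: "\<alpha> \<notin> (\<lambda>j. - v $$ (0, j) / v $$ (1, j)) ` {..<n}"
    using inf ex_new_if_finite by blast
  define c where "c j = v $$ (0, j) + \<alpha> * v $$ (1, j)" for j
  have c0: "c j \<noteq> 0" if j: "j < n" for j
  proof
    assume 0: "c j = 0"
    show False
    proof (cases "v $$ (1, j) = 0")
      case True
      obtain i where i: "i < n" "i \<noteq> j"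
        using n2 that[of 0] by (cases "j = 0") (auto intro: that[of 1])
      show False using minor[OF i(1) j i(2)] 0 True by (simp add: c_def)
    next
      case False
      then have "\<alpha> = - v $$ (0, j) / v $$ (1, j)" using 0 by (simp add: c_def field_simps eq_neg_iff_add_eq_0)
      then show False using \<alpha> j by blast
    qed
  qed
  define b where "b j = v $$ (1, j) / c j" for j
  have b: "b i \<noteq> b j" if "i < n" "j < n" "i \<noteq> j" for i j
  proof
    assume "b i = b j"
    then have "v $$ (1, i) * c j = v $$ (1, j) * c i" using c0 that by (simp add: b_def field_simps)
    then show False using minor[OF that] by (simp add: c_def algebra_simps)
  qed
  have "finite ((\<lambda>(i, j). - (b i + b j) / 2) ` ({..<n} \<times> {..<n}))" by simp
  then obtain \<beta> where \<beta>: "\<beta> \<notin> (\<lambda>(i, j). - (b i + b j) / 2) ` ({..<n} \<times> {..<n})"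
    using inf ex_new_if_finite by blast
  show thesis
  proof (rule that[of c \<alpha> "\<lambda>j. b j + \<beta>" \<beta>])
    fix i j assume ij: "i < n" "j < n" "i \<noteq> j"
    show "b i + \<beta> \<noteq> b j + \<beta>" using b[OF ij] by simp
    show "b i + \<beta> + (b j + \<beta>) \<noteq> 0"
    proof
      assume "b i + \<beta> + (b j + \<beta>) = 0"
      then have "\<beta> + \<beta> = - (b i + b j)" by (simp add: eq_neg_iff_add_eq_0 algebra_simps)
      then have "\<beta> = - (b i + b j) / 2" by (metis mult_2 nonzero_mult_div_cancel_left zero_neq_numeral)
      then show False using \<beta> ij by force
    qed
  next
    fix j assume j: "j < n"
    show "c j = v $$ (0, j) + \<alpha> * v $$ (1, j)" by (rule c_def)
    show "c j * (b j + \<beta>) = v $$ (1, j) + \<beta> * c j" using c0[OF j] by (simp add: b_def algebra_simps)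
  qed (rule c0)
qed

theorem proposition4p7:
  fixes n :: nat
    and v :: "'k::{alg_closed_field, field_char_0} mat"
    and perp :: "nat set \<Rightarrow> 'k mat"
  assumes "v \<in> carrier_mat 2 n"
    and "uniform_rank_two v"
    and "\<And>J. J \<subseteq> {..<n} \<Longrightarrow> J \<noteq> {} \<Longrightarrow> is_perp (column_submatrix v J) (perp J)"
  shows "minor_ideal 2 n perp = orbit_ideal 2 n v \<and>
         cohen_macaulay (coord_ring 2 n Quot minor_ideal 2 n perp)"
proof -
  note v = assms(1) and u = assms(2) and P = assms(3)
  let ?R = "polys_in ({..<2} \<times> {..<n}) :: 'k mpoly set"
  have n2: "2 \<le> n" using u v by (auto simp: uniform_rank_two_def)
  interpret R: cring "coord_ring 2 n :: 'k mpoly ring" by (rule cring_coord_ring)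
  define G where "G = (\<Union>J\<in>{J. J \<subseteq> {..<n} \<and> J \<noteq> {}}. minors (card J) (perp_matrix n J (perp J)))"
  define I where "I = minor_ideal 2 n perp"
  have IG: "I = genideal (coord_ring 2 n) G" by (simp add: I_def minor_ideal_def G_def)
  have G: "G \<subseteq> vanishing_ideal 2 n (orbit 2 n v)"
  proof
    fix f assume "f \<in> G"
    then obtain J where J: "J \<subseteq> {..<n}" "J \<noteq> {}" "f \<in> minors (card J) (perp_matrix n J (perp J))"
      by (auto simp: G_def)
    show "f \<in> vanishing_ideal 2 n (orbit 2 n v)"
      using minors_vanish[OF v J(1,2) P[OF J(1,2)] J(3)] by (auto simp: vanishing_ideal_def carrier_coord_ring)
  qed
  then have Gc: "G \<subseteq> carrier (coord_ring 2 n)" by (auto simp: vanishing_ideal_def)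
  have I: "ideal I (coord_ring 2 n)" unfolding IG by (rule R.genideal_ideal[OF Gc])
  have sub: "I \<subseteq> vanishing_ideal 2 n (orbit 2 n v)"
    unfolding IG by (rule R.genideal_minimal[OF ideal_vanishing_ideal G])
  have oi: "orbit_ideal 2 n v = vanishing_ideal 2 n (orbit 2 n v)"
    unfolding orbit_ideal_def orbit_closure_def
    by (rule vanishing_ideal_zariski_closure) (use orbit_entries(1)[OF v] in blast)
  have eval: "ev id x p = eval_at y p" if "p \<in> ?R" "\<forall>j<n. y $$ (0, j) = x (0, j) \<and> y $$ (1, j) = x (1, j)" for x y p
    unfolding eval_at_ev using that(2) by (intro EI.ev_cong[OF that(1)]) (auto simp: less_2_cases_iff)
  have "I = vanishing_ideal 2 n (orbit 2 n v) \<and> cohen_macaulay (coord_ring 2 n Quot I)"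
  proof (cases "n = 2")
    case True
    \<comment> \<open>With two columns the row operations alone fill an open set of matrices, so the
      dimension is 4 and not n + 3. The four entries are the parameters, and 1 is the only basis
      element.\<close>
    define \<theta> :: "nat \<Rightarrow> 'k mpoly" where "\<theta> k = (if k < 4 then Var (k mod 2, k div 2) else 0)" for k
    have th: "\<theta> k \<in> ?R" for k using True by (auto simp: \<theta>_def)
    have gen: "\<exists>b\<in>polys_in {..<4}. p = ev Const \<theta> b" if "p \<in> ?R" for p
      using that
    proof (induction rule: polys_induct)
      case (Const c)
      show ?case by (intro bexI[of _ "Const c"]) auto
    next
      case (Var ij)
      then obtain i j where ij: "ij = (i, j)" "i < 2" "j < 2" using True by auto
      then show ?case by (intro bexI[of _ "Var (2 * j + i)"]) (auto simp: \<theta>_def)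
    next
      case (add p q)
      then show ?case by (metis EC.ev_add polys_in_add)
    next
      case (mult p q)
      then show ?case by (metis EC.ev_mult polys_in_mult)
    qed
    define \<Delta> where "\<Delta> = v $$ (0, 0) * v $$ (1, 1) - v $$ (0, 1) * v $$ (1, 0)"
    have \<Delta>: "\<Delta> \<noteq> 0" unfolding \<Delta>_def using True by (intro uniform_rank_two_minor[OF v u]) auto
    have zero: "b = 0" if b: "b \<in> polys_in {..<4}" and van: "\<And>y. y \<in> orbit 2 n v \<Longrightarrow> eval_at y (ev Const \<theta> b) = 0" for b
    proof (rule poly_zero_if_vanishing_generic)
      \<comment> \<open>Variables 0 and 1 stand for the first column, 2 and 3 for the second, so
        this is the determinant of the 2-by-2 matrix.\<close>
      let ?N = "Var 0 * Var 3 - Var 1 * Var 2 :: (nat \<Rightarrow>\<^sub>0 nat) \<Rightarrow>\<^sub>0 'k"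
      have evN: "ev id h ?N = h 0 * h 3 - h 1 * h 2" for h by (simp add: EI.ev_mult EI.E.hom_minus)
      show "?N \<noteq> 0"
      proof
        assume "?N = 0"
        then have "ev id (\<lambda>k. if k = 0 \<or> k = 3 then 1 else 0) ?N = 0" by simp
        then show False unfolding evN by simp
      qed
      fix h assume "ev id h ?N \<noteq> 0"
      then have h: "h 0 * h 3 - h 1 * h 2 \<noteq> 0" unfolding evN .
      \<comment> \<open>Cramer's rule: row operations alone carry \<open>v\<close> to the invertible
        matrix with entries \<open>h\<close>.\<close>
      define g where "g i k = (if k = 0 then h i * v $$ (1, 1) - h (2 + i) * v $$ (1, 0)
        else h (2 + i) * v $$ (0, 0) - h i * v $$ (0, 1)) / \<Delta>" for i k :: nat
      have g: "g i 0 * v $$ (0, 0) + g i 1 * v $$ (1, 0) = h i" "g i 0 * v $$ (0, 1) + g i 1 * v $$ (1, 1) = h (2 + i)" for i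
      proof -
        have "(h i * v $$ (1, 1) - h (2 + i) * v $$ (1, 0)) * v $$ (0, 0)
            + (h (2 + i) * v $$ (0, 0) - h i * v $$ (0, 1)) * v $$ (1, 0) = h i * \<Delta>"
          by (simp add: \<Delta>_def algebra_simps)
        then show "g i 0 * v $$ (0, 0) + g i 1 * v $$ (1, 0) = h i"
          using \<Delta> by (simp add: g_def add_divide_distrib[symmetric])
        have "(h i * v $$ (1, 1) - h (2 + i) * v $$ (1, 0)) * v $$ (0, 1)
            + (h (2 + i) * v $$ (0, 0) - h i * v $$ (0, 1)) * v $$ (1, 1) = h (2 + i) * \<Delta>"
          by (simp add: \<Delta>_def algebra_simps)
        then show "g i 0 * v $$ (0, 1) + g i 1 * v $$ (1, 1) = h (2 + i)"
          using \<Delta> by (simp add: g_def add_divide_distrib[symmetric])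
      qed
      have "(g 0 0 * g 1 1 - g 0 1 * g 1 0) * \<Delta> = h 0 * h 3 - h 1 * h 2"
      proof -
        have "(g 0 0 * g 1 1 - g 0 1 * g 1 0) * \<Delta>
            = (g 0 0 * v $$ (0, 0) + g 0 1 * v $$ (1, 0)) * (g 1 0 * v $$ (0, 1) + g 1 1 * v $$ (1, 1))
              - (g 1 0 * v $$ (0, 0) + g 1 1 * v $$ (1, 0)) * (g 0 0 * v $$ (0, 1) + g 0 1 * v $$ (1, 1))"
          by (simp add: \<Delta>_def algebra_simps)
        also have "\<dots> = h 0 * h 3 - h 1 * h 2" unfolding g by (simp add: numeral_3_eq_3)
        finally show ?thesis .
      qed
      then have "g 0 0 * g 1 1 - g 0 1 * g 1 0 \<noteq> 0" using h by auto
      then obtain y where y: "y \<in> orbit 2 n v"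
          "\<forall>j<n. y $$ (0, j) = (g 0 0 * v $$ (0, j) + g 0 1 * v $$ (1, j)) * 1 \<and>
            y $$ (1, j) = (g 1 0 * v $$ (0, j) + g 1 1 * v $$ (1, j)) * 1"
        using orbit_mem[OF v, of "g 0 0" "g 1 1" "g 0 1" "g 1 0" "\<lambda>_. 1"] by auto
      have yh: "y $$ (k mod 2, k div 2) = h k" if "k < 4" for k
      proof -
        have "k = 0 \<or> k = 1 \<or> k = 2 \<or> k = 3" using that by linarith
        then show ?thesis
          using y(2)[rule_format, of 0] y(2)[rule_format, of 1] True g[of 0] g[of 1]
          by (auto simp: numeral_3_eq_3)
      qed
      have "eval_at y (ev Const \<theta> b) = ev id h b"
        unfolding eval_at_ev EI.ev_ev using yh by (intro EI.ev_cong[OF b]) (simp add: \<theta>_def)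
      then show "ev id h b = 0" using van[OF y(1)] by simp
    qed
    show ?thesis
    proof (rule vanishing_ideal_cohen_macaulay[where \<S> = "{()}" and e = "\<lambda>_. 1" and \<theta> = \<theta> and d = 4, OF I sub])
      fix p assume "p \<in> ?R"
      then obtain b where "b \<in> polys_in {..<4}" "p = ev Const \<theta> b" using gen by blast
      then show "\<exists>b. (\<forall>S. b S \<in> polys_in {..<4}) \<and> p - (\<Sum>S\<in>{()}. ev Const \<theta> (b S) * 1) \<in> I"
        using ideal_coord_ringD(2)[OF I] by (intro exI[of _ "\<lambda>_. b"]) simp
    next
      fix b :: "unit \<Rightarrow> (nat \<Rightarrow>\<^sub>0 nat) \<Rightarrow>\<^sub>0 'k" and S
      assume "\<And>S. S \<in> {()} \<Longrightarrow> b S \<in> polys_in {..<4}"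
        and "\<And>y. y \<in> orbit 2 n v \<Longrightarrow> eval_at y (\<Sum>S\<in>{()}. ev Const \<theta> (b S) * 1) = 0"
      then show "b S = 0" by (intro zero) auto
    qed (use th in auto)
  next
    case False
    then have n3: "3 \<le> n" using n2 by simp
    show ?thesis
    proof (rule normal_form[OF v u])
      fix \<alpha> \<beta> c a
      assume c: "\<And>j. j < n \<Longrightarrow> c j \<noteq> 0"
        and ca: "\<And>j. j < n \<Longrightarrow> c j = v $$ (0, j) + \<alpha> * v $$ (1, j)"
          "\<And>j. j < n \<Longrightarrow> c j * a j = v $$ (1, j) + \<beta> * c j"
        and a: "\<And>i j. i < n \<Longrightarrow> j < n \<Longrightarrow> i \<noteq> j \<Longrightarrow> a i \<noteq> a j"
          "\<And>i j. i < n \<Longrightarrow> j < n \<Longrightarrow> i \<noteq> j \<Longrightarrow> a i + a j \<noteq> 0"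
      interpret M: moment_points n a using n3 a by unfold_locales
      have inj: "inj_on a {..<n}" using a(1) by (auto simp: inj_on_def)
      note ID = ideal_coord_ringD[OF I]
      interpret M: minor_relations n a I
      proof unfold_locales
        fix J :: "nat set" assume J: "J \<subseteq> {..<n}" "card J = 4"
        then have J0: "J \<noteq> {}" by auto
        have "minors 4 (perp_matrix n J (perp J)) \<subseteq> G" using J J0 by (auto simp: G_def intro!: exI[of _ J])
        also have "G \<subseteq> I" unfolding IG by (rule R.genideal_self[OF Gc])
        finally have "minors 4 (perp_matrix n J (perp J)) \<subseteq> I" .
        then show "\<exists>V g. V \<noteq> 0 \<and> (\<forall>K. g K \<in> polys_in {..<n + 3}) \<and>
            Const V * ymon J - (\<Sum>K\<in>Pow J - {J}. ev Const (param n a) (g K) * ymon K) \<in> I"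
          using minor_four_expansion[OF v u J P[OF J(1) J0] c inj ca] by blast
      qed (use ID in auto)
      show "I = vanishing_ideal 2 n (orbit 2 n v) \<and> cohen_macaulay (coord_ring 2 n Quot I)"
      proof (rule vanishing_ideal_cohen_macaulay[where \<S> = "basis_sets n" and e = ymon and \<theta> = "param n a" and d = "n + 3", OF I sub finite_basis_sets M.param_in_R])
        fix S assume "S \<in> basis_sets n"
        then show "ymon S \<in> ?R" by (intro M.ymon_in_R M.basis_sets_sub)
      next
        fix b S assume b: "\<And>S. S \<in> basis_sets n \<Longrightarrow> b S \<in> polys_in {..<n + 3}" and S: "S \<in> basis_sets n"
          and van: "\<And>y. y \<in> orbit 2 n v \<Longrightarrow> eval_at y (\<Sum>S\<in>basis_sets n. ev Const (param n a) (b S) * ymon S) = 0"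
        let ?s = "\<Sum>S\<in>basis_sets n. ev Const (param n a) (b S) * ymon S"
        have sR: "?s \<in> ?R" by (intro polys_in_sum polys_in_mult M.subst_in_R M.ymon_in_R M.basis_sets_sub)
        have ev0: "ev id x ?s = 0" if x: "M.in_orbit x" for x
        proof -
          obtain t p0 p1 q0 q1 where pq: "p0 * q1 - p1 * q0 \<noteq> 0" "\<forall>j<n. t j \<noteq> 0"
              "\<forall>j<n. x (0, j) = t j * (p0 + p1 * a j) \<and> x (1, j) = t j * (q0 + q1 * a j)"
            using x unfolding M.in_orbit_def by blast
          \<comment> \<open>This undoes the normalization: r0 c_j + r1 c_j a_j is rewritten in the
            entries of column j of \<open>v\<close>. The change of coordinates has determinant 1, so
            invertibility carries over.\<close>
          define g where "g r0 r1 k = (if k = 0 then r0 + r1 * \<beta> else r0 * \<alpha> + r1 * (1 + \<alpha> * \<beta>))" for r0 r1 :: 'k and k :: nat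
          have row: "(g r0 r1 0 * v $$ (0, j) + g r0 r1 1 * v $$ (1, j)) * (t j / c j) = t j * (r0 + r1 * a j)"
            if j: "j < n" for r0 r1 j
          proof -
            have "g r0 r1 0 * v $$ (0, j) + g r0 r1 1 * v $$ (1, j)
                = r0 * (v $$ (0, j) + \<alpha> * v $$ (1, j)) + r1 * (v $$ (1, j) + \<beta> * (v $$ (0, j) + \<alpha> * v $$ (1, j)))"
              by (simp add: g_def algebra_simps)
            also have "\<dots> = (r0 + r1 * a j) * c j"
              unfolding ca(1)[OF j, symmetric] ca(2)[OF j, symmetric] by (simp add: algebra_simps)
            finally show ?thesis using c[OF j] by simp
          qed
          have "g p0 p1 0 * g q0 q1 1 - g p0 p1 1 * g q0 q1 0 = p0 * q1 - p1 * q0"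
            by (simp add: g_def algebra_simps)
          then have "\<exists>y\<in>orbit 2 n v. \<forall>j<n. y $$ (0, j) = (g p0 p1 0 * v $$ (0, j) + g p0 p1 1 * v $$ (1, j)) * (t j / c j) \<and>
              y $$ (1, j) = (g q0 q1 0 * v $$ (0, j) + g q0 q1 1 * v $$ (1, j)) * (t j / c j)"
            using pq c by (intro orbit_mem[OF v]) auto
          then obtain y where y: "y \<in> orbit 2 n v" "\<forall>j<n. y $$ (0, j) = x (0, j) \<and> y $$ (1, j) = x (1, j)"
            using row pq(3) by auto
          then show ?thesis using eval[OF sR y(2)] van[OF y(1)] by simp
        qed
        show "b S = 0" by (rule M.independence[where b = b, OF b ev0 S])
      qed (rule M.spanning)
    qed
  qed
  then show ?thesis unfolding oi I_def .
qed

end
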